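(* Let $\mu\in\mathcal P(\mathbb R^d)$, suppose $X\sim\nu$ satisfies $\|X\|_\psi\le K_\nu$, and let $f$ satisfy conditions (a)–(c) below with constants $L,M$. Let $\tilde{\mathrm Q}$ be a discrete-time Markov kernel on $\mathbb R^d$ with stationary distribution $\tilde\nu_{\tilde{\mathrm Q}}$ such that (i) there are $c_1\ge1$, $c_2>0$ with $W_\psi(\rho\tilde{\mathrm Q}^k,\tilde\nu_{\tilde{\mathrm Q}})\le c_1e^{-c_2k}W_\psi(\rho,\tilde\nu_{\tilde{\mathrm Q}})$ for all integers $k\ge1$ and all probability distributions $\rho$, and (ii) $W_\psi(\tilde\nu_{\tilde{\mathrm Q}},\nu)\le\Delta_h$ with $\Delta_h\ge0$, $\Delta_h\to0$ as $h\to0$. Let $1<q<\infty$ and set $s=2q-1$, $u^2=1+\frac1{4s}$ ($u>0$), $\delta_1=s\big(8dMT^2+\frac{3\sqrt d}{2T}\big)$, $\delta_2=\frac{9qs}{4T^2}$. Suppose $L(T^2+Th)\le\frac1{12}$, \[ \Delta_h\le\min\Big\{\frac{\sqrt{2\log2}}{4s\big(\frac{\sqrt d(6\sqrt d\,\mathsf j_{xy}+\mathsf p_{xy}u)}{\sqrt2}+h\sqrt d(6\sqrt d\,\mathsf j_x+\mathsf p_xu)\big)},\ \frac1{\sqrt{8s(\mathsf p_{xy}^2(1+3su^2)+2h^2\mathsf p_x^2(1+3su^2))}}\Big\}, \] \[ 0\le h\le\min\Big\{\frac{u-1}{\mathsf p_v},\ \frac{\sqrt{\log2}}{2\sqrt2\,s\sqrt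 d(6\sqrt d\,\mathsf j_x+\mathsf p_xu)K_\nu},\ \frac1{4K_\nu\mathsf p_x\sqrt{(1+3su^2)s}}\Big\}. \] Then for every integer $k\ge\frac1{c_2}\log\Big(\frac{c_1W_\psi(\mu,\tilde\nu_{\tilde{\mathrm Q}})}{4\sqrt{\log2}}\big(\delta_1+\sqrt{\delta_1^2+16(\log2)\delta_2}\big)\Big)$, \[ \mathsf R_q(\mu\tilde{\mathrm Q}^k\tilde{\mathrm P}_{T,h}\,\|\,\nu)\le\frac{3(\delta_1+\delta_2)}{2(2q-1)}\sqrt{\log2}\,c_1^2e^{-c_2k}\max\{1,W_\psi^2(\mu,\tilde\nu_{\tilde{\mathrm Q}})\}+B, \] where \begin{align*} B&=dh\big(6\mathsf j_c+6\sqrt d\,\mathsf j_v+108sdh\,\mathsf j_v^2+h\mathsf p_v^2+2\mathsf p_v\big)+2\sqrt d(6\sqrt d\,\mathsf j_{xy}+\mathsf p_{xy}u)\Delta_h+\mathsf p_{xy}^2(1+3su^2)\Delta_h^2\\ &\quad+2h\sqrt d(6\sqrt d\,\mathsf j_x+\mathsf p_xu)\big(\Delta_h+K_\nu+\sqrt{\Delta_h^2+K_\nu^2}\big)+2h^2\mathsf p_x^2(1+3su^2)(\Delta_h^2+K_\nu^2). \end{align*}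
   Context: Let $f:\mathbb R^d\to\mathbb R$, $\nu$ the probability measure with density proportional to $e^{-f}$. Conditions: (a) $f$ has global minimum at $0$, $f(0)=0$; (b) $f\in C^2$, $\|\nabla^2f(x)\|_{op}\le L$ for all $x$; (c) $f\in C^3$, $\|\nabla^3f(x)\|_{op}\le M$ (operator norms of symmetric multilinear forms w.r.t. unit vectors). Constants: $\mathsf p_{xy}=\frac3{2T}$, $\mathsf p_v=\frac7{25T}$, $\mathsf p_x=\frac{49}{180}L$, $\mathsf j_{xy}=\frac{11}2MT^2$, $\mathsf j_c=\frac{44}{135T}$, $\mathsf j_v=\frac{440}{135}MT^2$, $\mathsf j_x=\frac{352}{675}MT$. For $h>0$ with $T/h\in\mathbb N$ (always assumed), $\tilde q_{T,h}(x,v)=x_N$, $N=T/h$, where $x_0=x,v_0=v$, $x_{j+1}=x_j+hv_j-\frac{h^2}2\nabla f(x_j)$, $v_{j+1}=v_j-\frac h2(\nabla f(x_j)+\nabla f(x_{j+1}))$; for $h=0$, $\tilde q_{T,0}(x,v)$ is the time-$T$ position of the solution of $\dot x=v,\dot v=-\nabla f(x)$ from $(x,v)$. $\tilde{\mathrm P}_{T,h}$ maps $\rho$ to the law of $\tilde q_{T,h}(X,\xi)$, $X\sim\rho$, $\xi\sim\mathcal N(0,I_d)$ independent. $\|X\|_\psi=\inf\{\lambda>0:\mathbb E[e^{\|X\|^2/\lambda^2}]\le2\}$; $W_\psi(\mu,\pi)=\inf$ of $\|X-Y\|_\psi$ over couplings $(X,Y)$ of $\mu,\pi$. $\mathsf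 R_q(\mu\|\pi)=\frac1{q-1}\log\mathbb E_\pi[(d\mu/d\pi)^q]$ if $\mu\ll\pi$, else $+\infty$. *)

theory Defs
  imports "HOL-Probability.Probability"
begin

definition p_xy :: "real \<Rightarrow> real" where "p_xy T = 3 / (2 * T)"
definition p_v :: "real \<Rightarrow> real" where "p_v T = 7 / (25 * T)"
definition p_x :: "real \<Rightarrow> real" where "p_x L = 49 / 180 * L"
definition j_xy :: "real \<Rightarrow> real \<Rightarrow> real" where "j_xy M T = 11 / 2 * M * T^2"
definition j_c :: "real \<Rightarrow> real" where "j_c T = 44 / (135 * T)"
definition j_v :: "real \<Rightarrow> real \<Rightarrow> real" where "j_v M T = 440 / 135 * M * T^2"
definition j_x :: "real \<Rightarrow> real \<Rightarrow> real" where "j_x M T = 352 / 675 * M * T"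

definition target :: "('a::euclidean_space \<Rightarrow> real) \<Rightarrow> 'a measure" where
  "target f = density lborel
     (\<lambda>x. ennreal (exp (- f x) / (\<integral>y. exp (- f y) \<partial>lborel)))"

definition std_gauss :: "'a::euclidean_space measure" where
  "std_gauss = density lborel
     (\<lambda>v. ennreal ((2 * pi) powr (- real DIM('a) / 2) * exp (- (norm v * norm v) / 2)))"

definition leap_step :: "('a::real_normed_vector \<Rightarrow> 'a) \<Rightarrow> real \<Rightarrow> 'a \<times> 'a \<Rightarrow> 'a \<times> 'a" where
  "leap_step grad h = (\<lambda>(x, v).
     let x' = x + h *\<^sub>R v - (h^2 / 2) *\<^sub>R grad x
     in (x', v - (h / 2) *\<^sub>R (grad x + grad x')))"

definition ham_flow :: "('a::real_normed_vector \<Rightarrow> 'a) \<Rightarrow> real \<Rightarrow> 'a \<Rightarrow> 'a \<Rightarrow> 'a" where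
  "ham_flow grad T x v = (THE y. \<exists>X V. X 0 = x \<and> V 0 = v \<and>
      (\<forall>t. (X has_vector_derivative V t) (at t)) \<and>
      (\<forall>t. (V has_vector_derivative - grad (X t)) (at t)) \<and> y = X T)"

definition q_tilde :: "('a::real_normed_vector \<Rightarrow> 'a) \<Rightarrow> real \<Rightarrow> real \<Rightarrow> 'a \<Rightarrow> 'a \<Rightarrow> 'a" where
  "q_tilde grad T h x v =
     (if h = 0 then ham_flow grad T x v
      else fst ((leap_step grad h ^^ nat \<lfloor>T / h\<rfloor>) (x, v)))"

definition P_tilde :: "('a::euclidean_space \<Rightarrow> 'a) \<Rightarrow> real \<Rightarrow> real \<Rightarrow> 'a measure \<Rightarrow> 'a measure" where
  "P_tilde grad T h \<rho> = distr (\<rho> \<Otimes>\<^sub>M std_gauss) borel (\<lambda>(x, v). q_tilde grad T h x v)"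

definition kernel_pow :: "('a \<Rightarrow> 'a measure) \<Rightarrow> nat \<Rightarrow> 'a measure \<Rightarrow> 'a measure" where
  "kernel_pow Q k \<rho> = ((\<lambda>\<sigma>. \<sigma> \<bind> Q) ^^ k) \<rho>"

definition psi_norm :: "'b measure \<Rightarrow> ('b \<Rightarrow> 'a::real_normed_vector) \<Rightarrow> ennreal" where
  "psi_norm P g = Inf {ennreal r | r. r > 0 \<and>
      (\<integral>\<^sup>+x. ennreal (exp ((norm (g x))^2 / r^2)) \<partial>P) \<le> 2}"

definition couplings :: "'a::euclidean_space measure \<Rightarrow> 'a measure \<Rightarrow> ('a \<times> 'a) measure set" where
  "couplings \<mu> \<pi> = {P. prob_space P \<and> sets P = sets (borel :: ('a \<times> 'a) measure) \<and>
      distr P borel fst = \<mu> \<and> distr P borel snd = \<pi>}"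

definition W_psi :: "'a::euclidean_space measure \<Rightarrow> 'a measure \<Rightarrow> ennreal" where
  "W_psi \<mu> \<pi> = Inf {psi_norm P (\<lambda>(x, y). x - y) | P. P \<in> couplings \<mu> \<pi>}"

definition renyi :: "real \<Rightarrow> 'a measure \<Rightarrow> 'a measure \<Rightarrow> ereal" where
  "renyi q \<mu> \<pi> =
     (if absolutely_continuous \<pi> \<mu> then
        (let I = \<integral>\<^sup>+x. ennreal ((enn2real (RN_deriv \<pi> \<mu> x)) powr q) \<partial>\<pi>
         in if I = \<infinity> then \<infinity> else ereal (ln (enn2real I) / (q - 1)))
      else \<infinity>)"

end

theory Submission
  imports Defs
begin

text \<open>Couple \<open>X \<sim> \<mu> Q\<^sup>k\<close> and \<open>Y \<sim> \<nu>\<close> and write \<open>F = q\<^sub>h(X, \<cdot>)\<close> for the leapfrog map and \<open>G = q\<^sub>0(Y, \<cdot>)\<close>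
  for the exact flow. Since \<open>L T\<^sup>2 \<le> 1/12\<close>, \<open>G\<close> is \<open>T\<close> times a small perturbation of the identity, so
  \<open>F = G \<circ> \<Phi>\<close> for some \<open>\<Phi>\<close>. First and second differences of paths bound \<open>\<Phi>(v) - v\<close> and the
  Lipschitz constant of the inverse of \<open>\<Phi>\<close>, and Vitali's covering theorem turns the latter into
  a bound on volume distortion, without any derivative of the flow. Hence, with an explicit cost \<open>c\<close>,
  \<open>\<integral> g(F v) e\<^bsup>-c\<^esup> d\<gamma>(v) \<le> \<integral> g(G w) d\<gamma>(w)\<close>. Young's inequality, the stationarity of \<open>\<nu>\<close> under the
  exact flow and duality bound the Renyi divergence by \<open>log E exp((q - 1) c) / (q - 1)\<close>, and this moment
  is controlled by the Gaussian integral over \<open>v\<close> and the sub-Gaussian coupling of \<open>X\<close> and \<open>Y\<close>. The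
  coupling goes directly to \<open>\<nu>\<close>; the weak triangle inequality for Renyi divergences would
  lose a factor \<open>(q - 1/2) / (q - 1)\<close> that is unbounded as \<open>q\<close> tends to 1.\<close>

text \<open>Smallness of \<open>L * T^2\<close> replaces Gronwall throughout: a maximum over
  \<open>[0, T]\<close> reappears on the right with a factor 1/24 or 1/12 and is absorbed, which
  produces the constants 24/23 and 12/11. Neither Liouville's theorem nor smooth dependence of the
  flow on its data is established. What is wanted from them comes from leapfrog maps with step
  \<open>T / Suc N\<close>: they converge to the flow, so estimates for h = 0 are limits of
  estimates for h > 0; and they preserve volume while the flow conserves energy, which Fatou's lemma
  combines into stationarity. Leapfrog and exact paths are compared through the oscillation of the
  force over one step, so the error is of first order in h, as in \<open>B\<close>. The hypotheses
  are calibrated to \<open>s = 2 * q - 1\<close>, whereas the direct coupling only costs the moment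
  of order \<open>q - 1\<close>, less than \<open>s / 2\<close>; this factor of two pays for the
  roundings. Infima over couplings need not be attained, so an error \<open>e\<close> is carried
  along; strictness of the moment condition lets it tend to 0 at the end.\<close>

section \<open>Leapfrog paths and second-order equations\<close>

text \<open>The forces \<open>g\<close> and \<open>G\<close> enter as given data, not as functions
  of position. The recursion is therefore linear, and the estimate also applies to differences of
  two paths, or with the zero curve as \<open>X\<close>. Each step contributes the force error
  \<open>A\<close> at the grid points and the oscillation \<omega> of \<open>G\<close>; summing once
  gives the velocity bound, summing twice the position bound.\<close>

lemma leapfrog_error:
  fixes x v g :: "nat \<Rightarrow> 'a::euclidean_space" and X V G :: "real \<Rightarrow> 'a"
  assumes x_rec: "\<And>n. x (Suc n) = x n + h *\<^sub>R v n - (h^2 / 2) *\<^sub>R g n"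
    and v_rec: "\<And>n. v (Suc n) = v n - (h / 2) *\<^sub>R (g n + g (Suc n))"
    and X: "\<And>t. (X has_vector_derivative V t) (at t)"
    and V: "\<And>t. (V has_vector_derivative - G t) (at t)"
    and h: "0 < h"
    and A: "\<And>i. i \<le> N \<Longrightarrow> norm (g i - G (real i * h)) \<le> A"
    and om: "\<And>s s'. s \<in> {0..real N * h} \<Longrightarrow> s' \<in> {0..real N * h} \<Longrightarrow> \<bar>s - s'\<bar> \<le> h \<Longrightarrow> norm (G s - G s') \<le> \<omega>"
    and n: "n \<le> N"
  shows "norm (v n - V (real n * h) - (v 0 - V 0)) \<le> real n * h * (A + \<omega>)"
    and "norm (x n - X (real n * h) - (x 0 - X 0) - (real n * h) *\<^sub>R (v 0 - V 0))
           \<le> (real n * h)^2 / 2 * (A + \<omega>)"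
proof -
  \<comment> \<open>Defect of the exact path in one leapfrog step. After subtracting the mean of the
    two endpoint forces, or the force at \<open>t\<close>, the derivative is bounded by the
    oscillation of \<open>G\<close> alone.\<close>
  have local: "norm (V (t + h) - V t + (h / 2) *\<^sub>R (G t + G (t + h))) \<le> h * \<omega>"
    "norm (X (t + h) - X t - h *\<^sub>R V t + (h^2 / 2) *\<^sub>R G t) \<le> h^2 / 2 * \<omega>"
    if t: "t = real i * h" and i: "Suc i \<le> N" for t i
  proof -
    have rg: "s \<in> {0..real N * h}" if "s \<in> {t..t + h}" for s
    proof -
      have "t + h = real (Suc i) * h" using t by (simp add: algebra_simps)
      also have "\<dots> \<le> real N * h" using i h by (intro mult_right_mono) auto
      finally show ?thesis using that t h by (auto intro: order_trans[of 0 "real i * h"])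
    qed
    have osc: "norm (G s - G s') \<le> \<omega>" if "s \<in> {t..t + h}" "s' \<in> {t..t + h}" for s s'
      using that by (intro om rg) (auto simp: abs_le_iff)
    have "norm ((V (t+h) + (t+h-t) *\<^sub>R ((1/2) *\<^sub>R (G t + G (t+h)))) - (V t + (t-t) *\<^sub>R ((1/2) *\<^sub>R (G t + G (t+h)))))
        \<le> \<omega> * (t+h) - \<omega> * t"
    proof (rule differentiable_bound_general[where f="\<lambda>s. V s + (s-t) *\<^sub>R ((1/2) *\<^sub>R (G t + G (t+h)))"
          and \<phi>="\<lambda>s. \<omega> * s" and f'="\<lambda>s. - G s + (1/2) *\<^sub>R (G t + G (t+h))" and \<phi>'="\<lambda>s. \<omega>"])
      show "t < t + h" using h by simp
      show "continuous_on {t..t+h} (\<lambda>s. V s + (s-t) *\<^sub>R ((1/2) *\<^sub>R (G t + G (t+h))))"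
        by (intro continuous_intros continuous_at_imp_continuous_on ballI has_vector_derivative_continuous[OF V])
      show "((\<lambda>s. V s + (s-t) *\<^sub>R ((1/2) *\<^sub>R (G t + G (t+h)))) has_vector_derivative - G s + (1/2) *\<^sub>R (G t + G (t+h))) (at s)" for s
        by (auto intro!: derivative_eq_intros V)
      show "norm (- G s + (1/2) *\<^sub>R (G t + G (t+h))) \<le> \<omega>" if "t < s" "s < t + h" for s
      proof -
        have "- G s + (1/2) *\<^sub>R (G t + G (t+h)) = (1/2) *\<^sub>R (G t - G s) + (1/2) *\<^sub>R (G (t+h) - G s)"
          by (simp add: algebra_simps flip: scaleR_add_left)
        also have "norm \<dots> \<le> 1/2 * norm (G t - G s) + 1/2 * norm (G (t+h) - G s)"
          by (rule order_trans[OF norm_triangle_ineq]) simp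
        also have "\<dots> \<le> \<omega>" using osc[of t s] osc[of "t+h" s] that by auto
        finally show ?thesis .
      qed
    qed (auto intro!: derivative_eq_intros continuous_intros)
    then show "norm (V (t + h) - V t + (h / 2) *\<^sub>R (G t + G (t + h))) \<le> h * \<omega>"
      by (simp add: algebra_simps)
    have Vb: "norm (V s - V t + (s - t) *\<^sub>R G t) \<le> \<omega> * (s - t)" if s: "t < s" "s < t + h" for s
    proof -
      have "norm ((V s + (s-t) *\<^sub>R G t) - (V t + (t-t) *\<^sub>R G t)) \<le> \<omega> * s - \<omega> * t"
      proof (rule differentiable_bound_general[where f="\<lambda>s. V s + (s-t) *\<^sub>R G t"
          and \<phi>="\<lambda>s. \<omega> * s" and f'="\<lambda>s. - G s + G t" and \<phi>'="\<lambda>s. \<omega>"])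
        show "continuous_on {t..s} (\<lambda>s. V s + (s-t) *\<^sub>R G t)"
          by (intro continuous_intros continuous_at_imp_continuous_on ballI has_vector_derivative_continuous[OF V])
        show "((\<lambda>s. V s + (s-t) *\<^sub>R G t) has_vector_derivative - G s' + G t) (at s')" for s'
          by (auto intro!: derivative_eq_intros V)
        show "norm (- G s' + G t) \<le> \<omega>" if "t < s'" "s' < s" for s'
          using osc[of t s'] that s by auto
      qed (use s in \<open>auto intro!: derivative_eq_intros continuous_intros\<close>)
      then show ?thesis by (simp add: algebra_simps)
    qed
    have "norm ((X (t+h) - (t+h-t) *\<^sub>R V t + ((t+h-t)^2/2) *\<^sub>R G t) - (X t - (t-t) *\<^sub>R V t + ((t-t)^2/2) *\<^sub>R G t))
        \<le> \<omega> * (t+h-t)^2 / 2 - \<omega> * (t-t)^2/2"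
    proof (rule differentiable_bound_general[where f="\<lambda>s. X s - (s-t) *\<^sub>R V t + ((s-t)^2/2) *\<^sub>R G t"
          and \<phi>="\<lambda>s. \<omega> * (s-t)^2/2" and f'="\<lambda>s. V s - V t + (s-t) *\<^sub>R G t" and \<phi>'="\<lambda>s. \<omega> * (s - t)"])
      show "t < t + h" using h by simp
      show "continuous_on {t..t+h} (\<lambda>s. X s - (s-t) *\<^sub>R V t + ((s-t)^2/2) *\<^sub>R G t)"
        by (intro continuous_intros continuous_at_imp_continuous_on ballI has_vector_derivative_continuous[OF X]) auto
      show "((\<lambda>s. X s - (s-t) *\<^sub>R V t + ((s-t)^2/2) *\<^sub>R G t) has_vector_derivative V s - V t + (s-t) *\<^sub>R G t) (at s)" for s
        by (auto intro!: derivative_eq_intros X)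
      show "norm (V s - V t + (s-t) *\<^sub>R G t) \<le> \<omega> * (s - t)" if "t < s" "s < t + h" for s
        using Vb that by simp
      show "continuous_on {t..t+h} (\<lambda>s. \<omega> * (s-t)^2/2)" by (intro continuous_intros) auto
    qed (auto intro!: derivative_eq_intros simp: power2_eq_square field_simps)
    then show "norm (X (t + h) - X t - h *\<^sub>R V t + (h^2 / 2) *\<^sub>R G t) \<le> h^2 / 2 * \<omega>"
      by (simp add: algebra_simps)
  qed
  have n4: "norm (a - b - c - d) \<le> norm a + norm b + norm c + norm d" for a b c d :: 'a
    using norm_triangle_ineq4[of "a - b - c" d] norm_triangle_ineq4[of "a - b" c] norm_triangle_ineq4[of a b]
    by linarith
  have n4': "norm (a + b - c - d) \<le> norm a + norm b + norm c + norm d" for a b c d :: 'a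
    using n4[of a "- b" c d] by simp
  have "norm (v n - V (real n * h) - (v 0 - V 0)) \<le> real n * h * (A + \<omega>)
    \<and> norm (x n - X (real n * h) - (x 0 - X 0) - (real n * h) *\<^sub>R (v 0 - V 0))
           \<le> (real n * h)^2 / 2 * (A + \<omega>)"
    using n
  proof (induction n)
    case 0
    then show ?case by simp
  next
    case (Suc n)
    define t where "t = real n * h"
    have t': "real (Suc n) * h = t + h" by (simp add: t_def algebra_simps)
    note lo = local[OF t_def Suc.prems]
    have a0: "norm (g n - G t) \<le> A" using A[of n] Suc.prems by (simp add: t_def)
    have a1: "norm (g (Suc n) - G (t + h)) \<le> A" using A[of "Suc n"] Suc.prems by (simp only: t')
    have IHv: "norm (v n - V t - (v 0 - V 0)) \<le> t * (A + \<omega>)"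
      and IHx: "norm (x n - X t - (x 0 - X 0) - t *\<^sub>R (v 0 - V 0)) \<le> t^2 / 2 * (A + \<omega>)"
      using Suc by (auto simp: t_def)
    have dv: "v (Suc n) - V (t + h) - (v 0 - V 0) = (v n - V t - (v 0 - V 0))
       - (h/2) *\<^sub>R (g n - G t) - (h/2) *\<^sub>R (g (Suc n) - G (t+h))
       - (V (t + h) - V t + (h / 2) *\<^sub>R (G t + G (t + h)))"
      unfolding v_rec by (simp add: algebra_simps)
    have "norm (v (Suc n) - V (t + h) - (v 0 - V 0)) \<le> norm (v n - V t - (v 0 - V 0))
       + norm ((h/2) *\<^sub>R (g n - G t)) + norm ((h/2) *\<^sub>R (g (Suc n) - G (t+h)))
       + norm (V (t + h) - V t + (h / 2) *\<^sub>R (G t + G (t + h)))"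
      unfolding dv by (rule n4)
    also have "\<dots> \<le> t * (A + \<omega>) + h/2 * A + h/2 * A + h * \<omega>"
      using h a0 a1 by (intro add_mono IHv lo) (auto intro!: mult_left_mono)
    also have "\<dots> = (t + h) * (A + \<omega>)" by (simp add: algebra_simps)
    finally have v1: "norm (v (Suc n) - V (t + h) - (v 0 - V 0)) \<le> (t + h) * (A + \<omega>)" .
    have dx: "x (Suc n) - X (t + h) - (x 0 - X 0) - (t + h) *\<^sub>R (v 0 - V 0)
       = (x n - X t - (x 0 - X 0) - t *\<^sub>R (v 0 - V 0)) + h *\<^sub>R (v n - V t - (v 0 - V 0))
         - (h^2/2) *\<^sub>R (g n - G t) - (X (t + h) - X t - h *\<^sub>R V t + (h^2 / 2) *\<^sub>R G t)"
      unfolding x_rec by (simp add: algebra_simps)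
    have "norm (x (Suc n) - X (t + h) - (x 0 - X 0) - (t + h) *\<^sub>R (v 0 - V 0))
      \<le> norm (x n - X t - (x 0 - X 0) - t *\<^sub>R (v 0 - V 0)) + norm (h *\<^sub>R (v n - V t - (v 0 - V 0)))
         + norm ((h^2/2) *\<^sub>R (g n - G t)) + norm (X (t + h) - X t - h *\<^sub>R V t + (h^2 / 2) *\<^sub>R G t)"
      unfolding dx by (rule n4')
    also have "\<dots> \<le> t^2 / 2 * (A + \<omega>) + h * (t * (A + \<omega>)) + h^2/2 * A + h^2 / 2 * \<omega>"
      using h a0 IHv by (intro add_mono IHx lo) (auto intro!: mult_left_mono)
    also have "\<dots> = (t + h)^2 / 2 * (A + \<omega>)" by (simp add: power2_eq_square field_simps)
    finally show ?case using v1 unfolding t' by simp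
  qed
  then show "norm (v n - V (real n * h) - (v 0 - V 0)) \<le> real n * h * (A + \<omega>)"
    and "norm (x n - X (real n * h) - (x 0 - X 0) - (real n * h) *\<^sub>R (v 0 - V 0))
           \<le> (real n * h)^2 / 2 * (A + \<omega>)" by auto
qed

text \<open>With \<open>B\<close> the largest speed on \<open>[0, T]\<close>, the displacement is at
  most \<open>T * B\<close>, so the velocity changes by at most
  \<open>T * L * norm (Z 0) + B / 12\<close>. Moving \<open>B / 12\<close> to the left gives 12/11;
  for \<open>Z 0 = 0\<close> the change is then at most \<open>norm (U 0) / 11\<close>.\<close>

lemma second_order_bound:
  fixes Z U A :: "real \<Rightarrow> 'a::euclidean_space"
  assumes Z: "\<And>t. (Z has_vector_derivative U t) (at t)"
    and U: "\<And>t. (U has_vector_derivative A t) (at t)"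
    and A: "\<And>t. norm (A t) \<le> L * norm (Z t)"
    and L: "0 \<le> L" and T: "0 < T" and LT: "L * T^2 \<le> 1/12"
    and t: "t \<in> {0..T}"
  shows "norm (U t) \<le> 12/11 * (norm (U 0) + T * L * norm (Z 0))"
    and "Z 0 = 0 \<Longrightarrow> norm (Z t - t *\<^sub>R U 0) \<le> t * norm (U 0) / 11"
    and "Z 0 = 0 \<Longrightarrow> norm (Z t) \<le> 12/11 * t * norm (U 0)"
proof -
  have Uc: "continuous_on S U" for S
    by (intro continuous_at_imp_continuous_on ballI has_vector_derivative_continuous[OF U])
  have Zc: "continuous_on S Z" for S
    by (intro continuous_at_imp_continuous_on ballI has_vector_derivative_continuous[OF Z])
  obtain \<tau> where \<tau>: "\<tau> \<in> {0..T}" and \<tau>max: "\<And>s. s \<in> {0..T} \<Longrightarrow> norm (U s) \<le> norm (U \<tau>)"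
    using continuous_attains_sup[OF compact_Icc _ continuous_on_norm[OF Uc], of 0 T] T
    by (metis atLeastatMost_empty_iff2 less_eq_real_def linorder_not_le)
  define B where "B = norm (U \<tau>)"
  have Zb: "norm (Z s - Z 0) \<le> s * B" if "s \<in> {0..T}" for s
  proof (cases "s = 0")
    case False
    have "norm (Z s - Z 0) \<le> B * s - B * 0"
      by (rule differentiable_bound_general[where f'=U and \<phi>'="\<lambda>_. B"])
        (use that False Z Zc \<tau>max in \<open>auto intro!: derivative_eq_intros continuous_intros simp: B_def\<close>)
    then show ?thesis by (simp add: mult.commute)
  qed simp
  have Ub: "norm (U s - U 0) \<le> s * (L * C)" if "s \<in> {0..T}" and C: "\<And>s. s \<in> {0..T} \<Longrightarrow> norm (Z s) \<le> C" for s C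
  proof (cases "s = 0")
    case False
    have "norm (U s - U 0) \<le> (L * C) * s - (L * C) * 0"
    proof (rule differentiable_bound_general[where f'=A and \<phi>'="\<lambda>_. L * C"])
      show "norm (A s') \<le> L * C" if "0 < s'" "s' < s" for s'
        using \<open>s \<in> {0..T}\<close> that by (intro order_trans[OF A] mult_left_mono C L) auto
    qed (use that False U Uc in \<open>auto intro!: derivative_eq_intros continuous_intros\<close>)
    then show ?thesis by (simp add: mult.commute)
  qed simp
  have B0: "B \<ge> 0" by (simp add: B_def)
  have Zb2: "norm (Z s) \<le> norm (Z 0) + T * B" if "s \<in> {0..T}" for s
  proof -
    have "norm (Z s) \<le> norm (Z 0) + norm (Z s - Z 0)" using norm_triangle_ineq[of "Z 0" "Z s - Z 0"] by simp
    also have "norm (Z s - Z 0) \<le> T * B" using Zb[OF that] that B0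
      by (meson atLeastAtMost_iff mult_right_mono order_trans)
    finally show ?thesis by simp
  qed
  have LTB: "T * (L * (T * B)) \<le> B / 12"
    using mult_right_mono[OF LT B0] by (simp add: power2_eq_square mult_ac)
  have "norm (U \<tau> - U 0) \<le> \<tau> * (L * (norm (Z 0) + T * B))" by (rule Ub[OF \<tau> Zb2])
  also have "\<dots> \<le> T * (L * (norm (Z 0) + T * B))"
    using \<tau> L B0 T by (intro mult_right_mono mult_nonneg_nonneg) auto
  finally have "B \<le> norm (U 0) + T * (L * (norm (Z 0) + T * B))"
    using norm_triangle_ineq[of "U 0" "U \<tau> - U 0"] by (simp add: B_def)
  then have BB: "B \<le> 12/11 * (norm (U 0) + T * L * norm (Z 0))" using LTB by (simp add: algebra_simps)
  then show "norm (U t) \<le> 12/11 * (norm (U 0) + T * L * norm (Z 0))" using \<tau>max[OF t] by (simp add: B_def)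
  assume Z0: "Z 0 = 0"
  have BU: "B \<le> 12/11 * norm (U 0)" using BB Z0 by simp
  have Zt: "norm (Z s) \<le> T * B" if "s \<in> {0..T}" for s using Zb2[OF that] Z0 by simp
  have U11: "norm (U s - U 0) \<le> norm (U 0) / 11" if "s \<in> {0..T}" for s
  proof -
    have "norm (U s - U 0) \<le> s * (L * (T * B))" by (rule Ub[OF that Zt])
    also have "\<dots> \<le> T * (L * (T * B))" using that L B0 T by (intro mult_right_mono mult_nonneg_nonneg) auto
    also have "\<dots> \<le> B / 12" by (rule LTB)
    finally show ?thesis using BU by simp
  qed
  show "norm (Z t - t *\<^sub>R U 0) \<le> t * norm (U 0) / 11"
  proof (cases "t = 0")
    case False
    have "norm ((Z t - t *\<^sub>R U 0) - (Z 0 - 0 *\<^sub>R U 0)) \<le> norm (U 0) / 11 * t - norm (U 0) / 11 * 0"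
      by (rule differentiable_bound_general[where f'="\<lambda>s. U s - U 0" and \<phi>'="\<lambda>_. norm (U 0) / 11"])
        (use t False Zc U11 in \<open>auto intro!: derivative_eq_intros continuous_intros Z\<close>)
    then show ?thesis using Z0 by (simp add: mult.commute)
  qed (simp add: Z0)
  show "norm (Z t) \<le> 12/11 * t * norm (U 0)"
    using Zb[OF t] Z0 BU mult_left_mono[OF BU, of t] t by (auto simp: mult_ac)
qed

lemma Max_atMost_attained:
  fixes f :: "nat \<Rightarrow> real"
  obtains m where "m \<le> N" "Max (f ` {..N}) = f m"
proof -
  have "Max (f ` {..N}) \<in> f ` {..N}" by (rule Max_in) auto
  then obtain m where "m \<in> {..N}" "Max (f ` {..N}) = f m" by (rule imageE)
  then show ?thesis using that by simp
qed

lemma norm_diff_le_of_speed: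
  fixes X V :: "real \<Rightarrow> 'a::euclidean_space"
  assumes X: "\<And>t. (X has_vector_derivative V t) (at t)"
    and V: "\<And>t. t \<in> {0..T} \<Longrightarrow> norm (V t) \<le> C"
    and s: "s \<in> {0..T}" "s' \<in> {0..T}"
  shows "norm (X s - X s') \<le> C * \<bar>s - s'\<bar>"
proof -
  have "norm (X s - X s') \<le> C * norm (s - s')"
  proof (rule differentiable_bound[where S="{0..T}" and f'="\<lambda>t h. h *\<^sub>R V t"])
    show "(X has_derivative (\<lambda>h. h *\<^sub>R V t)) (at t within {0..T})" for t
      using X[of t] by (auto simp: has_vector_derivative_def intro: has_derivative_at_withinI)
    show "onorm (\<lambda>h. h *\<^sub>R V t) \<le> C" if "t \<in> {0..T}" for t
      using V[OF that] order_trans[OF norm_ge_zero V[OF that]] by (intro onorm_bound) (auto simp: mult.commute[of C] intro!: mult_left_mono)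
  qed (use s in auto)
  then show ?thesis by simp
qed

section \<open>Leapfrog and exact trajectories in a common force field\<close>

definition trajectory :: "('a::real_normed_vector \<Rightarrow> 'a) \<Rightarrow> (real \<Rightarrow> 'a) \<Rightarrow> (real \<Rightarrow> 'a) \<Rightarrow> bool" where
  "trajectory grad X V \<longleftrightarrow>
     (\<forall>t. (X has_vector_derivative V t) (at t)) \<and> (\<forall>t. (V has_vector_derivative - grad (X t)) (at t))"

definition leap_pos :: "('a::real_normed_vector \<Rightarrow> 'a) \<Rightarrow> real \<Rightarrow> 'a \<Rightarrow> 'a \<Rightarrow> nat \<Rightarrow> 'a" where
  "leap_pos grad h x v n = fst ((leap_step grad h ^^ n) (x, v))"

definition leap_vel :: "('a::real_normed_vector \<Rightarrow> 'a) \<Rightarrow> real \<Rightarrow> 'a \<Rightarrow> 'a \<Rightarrow> nat \<Rightarrow> 'a" where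
  "leap_vel grad h x v n = snd ((leap_step grad h ^^ n) (x, v))"

lemma leap_0 [simp]: "leap_pos grad h x v 0 = x" "leap_vel grad h x v 0 = v"
  by (simp_all add: leap_pos_def leap_vel_def)

lemma leap_pos_Suc:
  "leap_pos grad h x v (Suc n) =
     leap_pos grad h x v n + h *\<^sub>R leap_vel grad h x v n - (h^2 / 2) *\<^sub>R grad (leap_pos grad h x v n)"
  by (simp add: leap_pos_def leap_vel_def leap_step_def split_beta Let_def)

lemma leap_vel_Suc:
  "leap_vel grad h x v (Suc n) =
     leap_vel grad h x v n
       - (h / 2) *\<^sub>R (grad (leap_pos grad h x v n) + grad (leap_pos grad h x v (Suc n)))"
  unfolding leap_pos_Suc by (simp add: leap_pos_def leap_vel_def leap_step_def split_beta Let_def)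

text \<open>\<open>grad_four\<close> is the integrated form of a bound \<open>M\<close> on the third
  derivative of the potential. It allows second differences of paths to be estimated in the same way
  as first differences, without differentiating the force inside this locale.\<close>

locale force_field =
  fixes grad :: "'a::euclidean_space \<Rightarrow> 'a" and L M T :: real
  assumes grad_zero: "grad 0 = 0"
    and grad_lip: "\<And>a b. norm (grad a - grad b) \<le> L * norm (a - b)"
    and grad_four: "\<And>a b c e. norm (grad a - grad b - (grad c - grad e))
          \<le> L * norm (a - b - (c - e)) + M * max (norm (a - c)) (norm (b - e)) * norm (c - e)"
    and L_nonneg: "0 \<le> L" and M_nonneg: "0 \<le> M"
    and T_pos: "0 < T" and LT: "L * T^2 \<le> 1/12"
begin

lemma grad_norm: "norm (grad a) \<le> L * norm a"
  using grad_lip[of a 0] by (simp add: grad_zero)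

text \<open>The trajectory is compared with the rest point at the origin, where the force
  vanishes.\<close>

lemma trajectory_speed:
  assumes "trajectory grad X V" "t \<in> {0..T}"
  shows "norm (V t) \<le> 12/11 * (norm (V 0) + T * L * norm (X 0))"
  by (rule second_order_bound(1)[where A="\<lambda>t. - grad (X t)" and T=T])
    (use assms L_nonneg T_pos LT grad_norm in \<open>auto simp: trajectory_def\<close>)

lemma trajectory_diff:
  assumes "trajectory grad X V" "trajectory grad Y W" and 0: "X 0 = Y 0" and t: "t \<in> {0..T}"
  shows "norm (V t - W t) \<le> 12/11 * norm (V 0 - W 0)"
    and "norm (X t - Y t - t *\<^sub>R (V 0 - W 0)) \<le> t * norm (V 0 - W 0) / 11"
    and "norm (X t - Y t) \<le> 12/11 * t * norm (V 0 - W 0)"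
proof -
  have Z: "((\<lambda>t. X t - Y t) has_vector_derivative V t - W t) (at t)"
    and U: "((\<lambda>t. V t - W t) has_vector_derivative - (grad (X t) - grad (Y t))) (at t)" for t
    using assms by (auto simp: trajectory_def intro!: derivative_eq_intros)
  have A: "norm (- (grad (X t) - grad (Y t))) \<le> L * norm (X t - Y t)" for t
    using grad_lip[of "X t" "Y t"] by (simp add: norm_minus_commute)
  note b = second_order_bound[OF Z U A L_nonneg T_pos LT t]
  show "norm (V t - W t) \<le> 12/11 * norm (V 0 - W 0)" using b(1) 0 by simp
  show "norm (X t - Y t - t *\<^sub>R (V 0 - W 0)) \<le> t * norm (V 0 - W 0) / 11" using b(2) 0 by simp
  show "norm (X t - Y t) \<le> 12/11 * t * norm (V 0 - W 0)" using b(3) 0 by simp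
qed

text \<open>The difference of two leapfrog paths is compared with the zero curve, so \<omega> = 0
  and the force error is \<open>L\<close> times the largest difference \<open>S\<close>. Absorbing
  \<open>S / 24\<close> would give 1/23; the constant 1/11 is the one of the exact flow.\<close>

lemma leap_pos_diff:
  assumes h: "0 < h" and N: "real N * h = T"
  shows "norm (leap_pos grad h x v N - leap_pos grad h x v' N - T *\<^sub>R (v - v')) \<le> T * norm (v - v') / 11"
proof -
  let ?p = "\<lambda>i. leap_pos grad h x v i - leap_pos grad h x v' i"
  let ?g = "\<lambda>i. grad (leap_pos grad h x v i) - grad (leap_pos grad h x v' i)"
  let ?w = "\<lambda>i. leap_vel grad h x v i - leap_vel grad h x v' i"
  define S where "S = Max ((\<lambda>i. norm (?p i)) ` {..N})"
  have S: "norm (?p i) \<le> S" if "i \<le> N" for i using that by (auto simp: S_def)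
  have err: "norm (?p n - 0 - (?p 0 - 0) - (real n * h) *\<^sub>R (?w 0 - 0)) \<le> (real n * h)^2 / 2 * (L * S + 0)"
    if "n \<le> N" for n
  proof (rule leapfrog_error(2)[where X="\<lambda>_. 0" and V="\<lambda>_. 0" and G="\<lambda>_. 0" and N=N and g="?g" and v="?w"])
    show "?p (Suc n) = ?p n + h *\<^sub>R ?w n - (h\<^sup>2 / 2) *\<^sub>R ?g n" for n
      unfolding leap_pos_Suc by (simp add: algebra_simps)
    show "?w (Suc n) = ?w n - (h / 2) *\<^sub>R (?g n + ?g (Suc n))" for n
      unfolding leap_vel_Suc by (simp add: algebra_simps)
    show "norm (?g i - 0) \<le> L * S" if "i \<le> N" for i
      using grad_lip[of "leap_pos grad h x v i" "leap_pos grad h x v' i"] mult_left_mono[OF S[OF that] L_nonneg] by simp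
  qed (use h that in auto)
  have S0: "S \<ge> 0" using S[of 0] by (meson norm_ge_zero order_trans zero_le)
  have e: "norm (?p n - (real n * h) *\<^sub>R (v - v')) \<le> S / 24" if "n \<le> N" for n
  proof -
    have "real n * h \<le> T" unfolding N[symmetric] using that h by (intro mult_right_mono) auto
    then have "(real n * h)^2 \<le> T^2" using h by (intro power_mono) auto
    then have "(real n * h)^2 / 2 * (L * S) \<le> T^2/2 * (L * S)"
      using L_nonneg S0 by (intro mult_right_mono) auto
    also have "\<dots> \<le> S / 24" using mult_right_mono[OF LT S0] by (simp add: algebra_simps)
    finally have "(real n * h)^2 / 2 * (L * S) \<le> S / 24" .
    then show ?thesis using err[OF that] by (simp del: times_divide_eq_left)
  qed
  obtain n where n: "n \<le> N" "S = norm (?p n)"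
    unfolding S_def by (rule Max_atMost_attained)
  have "S \<le> norm ((real n * h) *\<^sub>R (v - v')) + norm (?p n - (real n * h) *\<^sub>R (v - v'))"
    using norm_triangle_ineq[of "(real n * h) *\<^sub>R (v - v')" "?p n - (real n * h) *\<^sub>R (v - v')"] n by simp
  also have "norm ((real n * h) *\<^sub>R (v - v')) \<le> T * norm (v - v')"
    unfolding N[symmetric] using n h by (auto intro!: mult_right_mono)
  finally have "S \<le> T * norm (v - v') + S / 24" using e[OF n(1)] by simp
  moreover have "0 \<le> T * norm (v - v')" using T_pos by simp
  ultimately have "S / 24 \<le> T * norm (v - v') / 11" by linarith
  then show ?thesis using e[of N] N by simp
qed

text \<open>The force error is \<open>L\<close> times the largest deviation \<open>E\<close>, and
  the oscillation over one step is at most \<open>L * (h * Vm)\<close>. The last two claims serve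
  the shooting problem: when the endpoints agree, the error estimate at the final time can be solved
  for \<open>T * \<phi>\<close>, which removes \<phi> from the bounds.\<close>

lemma shadow:
  assumes h: "0 < h" and N: "real N * h = T" and traj: "trajectory grad X V" and n: "n \<le> N"
    and Vm_def: "Vm = 12/11 * (norm (V 0) + T * L * norm (X 0))"
    and r: "r = norm (x - X 0)" and \<phi>: "\<phi> = norm (v - V 0)"
  shows "norm (leap_pos grad h x v n - X (real n * h)) \<le> 24/23 * (r + T * \<phi> + h * Vm / 24)"
    and "norm (leap_vel grad h x v n - V (real n * h)) \<le> \<phi> + T * L * (24/23 * (r + T * \<phi> + h * Vm / 24) + h * Vm)"
    and "leap_pos grad h x v N = X T \<Longrightarrow> norm (leap_pos grad h x v n - X (real n * h)) \<le> 12/11 * (2 * r + h * Vm / 12)"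
    and "leap_pos grad h x v N = X T \<Longrightarrow> T * \<phi> \<le> 12/11 * r + h * Vm / 22"
proof -
  let ?e = "\<lambda>i. leap_pos grad h x v i - X (real i * h)"
  define E where "E = Max ((\<lambda>i. norm (?e i)) ` {..N})"
  have E: "norm (?e i) \<le> E" if "i \<le> N" for i using that by (auto simp: E_def)
  have E0: "E \<ge> 0" using E[of 0] by (meson norm_ge_zero order_trans zero_le)
  have Vm0: "Vm \<ge> 0" unfolding Vm_def using T_pos L_nonneg by simp
  have osc: "norm (grad (X s) - grad (X s')) \<le> L * (h * Vm)"
    if "s \<in> {0..real N * h}" "s' \<in> {0..real N * h}" "\<bar>s - s'\<bar> \<le> h" for s s'
  proof -
    have "norm (X s - X s') \<le> Vm * \<bar>s - s'\<bar>"
      by (rule norm_diff_le_of_speed[where V=V and T=T])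
        (use that N traj trajectory_speed[OF traj] in \<open>auto simp: trajectory_def Vm_def\<close>)
    also have "\<dots> \<le> Vm * h" using that Vm0 by (intro mult_left_mono)
    finally show ?thesis using L_nonneg
      by (intro order_trans[OF grad_lip] mult_left_mono) (auto simp: mult.commute)
  qed
  have err: "norm (leap_vel grad h x v n - V (real n * h) - (v - V 0)) \<le> real n * h * (L * E + L * (h * Vm))"
    "norm (?e n - (x - X 0) - (real n * h) *\<^sub>R (v - V 0)) \<le> (real n * h)^2 / 2 * (L * E + L * (h * Vm))"
    if "n \<le> N" for n
  proof -
    have A: "norm (grad (leap_pos grad h x v i) - grad (X (real i * h))) \<le> L * E" if "i \<le> N" for i
      using grad_lip[of "leap_pos grad h x v i" "X (real i * h)"] mult_left_mono[OF E[OF that] L_nonneg] by simp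
    have X': "\<And>t. (X has_vector_derivative V t) (at t)" and V': "\<And>t. (V has_vector_derivative - grad (X t)) (at t)"
      using traj by (auto simp: trajectory_def)
    note le = leapfrog_error[where g="\<lambda>i. grad (leap_pos grad h x v i)" and G="\<lambda>t. grad (X t)",
        OF leap_pos_Suc leap_vel_Suc X' V' h A osc that]
    show "norm (leap_vel grad h x v n - V (real n * h) - (v - V 0)) \<le> real n * h * (L * E + L * (h * Vm))"
      using le(1) by simp
    show "norm (?e n - (x - X 0) - (real n * h) *\<^sub>R (v - V 0)) \<le> (real n * h)^2 / 2 * (L * E + L * (h * Vm))"
      using le(2) by simp
  qed
  have LEV: "0 \<le> L * E + L * (h * Vm)" using L_nonneg E0 Vm0 h by simp
  have tn: "real n * h \<le> T" if "n \<le> N" for n unfolding N[symmetric] using that h by (intro mult_right_mono) auto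
  have e: "norm (?e n - (x - X 0) - (real n * h) *\<^sub>R (v - V 0)) \<le> (E + h * Vm) / 24" if "n \<le> N" for n
  proof -
    have "(real n * h)^2 \<le> T^2" using h tn[OF that] by (intro power_mono) auto
    then have "(real n * h)^2 / 2 * (L * E + L * (h * Vm)) \<le> T^2/2 * (L * E + L * (h * Vm))"
      using LEV by (intro mult_right_mono) auto
    also have "\<dots> \<le> (E + h * Vm) / 24" using mult_right_mono[OF LT, of "E + h * Vm"] E0 Vm0 h by (simp add: algebra_simps)
    finally have "(real n * h)^2 / 2 * (L * E + L * (h * Vm)) \<le> (E + h * Vm) / 24" .
    then show ?thesis using err(2)[OF that] by linarith
  qed
  have e': "norm (?e n) \<le> r + T * \<phi> + (E + h * Vm) / 24" if "n \<le> N" for n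
  proof -
    have "norm (?e n) \<le> norm (x - X 0) + norm ((real n * h) *\<^sub>R (v - V 0)) + norm (?e n - (x - X 0) - (real n * h) *\<^sub>R (v - V 0))"
      using norm_triangle_ineq[of "x - X 0 + (real n * h) *\<^sub>R (v - V 0)" "?e n - (x - X 0) - (real n * h) *\<^sub>R (v - V 0)"]
        norm_triangle_ineq[of "x - X 0" "(real n * h) *\<^sub>R (v - V 0)"] by simp
    also have "norm ((real n * h) *\<^sub>R (v - V 0)) \<le> T * \<phi>"
      using h tn[OF that] by (auto simp: \<phi> intro!: mult_right_mono)
    finally show ?thesis using e[OF that] unfolding r by linarith
  qed
  obtain m where m: "m \<le> N" "E = norm (?e m)"
    unfolding E_def by (rule Max_atMost_attained)
  have EE: "E \<le> 24/23 * (r + T * \<phi> + h * Vm / 24)" using e'[OF m(1)] unfolding m(2)[symmetric] by (simp add: field_simps)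
  then show "norm (?e n) \<le> 24/23 * (r + T * \<phi> + h * Vm / 24)" using E[OF n] by simp
  have "norm (leap_vel grad h x v n - V (real n * h)) \<le> norm (v - V 0) + norm (leap_vel grad h x v n - V (real n * h) - (v - V 0))"
    using norm_triangle_ineq[of "v - V 0" "leap_vel grad h x v n - V (real n * h) - (v - V 0)"] by simp
  also have "\<dots> \<le> \<phi> + real n * h * (L * E + L * (h * Vm))" using err(1)[OF n] \<phi> by simp
  also have "real n * h * (L * E + L * (h * Vm)) \<le> T * (L * E + L * (h * Vm))"
    using tn[OF n] LEV by (intro mult_right_mono)
  also have "\<dots> \<le> T * (L * (24/23 * (r + T * \<phi> + h * Vm / 24)) + L * (h * Vm))"
    using EE T_pos L_nonneg h by (intro mult_left_mono add_mono) auto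
  finally show "norm (leap_vel grad h x v n - V (real n * h)) \<le> \<phi> + T * L * (24/23 * (r + T * \<phi> + h * Vm / 24) + h * Vm)"
    by (simp add: algebra_simps)
  assume "leap_pos grad h x v N = X T"
  then have "norm ((x - X 0) + T *\<^sub>R (v - V 0)) \<le> (E + h * Vm) / 24"
    using e[of N] N norm_minus_cancel[of "x - X 0 + T *\<^sub>R (v - V 0)"] by (simp add: algebra_simps del: norm_minus_cancel)
  moreover have "norm (T *\<^sub>R (v - V 0)) \<le> norm ((x - X 0) + T *\<^sub>R (v - V 0)) + norm (x - X 0)"
    using norm_triangle_ineq4[of "(x - X 0) + T *\<^sub>R (v - V 0)" "x - X 0"] by simp
  ultimately have "norm (T *\<^sub>R (v - V 0)) \<le> (E + h * Vm) / 24 + norm (x - X 0)"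
    by (meson add_right_mono order_trans)
  then have T\<phi>: "T * \<phi> \<le> r + (E + h * Vm) / 24" using T_pos unfolding r \<phi> norm_scaleR by simp
  then have EE': "E \<le> 12/11 * (2 * r + h * Vm / 12)" using EE by (simp add: field_simps)
  then show "norm (?e n) \<le> 12/11 * (2 * r + h * Vm / 12)" using E[OF n] by simp
  show "T * \<phi> \<le> 12/11 * r + h * Vm / 22" using T\<phi> EE' by (simp add: field_simps)
qed

text \<open>Replaces the velocity of the exact path, the unknown of the shooting problem, by that of
  the leapfrog path: \<open>norm (V 0) \<le> norm v + \<phi>\<close>, and \<open>h \<le> T\<close>
  lets \<open>h * \<phi>\<close> be absorbed. The coefficients in the first claim are those of
  \<open>p_xy\<close>, \<open>p_v\<close> and \<open>p_x\<close> after multiplication by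
  \<open>T\<close>; the argument itself yields 23/20 and 11/200.\<close>

lemma shadow_endpoint:
  assumes h: "0 < h" and N: "real N * h = T" and traj: "trajectory grad X V"
    and fin: "leap_pos grad h x v N = X T"
    and r: "r = norm (x - X 0)" and A: "a = norm v + T * L * norm (X 0)"
  shows "T * norm (v - V 0) \<le> 3/2 * r + h * (7/25 * norm v + 49/180 * T * L * norm (X 0))"
    and "n \<le> N \<Longrightarrow> norm (leap_pos grad h x v n - X (real n * h))
          + h * (12/11 * (norm (V 0) + T * L * norm (X 0))) \<le> 18/5 * r + 13/10 * h * a"
proof -
  define Vm where "Vm = 12/11 * (norm (V 0) + T * L * norm (X 0))"
  define \<phi> where "\<phi> = norm (v - V 0)"
  have a0: "a \<ge> 0" "h * a \<ge> 0" unfolding A using T_pos L_nonneg h by auto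
  have r0: "r \<ge> 0" using r by simp
  have "N \<noteq> 0" using N T_pos by (auto intro: ccontr)
  then have "h \<le> T" using h N by (cases N) (auto simp: algebra_simps)
  then have h\<phi>: "h * \<phi> \<le> T * \<phi>" by (intro mult_right_mono) (auto simp: \<phi>_def)
  have "norm (V 0) \<le> norm v + \<phi>" unfolding \<phi>_def using norm_triangle_ineq4[of v "v - V 0"] by simp
  then have "Vm \<le> 12/11 * (a + \<phi>)" unfolding Vm_def A by simp
  then have hV: "h * Vm \<le> 12/11 * (h * a + T * \<phi>)"
    using mult_left_mono[of Vm "12/11 * (a + \<phi>)" h] h h\<phi> by (simp add: algebra_simps)
  note sh = shadow[OF h N traj _ Vm_def r \<phi>_def, of n]
  have 1: "T * \<phi> \<le> 12/11 * r + h * Vm / 22" using shadow(4)[OF h N traj _ Vm_def r \<phi>_def fin, of 0] by simp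
  have 2: "T * \<phi> \<le> 23/20 * r + 11/200 * (h * a)" using 1 hV r0 a0 by (simp add: algebra_simps)
  have "11/200 * (h * a) \<le> h * (7/25 * norm v + 49/180 * T * L * norm (X 0))"
  proof -
    have "0 \<le> h * norm v" "0 \<le> h * (T * L * norm (X 0))" using T_pos L_nonneg h by auto
    then show ?thesis unfolding A by (simp add: algebra_simps)
  qed
  then show "T * norm (v - V 0) \<le> 3/2 * r + h * (7/25 * norm v + 49/180 * T * L * norm (X 0))"
    using 2 r0 by (simp add: \<phi>_def)
  assume "n \<le> N"
  then show "norm (leap_pos grad h x v n - X (real n * h))
          + h * (12/11 * (norm (V 0) + T * L * norm (X 0))) \<le> 18/5 * r + 13/10 * h * a"
    using sh(3)[OF _ fin] hV 2 r0 a0 unfolding Vm_def[symmetric] by (simp add: algebra_simps)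
qed

text \<open>The second difference of two leapfrog and two exact paths with common endpoints is again a
  leapfrog error, with the four-point inequality in the role of the Lipschitz bound.\<close>

lemma shadow_quad:
  assumes h: "0 < h" and N: "real N * h = T"
    and traj: "trajectory grad X V" "trajectory grad X' V'" and 0: "X 0 = X' 0"
    and fin: "leap_pos grad h x v N = X T" "leap_pos grad h x v' N = X' T"
    and r: "r = norm (x - X 0)" and R: "norm v \<le> R" "norm v' \<le> R"
  shows "norm (v - v' - (V 0 - V' 0)) \<le>
     (M * T^2 * (11/2 * r + 440/135 * h * R) + 352/675 * M * T * h * norm (X 0) + 44/135 * h / T) * norm (V 0 - V' 0)"
proof -
  let ?p = "\<lambda>i. leap_pos grad h x v i" and ?p' = "\<lambda>i. leap_pos grad h x v' i"
  define W where "W = norm (V 0 - V' 0)"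
  define a where "a = R + T * L * norm (X 0)"
  \<comment> \<open>By \<open>shadow_endpoint\<close>, a common majorant of the deviation plus
    \<open>h\<close> times the exact speed bound, for both pairs of paths. Hence \<open>e1\<close>
    and \<open>h * Vm\<close> are each at most \<open>EV\<close>.\<close>
  define EV where "EV = 18/5 * r + 13/10 * h * a"
  define Vm where "Vm = max (12/11 * (norm (V 0) + T * L * norm (X 0))) (12/11 * (norm (V' 0) + T * L * norm (X 0)))"
  define E where "E = EV - h * Vm"
  define D where "D i = ?p i - ?p' i - (X (real i * h) - X' (real i * h))" for i
  define S where "S = 12/11 * T * W"
  define Dm where "Dm = Max ((\<lambda>i. norm (D i)) ` {..N})"
  have R0: "0 \<le> R" using R(1) norm_ge_zero order_trans by blast
  have r0: "0 \<le> r" by (simp add: r)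
  have W0: "W \<ge> 0" by (simp add: W_def)
  have S0: "S \<ge> 0" unfolding S_def using W0 T_pos by simp
  have Dm: "norm (D i) \<le> Dm" if "i \<le> N" for i using that by (auto simp: Dm_def)
  have Dm0: "Dm \<ge> 0" using Dm[of 0] by (meson norm_ge_zero order_trans zero_le)
  have Vm0: "Vm \<ge> 0" unfolding Vm_def using T_pos L_nonneg by (auto simp: le_max_iff_disj)
  have EVb: "norm (?p n - X (real n * h)) + h * (12/11 * (norm (V 0) + T * L * norm (X 0))) \<le> EV"
    "norm (?p' n - X' (real n * h)) + h * (12/11 * (norm (V' 0) + T * L * norm (X 0))) \<le> EV" if "n \<le> N" for n
  proof -
    have "norm (?p n - X (real n * h)) + h * (12/11 * (norm (V 0) + T * L * norm (X 0))) \<le> 18/5 * r + 13/10 * h * (norm v + T * L * norm (X 0))"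
      by (rule shadow_endpoint(2)[OF h N traj(1) fin(1) r refl that])
    also have "\<dots> \<le> EV" unfolding EV_def a_def using R h by (intro add_left_mono mult_left_mono) auto
    finally show "norm (?p n - X (real n * h)) + h * (12/11 * (norm (V 0) + T * L * norm (X 0))) \<le> EV" .
    have "norm (?p' n - X' (real n * h)) + h * (12/11 * (norm (V' 0) + T * L * norm (X 0))) \<le> 18/5 * r + 13/10 * h * (norm v' + T * L * norm (X 0))"
      using shadow_endpoint(2)[OF h N traj(2) fin(2) _ refl that, of r] r 0 by simp
    also have "\<dots> \<le> EV" unfolding EV_def a_def using R h by (intro add_left_mono mult_left_mono) auto
    finally show "norm (?p' n - X' (real n * h)) + h * (12/11 * (norm (V' 0) + T * L * norm (X 0))) \<le> EV" .
  qed
  define e1 where "e1 = Max ((\<lambda>i. max (norm (?p i - X (real i * h))) (norm (?p' i - X' (real i * h)))) ` {..N})"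
  have e1: "max (norm (?p i - X (real i * h))) (norm (?p' i - X' (real i * h))) \<le> e1" if "i \<le> N" for i
    using that unfolding e1_def by (intro Max_ge) auto
  have e10: "e1 \<ge> 0" using e1[of 0] by (meson le_max_iff_disj norm_ge_zero order_trans zero_le)
  have hVm: "h * Vm \<le> EV"
    using EVb(1)[OF le0] EVb(2)[OF le0] norm_ge_zero[of "?p 0 - X (real 0 * h)"] norm_ge_zero[of "?p' 0 - X' (real 0 * h)"]
    unfolding Vm_def max_def by (simp only: split: if_split) linarith
  have e1EV: "e1 \<le> EV"
  proof -
    obtain m where m: "m \<le> N" "e1 = max (norm (?p m - X (real m * h))) (norm (?p' m - X' (real m * h)))"
      unfolding e1_def by (rule Max_atMost_attained)
    have "0 \<le> h * (12/11 * (norm (V 0) + T * L * norm (X 0)))" "0 \<le> h * (12/11 * (norm (V' 0) + T * L * norm (X 0)))"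
      using h T_pos L_nonneg by auto
    then show ?thesis using EVb[OF m(1)] m(2) by linarith
  qed
  have Sb: "norm (X t - X' t) \<le> S" if "t \<in> {0..T}" for t
  proof -
    have "norm (X t - X' t) \<le> 12/11 * t * W"
      unfolding W_def using trajectory_diff(3)[OF traj 0 that] .
    also have "\<dots> \<le> S" unfolding S_def using that W0 by (intro mult_right_mono) auto
    finally show ?thesis .
  qed
  have tn: "real n * h \<in> {0..T}" if "n \<le> N" for n
    unfolding N[symmetric] using that h by (auto intro!: mult_right_mono)
  define G where "G t = grad (X t) - grad (X' t)" for t
  have XX: "(X has_vector_derivative V t) (at t)" "(X' has_vector_derivative V' t) (at t)"
    and VV: "(V has_vector_derivative - grad (X t)) (at t)" "(V' has_vector_derivative - grad (X' t)) (at t)" for t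
    using traj by (auto simp: trajectory_def)
  \<comment> \<open>The first pair of points in the four-point inequality is on the leapfrog paths,
    the second on the exact ones. The second difference \<open>D\<close> is multiplied by
    \<open>L\<close>, and the first differences enter as a product of deviation and
    separation.\<close>
  have A: "norm ((grad (?p i) - grad (?p' i)) - G (real i * h)) \<le> L * Dm + M * e1 * S" if "i \<le> N" for i
    unfolding G_def using Dm[OF that] e1[OF that] Sb[OF tn[OF that]] L_nonneg M_nonneg S0 e10
    by (intro order_trans[OF grad_four] add_mono mult_mono mult_left_mono) (auto simp: D_def)
  have osc: "norm (G s - G s') \<le> L * (12/11 * W * h) + M * (Vm * h) * S"
    if s: "s \<in> {0..real N * h}" "s' \<in> {0..real N * h}" "\<bar>s - s'\<bar> \<le> h" for s s'
  proof -
    have s': "s \<in> {0..T}" "s' \<in> {0..T}" using s N by auto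
    have 1: "norm (X s - X' s - (X s' - X' s')) \<le> 12/11 * W * \<bar>s - s'\<bar>"
      by (rule norm_diff_le_of_speed[where V="\<lambda>t. V t - V' t" and T=T and X="\<lambda>t. X t - X' t"])
        (use s' trajectory_diff(1)[OF traj 0] XX in \<open>auto intro!: derivative_eq_intros simp: W_def\<close>)
    have 2: "norm (X s - X s') \<le> Vm * \<bar>s - s'\<bar>"
      by (rule norm_diff_le_of_speed[where V=V and T=T])
        (use s' XX trajectory_speed[OF traj(1)] in \<open>auto simp: Vm_def le_max_iff_disj\<close>)
    have 3: "norm (X' s - X' s') \<le> Vm * \<bar>s - s'\<bar>"
      by (rule norm_diff_le_of_speed[where V=V' and T=T])
        (use s' XX trajectory_speed[OF traj(2)] 0 in \<open>auto simp: Vm_def le_max_iff_disj\<close>)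
    have 4: "12/11 * W * \<bar>s - s'\<bar> \<le> 12/11 * W * h" "Vm * \<bar>s - s'\<bar> \<le> Vm * h"
      using s W0 Vm0 by (auto intro!: mult_left_mono)
    show ?thesis
      unfolding G_def using 1 2 3 4 Sb[OF s'(2)] L_nonneg M_nonneg S0 Vm0 h
      by (intro order_trans[OF grad_four] add_mono mult_mono mult_left_mono) auto
  qed
  define \<Omega> where "\<Omega> = (L * Dm + M * e1 * S) + (L * (12/11 * W * h) + M * (Vm * h) * S)"
  have err: "norm (D n - (real n * h) *\<^sub>R (v - v' - (V 0 - V' 0))) \<le> (real n * h)^2 / 2 * \<Omega>" if "n \<le> N" for n
  proof -
    have "norm ((?p n - ?p' n) - (X (real n * h) - X' (real n * h)) - ((?p 0 - ?p' 0) - (X 0 - X' 0))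
        - (real n * h) *\<^sub>R ((leap_vel grad h x v 0 - leap_vel grad h x v' 0) - (V 0 - V' 0))) \<le> (real n * h)^2 / 2 * \<Omega>"
      unfolding \<Omega>_def
    proof (rule leapfrog_error(2)[where X="\<lambda>t. X t - X' t" and V="\<lambda>t. V t - V' t" and G=G and N=N
          and g="\<lambda>i. grad (?p i) - grad (?p' i)" and v="\<lambda>i. leap_vel grad h x v i - leap_vel grad h x v' i"
          and x="\<lambda>i. ?p i - ?p' i"])
      show "?p (Suc n) - ?p' (Suc n) = ?p n - ?p' n + h *\<^sub>R (leap_vel grad h x v n - leap_vel grad h x v' n)
        - (h\<^sup>2 / 2) *\<^sub>R (grad (?p n) - grad (?p' n))" for n
        unfolding leap_pos_Suc by (simp add: algebra_simps)
      show "leap_vel grad h x v (Suc n) - leap_vel grad h x v' (Suc n) = leap_vel grad h x v n - leap_vel grad h x v' n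
        - (h / 2) *\<^sub>R (grad (?p n) - grad (?p' n) + (grad (?p (Suc n)) - grad (?p' (Suc n))))" for n
        unfolding leap_vel_Suc by (simp add: algebra_simps)
      show "((\<lambda>t. X t - X' t) has_vector_derivative V t - V' t) (at t)"
        "((\<lambda>t. V t - V' t) has_vector_derivative - G t) (at t)" for t
        using XX VV by (auto intro!: derivative_eq_intros simp: G_def)
    qed (use h A osc that in auto)
    then show ?thesis using 0 by (simp add: D_def)
  qed
  have \<Omega>0: "\<Omega> \<ge> 0" unfolding \<Omega>_def using L_nonneg M_nonneg Dm0 e10 S0 W0 h Vm0 by auto
  \<comment> \<open>The part of the error without \<open>Dm\<close>. Its last summand comes from
    \<open>L * T^2 \<le> 1/12\<close> applied to the oscillation of the velocity difference; it is
    the origin of \<open>j_c\<close>.\<close>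
  define Rr where "Rr = T^2/2 * M * S * (e1 + h * Vm) + h * W / 22"
  have T\<Omega>: "T^2/2 * \<Omega> \<le> Dm / 24 + Rr"
  proof -
    have "T^2/2 * \<Omega> = (L * T^2) * (Dm / 2) + (L * T^2) * (6/11 * W * h) + T^2/2 * M * S * (e1 + h * Vm)"
      by (simp add: \<Omega>_def algebra_simps)
    also have "(L * T^2) * (Dm / 2) \<le> 1/12 * (Dm / 2)" using LT Dm0 by (intro mult_right_mono) auto
    also have "(L * T^2) * (6/11 * W * h) \<le> 1/12 * (6/11 * W * h)" using LT W0 h by (intro mult_right_mono) auto
    finally show ?thesis by (simp add: Rr_def)
  qed
  have D: "norm (D n - (real n * h) *\<^sub>R (v - v' - (V 0 - V' 0))) \<le> Dm / 24 + Rr" if "n \<le> N" for n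
  proof -
    have "(real n * h)^2 \<le> T^2" using h tn[OF that] by (intro power_mono) auto
    then have "(real n * h)^2 / 2 * \<Omega> \<le> T^2/2 * \<Omega>" using \<Omega>0 by (intro mult_right_mono) auto
    then show ?thesis using err[OF that] T\<Omega> by linarith
  qed
  define \<theta> where "\<theta> = norm (v - v' - (V 0 - V' 0))"
  \<comment> \<open>Equal endpoints make the second difference vanish at the final time, so its
    initial slope \<theta> is determined by the accumulated error.\<close>
  have "D N = 0" using fin N by (simp add: D_def)
  then have T\<theta>: "T * \<theta> \<le> Dm / 24 + Rr" using D[of N] N T_pos by (simp add: \<theta>_def)
  obtain m where m: "m \<le> N" "Dm = norm (D m)"
    unfolding Dm_def by (rule Max_atMost_attained)
  have "Dm \<le> norm ((real m * h) *\<^sub>R (v - v' - (V 0 - V' 0))) + norm (D m - (real m * h) *\<^sub>R (v - v' - (V 0 - V' 0)))"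
    using norm_triangle_ineq[of "(real m * h) *\<^sub>R (v - v' - (V 0 - V' 0))" "D m - (real m * h) *\<^sub>R (v - v' - (V 0 - V' 0))"] m by simp
  also have "norm ((real m * h) *\<^sub>R (v - v' - (V 0 - V' 0))) \<le> T * \<theta>"
    using tn[OF m(1)] h by (auto simp: \<theta>_def intro!: mult_right_mono)
  finally have "Dm \<le> T * \<theta> + (Dm / 24 + Rr)" using D[OF m(1)] by simp
  then have "T * \<theta> \<le> 12/11 * Rr" using T\<theta> by (simp add: algebra_simps)
  also have "\<dots> \<le> 12/11 * (T^2/2 * M * S * (2 * EV) + h * W / 22)"
    unfolding Rr_def using M_nonneg S0 e1EV hVm by (intro mult_left_mono add_right_mono) auto
  also have "\<dots> = T * ((144/121 * M * T^2 * EV + 6/121 * h / T) * W)"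
    using T_pos by (simp add: S_def field_simps power2_eq_square)
  finally have "\<theta> \<le> (144/121 * M * T^2 * EV + 6/121 * h / T) * W" using T_pos by simp
  also have "\<dots> \<le> (M * T^2 * (11/2 * r + 440/135 * h * R) + 352/675 * M * T * h * norm (X 0) + 44/135 * h / T) * W"
  proof (rule mult_right_mono[OF _ W0])
    \<comment> \<open>Here \<open>L * T^2 \<le> 1/12\<close> trades the factor \<open>T * L\<close>
      for \<open>1 / (12 * T)\<close> relative to the prefactor \<open>M * T^2\<close>; this is why
      \<open>j_x\<close> contains \<open>M * T\<close> and no \<open>L\<close>.\<close>
    have "M * T^2 * (h * (T * L * norm (X 0))) = (L * T^2) * (M * T * h * norm (X 0))"
      by (simp add: power2_eq_square)
    also have "\<dots> \<le> 1/12 * (M * T * h * norm (X 0))"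
      using LT M_nonneg T_pos h by (intro mult_right_mono) auto
    finally have 1: "M * T^2 * (h * (T * L * norm (X 0))) \<le> 1/12 * (M * T * h * norm (X 0))" .
    have 2: "0 \<le> M * T^2 * r" "0 \<le> M * T^2 * (h * R)" "0 \<le> h / T" "0 \<le> M * T * h * norm (X 0)"
      using M_nonneg T_pos h r0 R0 by auto
    have num: "144/121 * (18/5 * b + 13/10 * c + 13/10 * e) \<le> 11/2 * b + 440/135 * c + 352/675 * z"
      if "e \<le> 1/12 * z" "0 \<le> b" "0 \<le> c" "0 \<le> z" for b c e z :: real
    proof -
      have "144/121 * (18/5 * b) \<le> 11/2 * b" using that(2) by simp
      moreover have "144/121 * (13/10 * c) \<le> 440/135 * c" using that(3) by simp
      moreover have "144/121 * (13/10 * e) \<le> 352/675 * z" using that(1,4) by simp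
      ultimately show ?thesis by (simp add: distrib_left)
    qed
    have "144/121 * M * T^2 * EV = 144/121 * (18/5 * (M * T^2 * r) + 13/10 * (M * T^2 * (h * R)) + 13/10 * (M * T^2 * (h * (T * L * norm (X 0)))))"
      by (simp add: EV_def a_def algebra_simps)
    also have "\<dots> \<le> 11/2 * (M * T^2 * r) + 440/135 * (M * T^2 * (h * R)) + 352/675 * (M * T * h * norm (X 0))"
      by (rule num[OF 1 2(1,2,4)])
    finally show "144/121 * M * T^2 * EV + 6/121 * h / T
      \<le> M * T^2 * (11/2 * r + 440/135 * h * R) + 352/675 * M * T * h * norm (X 0) + 44/135 * h / T"
      using 2(3) by (simp add: algebra_simps)
  qed
  finally show ?thesis by (simp add: \<theta>_def W_def)
qed

end

section \<open>Global solutions of Lipschitz differential equations\<close>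

text \<open>Oriented integral from 0 to \<open>t\<close> for either sign of \<open>t\<close>: one of
  the two intervals is always empty or a single point.\<close>

definition path_integral :: "(real \<Rightarrow> 'b::euclidean_space) \<Rightarrow> real \<Rightarrow> 'b" where
  "path_integral g t = integral {0..t} g - integral {t..0} g"

lemma path_integral_0 [simp]: "path_integral g 0 = 0"
  by (simp add: path_integral_def)

lemma path_integral_has_vector_derivative:
  assumes g: "continuous_on UNIV g"
  shows "(path_integral g has_vector_derivative g t) (at t)"
proof -
  define R where "R = \<bar>t\<bar> + 1"
  have int: "g integrable_on {a..b}" for a b
    by (intro integrable_continuous_interval continuous_on_subset[OF g]) auto
  have eq: "path_integral g s = integral {- R..s} g - integral {- R..0} g" if s: "s \<in> {- R<..<R}" for s
  proof (cases "0 \<le> s")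
    case True
    have "integral {- R..0} g + integral {0..s} g = integral {- R..s} g"
      using True s by (intro Henstock_Kurzweil_Integration.integral_combine int) (auto simp: R_def)
    then show ?thesis using True by (cases "s = 0") (auto simp: path_integral_def algebra_simps)
  next
    case False
    have "integral {- R..s} g + integral {s..0} g = integral {- R..0} g"
      using False s by (intro Henstock_Kurzweil_Integration.integral_combine int) (auto simp: R_def)
    then show ?thesis using False by (auto simp: path_integral_def algebra_simps)
  qed
  have t: "t \<in> {- R<..<R}" by (auto simp: R_def)
  have "((\<lambda>s. integral {- R..s} g) has_vector_derivative g t) (at t within {- R..R})"
    by (intro integral_has_vector_derivative continuous_on_subset[OF g]) (use t in auto)
  then have "((\<lambda>s. integral {- R..s} g) has_vector_derivative g t) (at t)"
    using at_within_interior[of t "{- R..R}"] t by (simp add: interior_atLeastAtMost_real)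
  then have "((\<lambda>s. integral {- R..s} g - integral {- R..0} g) has_vector_derivative g t - 0) (at t)"
    by (intro derivative_intros)
  then show ?thesis
    using has_vector_derivative_transform_within_open[of "\<lambda>s. integral {- R..s} g - integral {- R..0} g" "g t" t "{- R<..<R}" "path_integral g"]
      eq t by auto
qed

text \<open>Growth estimate matched to the weight of the fixed-point argument below. Negative times
  follow by reflection.\<close>

lemma norm_le_of_exp_derivative:
  fixes Y :: "real \<Rightarrow> 'b::euclidean_space"
  assumes Y: "\<And>t. (Y has_vector_derivative Y' t) (at t)" and Y0: "Y 0 = 0"
    and b: "\<And>t. norm (Y' t) \<le> C * exp (\<kappa> * \<bar>t\<bar>)" and \<kappa>: "0 < \<kappa>"
  shows "norm (Y t) \<le> C / \<kappa> * (exp (\<kappa> * \<bar>t\<bar>) - 1)"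
proof -
  have pos: "norm (Z t) \<le> C / \<kappa> * (exp (\<kappa> * t) - 1)"
    if Z: "\<And>t. (Z has_vector_derivative Z' t) (at t)" and Z0: "Z 0 = 0"
      and bz: "\<And>t. norm (Z' t) \<le> C * exp (\<kappa> * \<bar>t\<bar>)" and t: "0 < t"
    for t and Z Z' :: "real \<Rightarrow> 'b"
  proof -
    have "norm (Z t - Z 0) \<le> C / \<kappa> * exp (\<kappa> * t) - C / \<kappa> * exp (\<kappa> * 0)"
    proof (rule differentiable_bound_general[OF t, where f'=Z' and \<phi>'="\<lambda>t. C * exp (\<kappa> * t)"])
      show "continuous_on {0..t} Z"
        by (intro continuous_at_imp_continuous_on ballI has_vector_derivative_continuous[OF Z])
      show "((\<lambda>t. C / \<kappa> * exp (\<kappa> * t)) has_vector_derivative C * exp (\<kappa> * s)) (at s)" for s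
        using \<kappa> by (auto intro!: derivative_eq_intros simp flip: has_real_derivative_iff_has_vector_derivative)
      show "norm (Z' s) \<le> C * exp (\<kappa> * s)" if "0 < s" "s < t" for s using bz[of s] that by simp
    qed (use Z \<kappa> in \<open>auto intro!: continuous_intros\<close>)
    then show ?thesis using Z0 by (simp add: algebra_simps)
  qed
  show ?thesis
  proof (cases "t > 0")
    case True
    then show ?thesis using pos[OF Y Y0 b, of t] by simp
  next
    case False
    have Ym: "((\<lambda>t. Y (- t)) has_vector_derivative - Y' (- t)) (at t)" for t
    proof -
      have "((\<lambda>t. - t) has_vector_derivative - (1::real)) (at t)" by (auto intro!: derivative_eq_intros)
      from vector_diff_chain_at[OF this Y] show ?thesis by (simp add: o_def)
    qed
    show ?thesis
    proof (cases "t = 0")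
      case False
      then show ?thesis using pos[OF Ym, of "- t"] Y0 b \<open>\<not> t > 0\<close> by (simp add: b[of "- _", simplified])
    qed (simp add: Y0)
  qed
qed

text \<open>Picard iteration in an exponentially weighted norm (Bielecki): paths are written as
  \<open>exp (\<kappa> * \<bar>t\<bar>)\<close> times a bounded continuous function, which makes the
  integral operator a contraction on the whole line at once. All real times are covered because
  \<open>ham_flow\<close> quantifies over such solutions.\<close>

lemma ode_global_solution:
  fixes F :: "'b::euclidean_space \<Rightarrow> 'b"
  assumes lip: "\<And>a b. norm (F a - F b) \<le> l * norm (a - b)"
  obtains Z where "Z 0 = z0" "\<And>t. (Z has_vector_derivative F (Z t)) (at t)"
proof -
  have l: "0 \<le> \<bar>l\<bar>" and lip: "norm (F a - F b) \<le> \<bar>l\<bar> * norm (a - b)" for a b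
    using order_trans[OF lip[of a b] mult_right_mono[OF abs_ge_self norm_ge_zero]] by auto
  \<comment> \<open>Makes the weighted Lipschitz factor \<open>\<bar>l\<bar> / \<kappa>\<close>
    smaller than 1/2, and keeps \<kappa> positive when \<open>l = 0\<close>.\<close>
  define \<kappa> where "\<kappa> = 2 * \<bar>l\<bar> + 1"
  have \<kappa>: "0 < \<kappa>" by (simp add: \<kappa>_def)
  have Fc: "continuous_on UNIV F"
    by (rule lipschitz_on_continuous_on[of "\<bar>l\<bar>"]) (auto simp: lipschitz_on_def dist_norm lip)
  define Z where "Z b t = exp (\<kappa> * \<bar>t\<bar>) *\<^sub>R apply_bcontfun b t" for b :: "real \<Rightarrow>\<^sub>C 'b" and t
  have Zc: "continuous_on UNIV (\<lambda>t. F (Z b t))" for b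
    unfolding Z_def by (intro continuous_on_compose2[OF Fc] continuous_intros) auto
  define J where "J b = path_integral (\<lambda>t. F (Z b t))" for b
  have J: "(J b has_vector_derivative F (Z b t)) (at t)" for b t
    unfolding J_def by (rule path_integral_has_vector_derivative[OF Zc])
  have J0: "J b 0 = 0" for b by (simp add: J_def)
  define Q where "Q b t = exp (- \<kappa> * \<bar>t\<bar>) *\<^sub>R (z0 + J b t)" for b t
  have Jb: "norm (J b t) \<le> (norm (F 0) + \<bar>l\<bar> * norm b) / \<kappa> * (exp (\<kappa> * \<bar>t\<bar>) - 1)" for b t
  proof (rule norm_le_of_exp_derivative[OF J J0 _ \<kappa>])
    fix t
    have "norm (F (Z b t)) \<le> norm (F 0) + norm (F (Z b t) - F 0)"
      using norm_triangle_ineq[of "F 0" "F (Z b t) - F 0"] by simp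
    also have "norm (F (Z b t) - F 0) \<le> \<bar>l\<bar> * (exp (\<kappa> * \<bar>t\<bar>) * norm b)"
      using norm_bounded[of b t] by (intro order_trans[OF lip] mult_left_mono) (auto simp: Z_def)
    also have "norm (F 0) \<le> norm (F 0) * exp (\<kappa> * \<bar>t\<bar>)"
      using \<kappa> by (simp add: mult_le_cancel_left1)
    finally show "norm (F (Z b t)) \<le> (norm (F 0) + \<bar>l\<bar> * norm b) * exp (\<kappa> * \<bar>t\<bar>)"
      by (simp add: algebra_simps)
  qed
  have Qb: "Q b \<in> bcontfun" for b
  proof (rule bcontfun_normI)
    have "continuous_on UNIV (J b)"
      by (intro continuous_at_imp_continuous_on ballI has_vector_derivative_continuous[OF J])
    then show "continuous_on UNIV (Q b)" unfolding Q_def by (intro continuous_intros)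
    fix t
    have "norm (Q b t) \<le> exp (- \<kappa> * \<bar>t\<bar>) * (norm z0 + (norm (F 0) + \<bar>l\<bar> * norm b) / \<kappa> * (exp (\<kappa> * \<bar>t\<bar>) - 1))"
      unfolding Q_def norm_scaleR using Jb[of b t] norm_triangle_ineq[of z0 "J b t"]
      by (auto intro!: mult_left_mono)
    also have "\<dots> \<le> exp (- \<kappa> * \<bar>t\<bar>) * ((norm z0 + (norm (F 0) + \<bar>l\<bar> * norm b) / \<kappa>) * exp (\<kappa> * \<bar>t\<bar>))"
    proof -
      have "norm z0 \<le> norm z0 * exp (\<kappa> * \<bar>t\<bar>)" using \<kappa> by (simp add: mult_le_cancel_left1)
      moreover have "(norm (F 0) + \<bar>l\<bar> * norm b) / \<kappa> * (exp (\<kappa> * \<bar>t\<bar>) - 1) \<le> (norm (F 0) + \<bar>l\<bar> * norm b) / \<kappa> * exp (\<kappa> * \<bar>t\<bar>)"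
        using \<kappa> by (intro mult_left_mono) auto
      ultimately show ?thesis by (intro mult_left_mono) (auto simp: distrib_right)
    qed
    also have "\<dots> = norm z0 + (norm (F 0) + \<bar>l\<bar> * norm b) / \<kappa>"
      by (simp add: exp_minus field_simps)
    finally show "norm (Q b t) \<le> norm z0 + (norm (F 0) + \<bar>l\<bar> * norm b) / \<kappa>" .
  qed
  have "\<exists>!b. Bcontfun (Q b) = b"
  proof (rule banach_fix_type[of "1/2"]; (intro allI)?)
    fix b c
    have dZ: "norm (Z b t - Z c t) \<le> exp (\<kappa> * \<bar>t\<bar>) * dist b c" for t
    proof -
      have "Z b t - Z c t = exp (\<kappa> * \<bar>t\<bar>) *\<^sub>R (b t - c t)" by (simp add: Z_def scaleR_diff_right)
      then show ?thesis using dist_bounded[of b t c] by (simp add: dist_norm)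
    qed
    have dJ: "norm (J b t - J c t) \<le> (\<bar>l\<bar> * dist b c) / \<kappa> * (exp (\<kappa> * \<bar>t\<bar>) - 1)" for t
    proof (rule norm_le_of_exp_derivative[where Y="\<lambda>t. J b t - J c t", OF _ _ _ \<kappa>])
      show "((\<lambda>t. J b t - J c t) has_vector_derivative F (Z b t) - F (Z c t)) (at t)" for t
        by (intro derivative_intros J)
      show "norm (F (Z b t) - F (Z c t)) \<le> \<bar>l\<bar> * dist b c * exp (\<kappa> * \<bar>t\<bar>)" for t
        using order_trans[OF lip mult_left_mono[OF dZ[of t] l]] by (simp add: mult_ac)
    qed (simp add: J0)
    show "dist (Bcontfun (Q b)) (Bcontfun (Q c)) \<le> 1/2 * dist b c"
    proof (rule dist_bound)
      fix t
      have "dist (Q b t) (Q c t) = exp (- \<kappa> * \<bar>t\<bar>) * norm (J b t - J c t)"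
        by (simp add: Q_def dist_norm flip: scaleR_diff_right)
      also have "\<dots> \<le> exp (- \<kappa> * \<bar>t\<bar>) * ((\<bar>l\<bar> * dist b c) / \<kappa> * (exp (\<kappa> * \<bar>t\<bar>) - 1))"
        by (intro mult_left_mono dJ) auto
      also have "\<dots> \<le> exp (- \<kappa> * \<bar>t\<bar>) * ((\<bar>l\<bar> * dist b c) / \<kappa> * exp (\<kappa> * \<bar>t\<bar>))"
        using \<kappa> by (intro mult_left_mono) auto
      also have "\<dots> = \<bar>l\<bar> / \<kappa> * dist b c" by (simp add: exp_minus field_simps)
      also have "\<dots> \<le> 1/2 * dist b c" by (intro mult_right_mono) (auto simp: \<kappa>_def field_simps)
      finally show "dist (apply_bcontfun (Bcontfun (Q b)) t) (apply_bcontfun (Bcontfun (Q c)) t) \<le> 1/2 * dist b c"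
        by (simp add: Bcontfun_inverse[OF Qb])
    qed
  qed auto
  then obtain b where "Bcontfun (Q b) = b" by auto
  then have b: "apply_bcontfun b = Q b" using Bcontfun_inverse[OF Qb[of b]] by simp
  have Zb: "Z b = (\<lambda>t. z0 + J b t)"
    unfolding Z_def b Q_def by (auto simp: exp_minus)
  show ?thesis
  proof (rule that[of "Z b"])
    show "Z b 0 = z0" by (simp add: Zb J0)
    show "(Z b has_vector_derivative F (Z b t)) (at t)" for t
    proof -
      have "((\<lambda>t. z0 + J b t) has_vector_derivative 0 + F (Z b t)) (at t)" by (intro derivative_intros J)
      then show ?thesis by (simp flip: Zb)
    qed
  qed
qed

section \<open>The Hamiltonian flow and the matching map\<close>

context force_field
begin

lemma trajectory_exists:
  obtains X V where "trajectory grad X V" "X 0 = x" "V 0 = v"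
proof -
  have "norm ((snd a, - grad (fst a)) - (snd b, - grad (fst b))) \<le> (1 + L) * norm (a - b)" for a b
  proof -
    have "norm (snd a - snd b, grad (fst b) - grad (fst a)) \<le> norm (snd a - snd b) + norm (grad (fst b) - grad (fst a))"
      by (rule norm_Pair_le)
    also have "\<dots> \<le> norm (snd (a - b)) + L * norm (fst (b - a))"
      using grad_lip[of "fst b" "fst a"] by simp
    also have "\<dots> \<le> norm (a - b) + L * norm (b - a)"
      using L_nonneg norm_fst_le[of "fst (b - a)" "snd (b - a)"] norm_snd_le[of "snd (a - b)" "fst (a - b)"]
      by (intro add_mono mult_left_mono) (simp_all only: prod.collapse)
    finally show ?thesis by (simp add: norm_minus_commute algebra_simps)
  qed
  then obtain Z where Z: "Z 0 = (x, v)" "\<And>t. (Z has_vector_derivative (snd (Z t), - grad (fst (Z t)))) (at t)"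
    using ode_global_solution[of "\<lambda>z. (snd z, - grad (fst z))" "1 + L" "(x, v)"] by metis
  show ?thesis
    by (rule that[of "\<lambda>t. fst (Z t)" "\<lambda>t. snd (Z t)"])
      (use Z bounded_linear.has_vector_derivative[OF bounded_linear_fst Z(2)]
        bounded_linear.has_vector_derivative[OF bounded_linear_snd Z(2)] in \<open>auto simp: trajectory_def\<close>)
qed

text \<open>Justifies the definite description in \<open>ham_flow\<close>: two trajectories with the
  same data agree at time \<open>T\<close> by \<open>trajectory_diff\<close>.\<close>

lemma ham_flow_eq:
  assumes "trajectory grad X V"
  shows "ham_flow grad T (X 0) (V 0) = X T"
  unfolding ham_flow_def
proof (rule the_equality)
  show "\<exists>X' V'. X' 0 = X 0 \<and> V' 0 = V 0 \<and> (\<forall>t. (X' has_vector_derivative V' t) (at t)) \<and>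
      (\<forall>t. (V' has_vector_derivative - grad (X' t)) (at t)) \<and> X T = X' T"
    using assms by (auto simp: trajectory_def)
  fix y
  assume "\<exists>X' V'. X' 0 = X 0 \<and> V' 0 = V 0 \<and> (\<forall>t. (X' has_vector_derivative V' t) (at t)) \<and>
      (\<forall>t. (V' has_vector_derivative - grad (X' t)) (at t)) \<and> y = X' T"
  then obtain X' V' where *: "X' 0 = X 0" "V' 0 = V 0" "trajectory grad X' V'" "y = X' T"
    by (auto simp: trajectory_def)
  show "y = X T" using trajectory_diff(3)[OF *(3) assms *(1), of T] *(2,4) T_pos by simp
qed

lemma ham_flow_diff:
  "norm (ham_flow grad T y w - ham_flow grad T y w' - T *\<^sub>R (w - w')) \<le> T * norm (w - w') / 11"
proof -
  obtain X V where X: "trajectory grad X V" "X 0 = y" "V 0 = w" by (rule trajectory_exists)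
  obtain X' V' where X': "trajectory grad X' V'" "X' 0 = y" "V' 0 = w'" by (rule trajectory_exists)
  show ?thesis
    using trajectory_diff(2)[OF X(1) X'(1), of T] ham_flow_eq[OF X(1)] ham_flow_eq[OF X'(1)] X X' T_pos
    by simp
qed

text \<open>A Newton-type correction of the velocity with the fixed slope \<open>T\<close> contracts
  by 1/11, because the flow differs from \<open>T\<close> times the identity by a map with Lipschitz
  constant \<open>T / 11\<close>.\<close>

lemma ham_flow_ex1: "\<exists>!w. ham_flow grad T y w = z"
proof -
  let ?\<Phi> = "\<lambda>w. w - (1/T) *\<^sub>R (ham_flow grad T y w - z)"
  have "\<exists>!w. ?\<Phi> w = w"
  proof (rule banach_fix_type[of "1/11"]; (intro allI)?)
    fix w w'
    have "?\<Phi> w - ?\<Phi> w' = - (1/T) *\<^sub>R (ham_flow grad T y w - ham_flow grad T y w' - T *\<^sub>R (w - w'))"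
      using T_pos by (simp add: algebra_simps)
    then have "norm (?\<Phi> w - ?\<Phi> w') = (1/T) * norm (ham_flow grad T y w - ham_flow grad T y w' - T *\<^sub>R (w - w'))"
      using T_pos by simp
    also have "\<dots> \<le> (1/T) * (T * norm (w - w') / 11)" using ham_flow_diff T_pos by (intro mult_left_mono) auto
    finally show "dist (?\<Phi> w) (?\<Phi> w') \<le> 1/11 * dist w w'" using T_pos by (simp add: dist_norm)
  qed auto
  moreover have "?\<Phi> w = w \<longleftrightarrow> ham_flow grad T y w = z" for w using T_pos by auto
  ultimately show ?thesis by simp
qed

text \<open>Solution of the two-point boundary problem, that is, the inverse of
  \<open>ham_flow grad T y\<close>. Composed with \<open>q_tilde\<close> it is the map \<Phi>
  matching leapfrog velocities to exact ones.\<close>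

definition shoot :: "'a \<Rightarrow> 'a \<Rightarrow> 'a" where
  "shoot y z = (THE w. ham_flow grad T y w = z)"

lemma ham_flow_shoot: "ham_flow grad T y (shoot y z) = z"
  unfolding shoot_def by (rule theI'[OF ham_flow_ex1])

text \<open>\<open>ham_flow_diff\<close> read at two preimages: 11/10 and 12/11 are the constants
  \<open>1 / (1 - 1/11)\<close> and \<open>1 + 1/11\<close>.\<close>

lemma shoot_dist:
  "norm (shoot y z - shoot y z') * T \<le> 11/10 * norm (z - z')"
  "norm (z - z') \<le> 12/11 * T * norm (shoot y z - shoot y z')"
proof -
  let ?w = "shoot y z - shoot y z'"
  have b: "norm (z - z' - T *\<^sub>R ?w) \<le> T * norm ?w / 11"
    using ham_flow_diff[of y "shoot y z" "shoot y z'"] by (simp add: ham_flow_shoot)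
  have "norm (T *\<^sub>R ?w) \<le> norm (z - z') + norm (z - z' - T *\<^sub>R ?w)"
    using norm_triangle_ineq4[of "z - z'" "z - z' - T *\<^sub>R ?w"] by simp
  then show "norm ?w * T \<le> 11/10 * norm (z - z')" using b T_pos by (simp add: mult.commute)
  have "norm (z - z') \<le> norm (T *\<^sub>R ?w) + norm (z - z' - T *\<^sub>R ?w)"
    using norm_triangle_ineq[of "T *\<^sub>R ?w" "z - z' - T *\<^sub>R ?w"] by simp
  then show "norm (z - z') \<le> 12/11 * T * norm ?w" using b T_pos by (simp add: mult.commute)
qed

text \<open>\<open>shadow\<close> with equal initial data, where only terms with a factor
  \<open>h\<close> survive. The limit of the velocities is needed later, when the kinetic energy is
  passed to the limit.\<close>

lemma leap_tendsto:
  assumes "trajectory grad X V"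
  shows "(\<lambda>N. leap_pos grad (T / real (Suc N)) (X 0) (V 0) (Suc N)) \<longlonglongrightarrow> X T"
    and "(\<lambda>N. leap_vel grad (T / real (Suc N)) (X 0) (V 0) (Suc N)) \<longlonglongrightarrow> V T"
proof -
  define Vm where "Vm = 12/11 * (norm (V 0) + T * L * norm (X 0))"
  define \<eta> where "\<eta> N = T / real (Suc N)" for N
  have h0: "\<eta> \<longlonglongrightarrow> 0"
    unfolding \<eta>_def using tendsto_mult[OF tendsto_const[of T] LIMSEQ_inverse_real_of_nat] by (simp add: divide_inverse)
  have "norm (leap_pos grad (\<eta> N) (X 0) (V 0) (Suc N) - X T) \<le> 24/23 * (\<eta> N * Vm / 24)"
    and "norm (leap_vel grad (\<eta> N) (X 0) (V 0) (Suc N) - V T)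
      \<le> T * L * (24/23 * (\<eta> N * Vm / 24) + \<eta> N * Vm)" for N
    using shadow(1,2)[OF _ _ assms _ Vm_def refl refl, of "\<eta> N" "Suc N" "Suc N" "X 0" "V 0"] T_pos
    by (simp_all add: \<eta>_def)
  note b = this
  have "(\<lambda>N. leap_pos grad (\<eta> N) (X 0) (V 0) (Suc N) - X T) \<longlonglongrightarrow> 0"
    by (rule Lim_null_comparison[OF _ _, of _ "\<lambda>N. 24/23 * (\<eta> N * Vm / 24)"])
      (use b(1) in \<open>auto intro!: tendsto_eq_intros h0\<close>)
  then show "(\<lambda>N. leap_pos grad (T / real (Suc N)) (X 0) (V 0) (Suc N)) \<longlonglongrightarrow> X T"
    by (simp add: LIM_zero_iff flip: \<eta>_def del: of_nat_Suc)
  have "(\<lambda>N. leap_vel grad (\<eta> N) (X 0) (V 0) (Suc N) - V T) \<longlonglongrightarrow> 0"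
    by (rule Lim_null_comparison[OF _ _, of _ "\<lambda>N. T * L * (24/23 * (\<eta> N * Vm / 24) + \<eta> N * Vm)"])
      (use b(2) in \<open>auto intro!: tendsto_eq_intros h0\<close>)
  then show "(\<lambda>N. leap_vel grad (T / real (Suc N)) (X 0) (V 0) (Suc N)) \<longlonglongrightarrow> V T"
    by (simp add: LIM_zero_iff flip: \<eta>_def del: of_nat_Suc)
qed

lemma q_tilde_pos:
  assumes "0 < h" "T = real N * h"
  shows "q_tilde grad T h x v = leap_pos grad h x v N"
  using assms by (simp add: q_tilde_def leap_pos_def)

lemma q_tilde_tendsto:
  "(\<lambda>N. q_tilde grad T (T / real (Suc N)) x v) \<longlonglongrightarrow> q_tilde grad T 0 x v"
proof -
  obtain X V where X: "trajectory grad X V" "X 0 = x" "V 0 = v" by (rule trajectory_exists)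
  have "q_tilde grad T (T / real (Suc N)) x v = leap_pos grad (T / real (Suc N)) x v (Suc N)" for N
    using T_pos by (intro q_tilde_pos) auto
  then show ?thesis using leap_tendsto(1)[OF X(1)] ham_flow_eq[OF X(1)] X by (simp add: q_tilde_def)
qed

text \<open>By how much the Lipschitz constant of the inverse of \<Phi> may exceed 1 on velocities
  of norm at most \<open>R\<close>; \<open>r\<close> is the distance between the two starting points
  and \<open>y\<close> the norm of the second one.\<close>

definition slope_bound :: "real \<Rightarrow> real \<Rightarrow> real \<Rightarrow> real \<Rightarrow> real" where
  "slope_bound h r y R = j_xy M T * r + h * (j_c T + j_v M T * R + j_x M T * y)"

text \<open>The leapfrog path from \<open>(x, v)\<close> and the exact path from
  \<open>(y, \<Phi> v)\<close> share their endpoint by construction, so the shadowing estimates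
  apply to them.\<close>

lemma shoot_q_tilde_pos:
  fixes x y :: 'a
  assumes h: "0 < h" and N: "T = real N * h"
  defines "\<Phi> \<equiv> \<lambda>v. shoot y (q_tilde grad T h x v)"
  shows "norm (\<Phi> v - v) \<le> p_xy T * norm (x - y) + h * (p_v T * norm v + p_x L * norm y)"
    and "norm v \<le> R \<Longrightarrow> norm v' \<le> R \<Longrightarrow>
      norm (v - v') \<le> (1 + slope_bound h (norm (x - y)) (norm y) R) * norm (\<Phi> v - \<Phi> v')"
    and "norm (q_tilde grad T h x v - q_tilde grad T h x v' - T *\<^sub>R (v - v')) \<le> T * norm (v - v') / 11"
proof -
  have q: "q_tilde grad T h x v = leap_pos grad h x v N" for v by (rule q_tilde_pos[OF h N])
  note N' = N[symmetric]
  obtain X V where X: "trajectory grad X V" "X 0 = y" "V 0 = \<Phi> v" by (rule trajectory_exists)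
  obtain X' V' where X': "trajectory grad X' V'" "X' 0 = y" "V' 0 = \<Phi> v'" by (rule trajectory_exists)
  have XT: "leap_pos grad h x v N = X T" "leap_pos grad h x v' N = X' T"
    using ham_flow_eq[OF X(1)] ham_flow_eq[OF X'(1)] X(2,3) X'(2,3) ham_flow_shoot[of y] by (simp_all add: \<Phi>_def q)
  have "T * norm (v - \<Phi> v) \<le> 3/2 * norm (x - y) + h * (7/25 * norm v + 49/180 * T * L * norm y)"
    using shadow_endpoint(1)[OF h N' X(1) XT(1) refl refl] X(2,3) by simp
  then have "norm (v - \<Phi> v) \<le> (3/2 * norm (x - y) + h * (7/25 * norm v + 49/180 * T * L * norm y)) / T"
    using T_pos by (simp add: pos_le_divide_eq mult.commute)
  also have "\<dots> = p_xy T * norm (x - y) + h * (p_v T * norm v + p_x L * norm y)"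
    using T_pos by (simp add: p_xy_def p_v_def p_x_def field_simps)
  finally show "norm (\<Phi> v - v) \<le> p_xy T * norm (x - y) + h * (p_v T * norm v + p_x L * norm y)"
    by (simp add: norm_minus_commute)
  show "norm (v - v') \<le> (1 + slope_bound h (norm (x - y)) (norm y) R) * norm (\<Phi> v - \<Phi> v')"
    if R: "norm v \<le> R" "norm v' \<le> R"
  proof -
    have "norm (v - v' - (\<Phi> v - \<Phi> v')) \<le> (M * T^2 * (11/2 * norm (x - y) + 440/135 * h * R)
        + 352/675 * M * T * h * norm y + 44/135 * h / T) * norm (\<Phi> v - \<Phi> v')"
      using shadow_quad[OF h N' X(1) X'(1) _ XT refl R] X(2,3) X'(2,3) by simp
    also have "\<dots> = slope_bound h (norm (x - y)) (norm y) R * norm (\<Phi> v - \<Phi> v')"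
      by (simp add: slope_bound_def j_xy_def j_c_def j_v_def j_x_def algebra_simps)
    finally have 1: "norm (v - v' - (\<Phi> v - \<Phi> v')) \<le> slope_bound h (norm (x - y)) (norm y) R * norm (\<Phi> v - \<Phi> v')" .
    have "norm (v - v') \<le> norm (\<Phi> v - \<Phi> v') + norm (v - v' - (\<Phi> v - \<Phi> v'))"
      using norm_triangle_ineq[of "\<Phi> v - \<Phi> v'" "v - v' - (\<Phi> v - \<Phi> v')"] by simp
    with 1 show ?thesis by (simp add: distrib_right)
  qed
  show "norm (q_tilde grad T h x v - q_tilde grad T h x v' - T *\<^sub>R (v - v')) \<le> T * norm (v - v') / 11"
    unfolding q by (rule leap_pos_diff[OF h N'])
qed

text \<open>For \<open>h = 0\<close> the estimates are limits along the steps
  \<open>T / Suc N\<close>: all three are closed conditions, and \<open>shoot y\<close> is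
  Lipschitz.\<close>

lemma shoot_q_tilde:
  fixes x y :: 'a
  assumes h: "0 \<le> h" and N: "h > 0 \<Longrightarrow> \<exists>N::nat. T = real N * h"
  defines "\<Phi> \<equiv> \<lambda>v. shoot y (q_tilde grad T h x v)"
  shows "norm (\<Phi> v - v) \<le> p_xy T * norm (x - y) + h * (p_v T * norm v + p_x L * norm y)"
    and "norm v \<le> R \<Longrightarrow> norm v' \<le> R \<Longrightarrow>
      norm (v - v') \<le> (1 + slope_bound h (norm (x - y)) (norm y) R) * norm (\<Phi> v - \<Phi> v')"
    and "norm (q_tilde grad T h x v - q_tilde grad T h x v' - T *\<^sub>R (v - v')) \<le> T * norm (v - v') / 11"
proof -
  have "norm (\<Phi> v - v) \<le> p_xy T * norm (x - y) + h * (p_v T * norm v + p_x L * norm y) \<and>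
    (norm v \<le> R \<longrightarrow> norm v' \<le> R \<longrightarrow>
      norm (v - v') \<le> (1 + slope_bound h (norm (x - y)) (norm y) R) * norm (\<Phi> v - \<Phi> v')) \<and>
    norm (q_tilde grad T h x v - q_tilde grad T h x v' - T *\<^sub>R (v - v')) \<le> T * norm (v - v') / 11"
  proof (cases "h = 0")
    case False
    then obtain N where "T = real N * h" using N h by auto
    then show ?thesis using shoot_q_tilde_pos[of h N] False h unfolding \<Phi>_def by auto
  next
    case True
    define \<eta> where "\<eta> N = T / real (Suc N)" for N
    have \<eta>: "0 < \<eta> N" "T = real (Suc N) * \<eta> N" for N using T_pos by (auto simp: \<eta>_def)
    have \<eta>0: "\<eta> \<longlonglongrightarrow> 0"
      unfolding \<eta>_def using tendsto_mult[OF tendsto_const[of T] LIMSEQ_inverse_real_of_nat] by (simp add: divide_inverse)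
    have q: "(\<lambda>N. q_tilde grad T (\<eta> N) x v) \<longlonglongrightarrow> q_tilde grad T h x v" for v
      unfolding \<eta>_def True by (rule q_tilde_tendsto)
    have s: "(\<lambda>N. shoot y (q_tilde grad T (\<eta> N) x v)) \<longlonglongrightarrow> \<Phi> v" for v
    proof -
      have "(\<lambda>N. shoot y (q_tilde grad T (\<eta> N) x v) - \<Phi> v) \<longlonglongrightarrow> 0"
      proof (rule Lim_null_comparison)
        show "\<forall>\<^sub>F N in sequentially. norm (shoot y (q_tilde grad T (\<eta> N) x v) - \<Phi> v)
            \<le> 11/10 / T * norm (q_tilde grad T (\<eta> N) x v - q_tilde grad T h x v)"
        proof (intro always_eventually allI)
          fix N
          show "norm (shoot y (q_tilde grad T (\<eta> N) x v) - \<Phi> v)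
            \<le> 11/10 / T * norm (q_tilde grad T (\<eta> N) x v - q_tilde grad T h x v)"
            using shoot_dist(1)[of y "q_tilde grad T (\<eta> N) x v" "q_tilde grad T h x v"] T_pos
            unfolding \<Phi>_def by (simp add: pos_le_divide_eq)
        qed
        show "(\<lambda>N. 11/10 / T * norm (q_tilde grad T (\<eta> N) x v - q_tilde grad T h x v)) \<longlonglongrightarrow> 0"
          by (rule tendsto_mult_right_zero[OF tendsto_norm_zero[OF LIM_zero[OF q]]])
      qed
      then show ?thesis by (simp add: LIM_zero_iff)
    qed
    note b = shoot_q_tilde_pos[OF \<eta>]
    have "norm (\<Phi> v - v) \<le> p_xy T * norm (x - y) + h * (p_v T * norm v + p_x L * norm y)"
    proof (rule LIMSEQ_le)
      show "(\<lambda>N. norm (shoot y (q_tilde grad T (\<eta> N) x v) - v)) \<longlonglongrightarrow> norm (\<Phi> v - v)"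
        by (intro tendsto_intros s)
      show "(\<lambda>N. p_xy T * norm (x - y) + \<eta> N * (p_v T * norm v + p_x L * norm y)) \<longlonglongrightarrow>
          p_xy T * norm (x - y) + h * (p_v T * norm v + p_x L * norm y)"
        unfolding True by (intro tendsto_intros \<eta>0)
    qed (use b(1) in auto)
    moreover have "norm (v - v') \<le> (1 + slope_bound h (norm (x - y)) (norm y) R) * norm (\<Phi> v - \<Phi> v')"
      if "norm v \<le> R" "norm v' \<le> R"
    proof (rule LIMSEQ_le)
      show "(\<lambda>N. norm (v - v')) \<longlonglongrightarrow> norm (v - v')" by simp
      show "(\<lambda>N. (1 + slope_bound (\<eta> N) (norm (x - y)) (norm y) R) * norm (shoot y (q_tilde grad T (\<eta> N) x v) - shoot y (q_tilde grad T (\<eta> N) x v'))) \<longlonglongrightarrow>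
         (1 + slope_bound h (norm (x - y)) (norm y) R) * norm (\<Phi> v - \<Phi> v')"
        unfolding slope_bound_def True by (intro tendsto_intros \<eta>0 s)
    qed (use b(2)[OF that] in auto)
    moreover have "norm (q_tilde grad T h x v - q_tilde grad T h x v' - T *\<^sub>R (v - v')) \<le> T * norm (v - v') / 11"
      by (rule LIMSEQ_le_const2[OF tendsto_norm[OF tendsto_diff[OF tendsto_diff[OF q q] tendsto_const]]])
        (use b(3) in auto)
    ultimately show ?thesis by blast
  qed
  then show "norm (\<Phi> v - v) \<le> p_xy T * norm (x - y) + h * (p_v T * norm v + p_x L * norm y)"
    and "norm v \<le> R \<Longrightarrow> norm v' \<le> R \<Longrightarrow>
      norm (v - v') \<le> (1 + slope_bound h (norm (x - y)) (norm y) R) * norm (\<Phi> v - \<Phi> v')"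
    and "norm (q_tilde grad T h x v - q_tilde grad T h x v' - T *\<^sub>R (v - v')) \<le> T * norm (v - v') / 11"
    by auto
qed

lemma grad_continuous: "continuous_on S grad"
  by (rule lipschitz_on_continuous_on[of L]) (auto simp: lipschitz_on_def dist_norm grad_lip L_nonneg)

lemma leap_iterate_continuous: "continuous_on UNIV (leap_step grad h ^^ n)"
proof (induction n)
  case (Suc n)
  have 1: "continuous_on UNIV (leap_step grad h)"
    unfolding leap_step_def Let_def split_beta
    by (intro continuous_intros continuous_on_compose2[OF grad_continuous[of UNIV]]) auto
  show ?case using continuous_on_compose2[OF 1 Suc] by (simp add: o_def)
qed (simp add: id_def)

text \<open>At \<open>h = 0\<close> joint measurability is inherited from the continuous leapfrog
  maps as a pointwise limit.\<close>

lemma q_tilde_measurable [measurable]: "(\<lambda>(x, v). q_tilde grad T h x v) \<in> borel_measurable (borel \<Otimes>\<^sub>M borel)"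
proof -
  have pos: "(\<lambda>(x, v). q_tilde grad T h x v) \<in> borel_measurable (borel \<Otimes>\<^sub>M borel)" if "h \<noteq> 0" for h
    unfolding borel_prod q_tilde_def using that leap_iterate_continuous
    by (intro borel_measurable_continuous_onI) (auto simp: split_beta intro!: continuous_intros)
  show ?thesis
  proof (cases "h = 0")
    case True
    show ?thesis unfolding True
    proof (rule borel_measurable_LIMSEQ_metric)
      show "(\<lambda>(x, v). q_tilde grad T (T / real (Suc N)) x v) \<in> borel_measurable (borel \<Otimes>\<^sub>M borel)" for N
        using T_pos by (intro pos) auto
      show "(\<lambda>N. (case z of (x, v) \<Rightarrow> q_tilde grad T (T / real (Suc N)) x v)) \<longlonglongrightarrow> (case z of (x, v) \<Rightarrow> q_tilde grad T 0 x v)" for z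
        by (cases z) (simp add: q_tilde_tendsto del: of_nat_Suc)
    qed
  qed (rule pos)
qed

end

section \<open>Change of variables without Jacobians\<close>

text \<open>A small ball of radius \<rho> around \<open>\<Phi> v\<close> pulls back into a ball of
  radius about \<open>(1 + \<eta> v) * \<rho>\<close>, and the density compensates exactly this
  growth of volume. Vitali's theorem upgrades the estimate from balls to \<open>A\<close>; the
  exceptional null set stays null under the inverse of \<Phi>, which is Lipschitz by
  \<open>glob\<close>. Only \<open>A \<inter> range \<Phi>\<close> has to be covered.\<close>

lemma emeasure_distr_density_le_lborel:
  fixes \<Phi> :: "'a::euclidean_space \<Rightarrow> 'a" and \<eta> :: "'a \<Rightarrow> real"
  assumes \<Phi>: "continuous_on UNIV \<Phi>" and \<eta>: "continuous_on UNIV \<eta>" and \<eta>0: "\<And>v. 0 \<le> \<eta> v"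
    and glob: "\<And>v v'. norm (v - v') \<le> C * norm (\<Phi> v - \<Phi> v')"
    and loc: "\<And>v v'. norm (v - v') \<le> (1 + max (\<eta> v) (\<eta> v')) * norm (\<Phi> v - \<Phi> v')"
    and A: "A \<in> sets borel"
  shows "emeasure (distr (density lborel (\<lambda>v. ennreal (1 / (1 + \<eta> v) ^ DIM('a)))) borel \<Phi>) A \<le> emeasure lborel A"
proof (cases "emeasure lborel A = \<infinity>")
  case False
  have [measurable]: "\<Phi> \<in> borel_measurable borel" "\<eta> \<in> borel_measurable borel"
    using \<Phi> \<eta> by (auto intro: borel_measurable_continuous_onI)
  define J where "J v = ennreal (1 / (1 + \<eta> v) ^ DIM('a))" for v
  define \<mu> where "\<mu> = distr (density lborel J) borel \<Phi>"
  have J[measurable]: "J \<in> borel_measurable borel" unfolding J_def by measurable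
  have \<mu>: "emeasure \<mu> B = (\<integral>\<^sup>+v. J v * indicator (\<Phi> -` B) v \<partial>lborel)" if [measurable]: "B \<in> sets borel" for B
  proof -
    have "\<Phi> -` B \<in> sets borel" using measurable_sets[OF \<open>\<Phi> \<in> borel_measurable borel\<close> that] by simp
    then show ?thesis unfolding \<mu>_def by (simp add: emeasure_distr emeasure_density)
  qed
  obtain a where a: "emeasure lborel A = ennreal a" "0 \<le> a"
    using False by (cases "emeasure lborel A") auto
  have key: "emeasure \<mu> A \<le> ennreal ((1 + e) ^ (2 * DIM('a)) * (a + e))" if e: "0 < e" for e
  proof -
    obtain U where U: "open U" "A \<subseteq> U" "emeasure lborel (U - A) < ennreal e"
      using outer_regular_lborel[of A e] A e by (auto simp: sets_completionI_sets)
    \<comment> \<open>Admissible balls: the density is constant up to a factor \<open>1 + e\<close>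
      on their preimages, and staying inside \<open>U\<close> they exceed the volume of
      \<open>A\<close> by at most \<open>e\<close> in total.\<close>
    define K where "K = {(v, \<rho>). v \<in> \<Phi> -` A \<and> ball (\<Phi> v) \<rho> \<subseteq> U \<and> 0 < \<rho> \<and>
      (\<forall>v'. \<Phi> v' \<in> ball (\<Phi> v) \<rho> \<longrightarrow> 1 + \<eta> v' \<le> (1 + e) * (1 + \<eta> v) \<and> 1 + \<eta> v \<le> (1 + e) * (1 + \<eta> v'))}"
    let ?B = "\<lambda>(v, \<rho>). ball (\<Phi> v) \<rho>"
    have good: "\<exists>\<rho>. (v, \<rho>) \<in> K \<and> \<rho> < \<delta>" if v: "\<Phi> v \<in> A" and \<delta>: "0 < \<delta>" for v \<delta>
    proof -
      obtain \<rho>1 where \<rho>1: "0 < \<rho>1" "ball (\<Phi> v) \<rho>1 \<subseteq> U" using U v by (meson open_contains_ball subsetD)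
      define g where "g = e / (1 + e)"
      have g: "0 < g" using e by (simp add: g_def)
      obtain \<rho>2 where \<rho>2: "0 < \<rho>2" "\<And>v'. dist v' v < \<rho>2 \<Longrightarrow> dist (\<eta> v') (\<eta> v) < g"
        using \<eta> g by (metis UNIV_I continuous_on_iff)
      \<comment> \<open>Division by \<open>\<bar>C\<bar> + 1\<close> turns closeness of images into
        closeness of preimages via \<open>glob\<close>, so that continuity of \<eta>
        applies.\<close>
      define \<rho> where "\<rho> = min (min \<rho>1 (\<delta> / 2)) (\<rho>2 / (\<bar>C\<bar> + 1))"
      have \<rho>: "0 < \<rho>" "\<rho> \<le> \<rho>1" "\<rho> < \<delta>" "\<rho> \<le> \<rho>2 / (\<bar>C\<bar> + 1)" using \<rho>1 \<rho>2 \<delta> by (auto simp: \<rho>_def)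
      have "1 + \<eta> v' \<le> (1 + e) * (1 + \<eta> v) \<and> 1 + \<eta> v \<le> (1 + e) * (1 + \<eta> v')" if "\<Phi> v' \<in> ball (\<Phi> v) \<rho>" for v'
      proof -
        have "norm (v' - v) \<le> (\<bar>C\<bar> + 1) * norm (\<Phi> v' - \<Phi> v)"
          by (rule order_trans[OF glob]) (intro mult_right_mono, auto)
        also have "\<dots> < (\<bar>C\<bar> + 1) * \<rho>" using that by (intro mult_strict_left_mono) (auto simp: dist_norm norm_minus_commute)
        also have "\<dots> \<le> \<rho>2" using \<rho>(4) by (simp add: pos_le_divide_eq mult.commute)
        finally have "\<bar>\<eta> v' - \<eta> v\<bar> < g" using \<rho>2(2)[of v'] by (simp add: dist_norm)
        moreover have "g \<le> e" using e by (simp add: g_def field_simps)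
        moreover have "e * 1 \<le> e * (1 + \<eta> v)" "e * 1 \<le> e * (1 + \<eta> v')" using \<eta>0[of v] \<eta>0[of v'] e by (auto intro!: mult_left_mono)
        ultimately show ?thesis by (auto simp: algebra_simps abs_less_iff)
      qed
      then have "(v, \<rho>) \<in> K" using v \<rho> \<rho>1 subset_ball[OF \<rho>(2), of "\<Phi> v"] by (auto simp: K_def)
      then show ?thesis using \<rho> by blast
    qed
    obtain D where D: "countable D" "D \<subseteq> K"
      and disj: "pairwise (\<lambda>i j. disjnt (ball (\<Phi> (fst i)) (snd i)) (ball (\<Phi> (fst j)) (snd j))) D"
      and neg: "negligible (A \<inter> range \<Phi> - (\<Union>i \<in> D. ball (\<Phi> (fst i)) (snd i)))"
    proof (rule Vitali_covering_theorem_balls[of "A \<inter> range \<Phi>" K "\<lambda>i. \<Phi> (fst i)" snd])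
      fix x \<delta> :: real
      fix x assume "x \<in> A \<inter> range \<Phi>" and d: "0 < \<delta>"
      then obtain v where v: "x = \<Phi> v" "\<Phi> v \<in> A" by auto
      then obtain \<rho> where \<rho>: "(v, \<rho>) \<in> K" "\<rho> < \<delta>" using good[OF _ d] by auto
      then show "\<exists>i. i \<in> K \<and> x \<in> ball (\<Phi> (fst i)) (snd i) \<and> snd i < \<delta>"
        by (intro exI[of _ "(v, \<rho>)"]) (auto simp: v K_def)
    qed blast
    define W where "W i = ball (\<Phi> (fst i)) (snd i)" for i :: "'a \<times> real"
    have W[measurable]: "W i \<in> sets borel" for i by (simp add: W_def)
    have Wfam: "disjoint_family_on W D"
      using disj by (auto simp: disjoint_family_on_def W_def pairwise_def disjnt_def)
    have UW[measurable]: "(\<Union>i\<in>D. W i) \<in> sets borel" using D(1) by (intro sets.countable_UN'') auto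
    have ball_le: "emeasure \<mu> (W i) \<le> ennreal ((1 + e) ^ (2 * DIM('a))) * emeasure lborel (W i)" if "i \<in> D" for i
    proof -
      obtain v \<rho> where i: "i = (v, \<rho>)" by (cases i)
      have K: "(v, \<rho>) \<in> K" using that D i by auto
      then have \<rho>: "0 < \<rho>" and
        cmp: "\<And>v'. \<Phi> v' \<in> ball (\<Phi> v) \<rho> \<Longrightarrow> 1 + \<eta> v' \<le> (1 + e) * (1 + \<eta> v) \<and> 1 + \<eta> v \<le> (1 + e) * (1 + \<eta> v')"
        by (auto simp: K_def)
      define R where "R = (1 + e) * (1 + \<eta> v)"
      have R0: "0 < R" using e \<eta>0[of v] by (simp add: R_def add_pos_nonneg)
      have eta1: "0 < 1 + \<eta> v" for v using \<eta>0[of v] by simp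
      have sub: "\<Phi> -` (W i) \<subseteq> ball v (R * \<rho>)"
      proof
        fix v' assume "v' \<in> \<Phi> -` (W i)"
        then have in': "\<Phi> v' \<in> ball (\<Phi> v) \<rho>" by (simp add: W_def i)
        have "1 * (1 + \<eta> v) \<le> (1 + e) * (1 + \<eta> v)" using e eta1[of v] by (intro mult_right_mono) auto
        then have "1 + max (\<eta> v) (\<eta> v') \<le> R"
          using cmp[OF in'] unfolding R_def by (simp add: max_def)
        then have "norm (v - v') \<le> R * norm (\<Phi> v - \<Phi> v')"
          by (intro order_trans[OF loc] mult_right_mono) auto
        also have "\<dots> < R * \<rho>" using in' R0 by (intro mult_strict_left_mono) (auto simp: dist_norm)
        finally show "v' \<in> ball v (R * \<rho>)" by (simp add: dist_norm)
      qed
      have Jb: "J v' * indicator (\<Phi> -` W i) v' \<le> ennreal (((1 + e) / (1 + \<eta> v)) ^ DIM('a)) * indicator (ball v (R * \<rho>)) v'" for v'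
      proof (cases "v' \<in> \<Phi> -` W i")
        case True
        then have in': "\<Phi> v' \<in> ball (\<Phi> v) \<rho>" by (simp add: W_def i)
        have "1 / (1 + \<eta> v') \<le> (1 + e) / (1 + \<eta> v)"
          using cmp[OF in'] eta1[of v] eta1[of v'] by (simp add: divide_simps mult.commute)
        then have "(1 / (1 + \<eta> v')) ^ DIM('a) \<le> ((1 + e) / (1 + \<eta> v)) ^ DIM('a)"
          using eta1[of v'] by (intro power_mono) auto
        then show ?thesis using True sub by (auto simp: J_def power_one_over intro!: ennreal_leI)
      qed simp
      have "emeasure \<mu> (W i) \<le> (\<integral>\<^sup>+v'. ennreal (((1 + e) / (1 + \<eta> v)) ^ DIM('a)) * indicator (ball v (R * \<rho>)) v' \<partial>lborel)"
        unfolding \<mu>[OF W] by (intro nn_integral_mono Jb)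
      also have "\<dots> = ennreal (((1 + e) / (1 + \<eta> v)) ^ DIM('a)) * emeasure lborel (ball v (R * \<rho>))"
        by (rule nn_integral_cmult_indicator) simp
      also have "\<dots> = ennreal (((1 + e) / (1 + \<eta> v)) ^ DIM('a) * (unit_ball_vol (real DIM('a)) * (R * \<rho>) ^ DIM('a)))"
        using R0 \<rho> e eta1[of v] by (subst emeasure_ball) (auto simp: ennreal_mult'')
      also have "((1 + e) / (1 + \<eta> v)) ^ DIM('a) * (unit_ball_vol (real DIM('a)) * (R * \<rho>) ^ DIM('a))
          = (1 + e) ^ (2 * DIM('a)) * (unit_ball_vol (real DIM('a)) * \<rho> ^ DIM('a))"
      proof -
        \<comment> \<open>One factor \<open>1 + e\<close> stems from the radius and one from the
          density, hence the exponent \<open>2 * DIM('a)\<close>.\<close>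
        have "(1 + e) / (1 + \<eta> v) * R = (1 + e)^2" using eta1[of v] by (simp add: R_def power2_eq_square)
        then have "((1 + e) / (1 + \<eta> v)) ^ DIM('a) * R ^ DIM('a) = (1 + e) ^ (2 * DIM('a))"
          by (metis power_mult power_mult_distrib)
        then show ?thesis by (simp add: power_mult_distrib mult_ac)
      qed
      also have "ennreal \<dots> = ennreal ((1 + e) ^ (2 * DIM('a))) * emeasure lborel (W i)"
        unfolding W_def i using \<rho> e by (simp add: emeasure_ball ennreal_mult'')
      finally show ?thesis .
    qed
    have "emeasure \<mu> (\<Union>i\<in>D. W i) = (\<integral>\<^sup>+i. emeasure \<mu> (W i) \<partial>count_space D)"
      using D(1) Wfam by (intro emeasure_UN_countable) (auto simp: \<mu>_def)
    also have "\<dots> \<le> (\<integral>\<^sup>+i. ennreal ((1 + e) ^ (2 * DIM('a))) * emeasure lborel (W i) \<partial>count_space D)"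
      by (intro nn_integral_mono ball_le) auto
    also have "\<dots> = ennreal ((1 + e) ^ (2 * DIM('a))) * (\<integral>\<^sup>+i. emeasure lborel (W i) \<partial>count_space D)"
      by (intro nn_integral_cmult) auto
    also have "(\<integral>\<^sup>+i. emeasure lborel (W i) \<partial>count_space D) = emeasure lborel (\<Union>i\<in>D. W i)"
      using D(1) Wfam by (intro emeasure_UN_countable[symmetric]) auto
    also have "\<dots> \<le> emeasure lborel U"
    proof (rule emeasure_mono)
      show "(\<Union>i\<in>D. W i) \<subseteq> U" using D(2) unfolding W_def K_def by (intro UN_least) force
    qed (use U in auto)
    also have "emeasure lborel U \<le> ennreal (a + e)"
    proof -
      have "emeasure lborel U = emeasure lborel A + emeasure lborel (U - A)"
        using U A by (subst plus_emeasure) (auto simp: Un_absorb1)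
      also have "\<dots> \<le> ennreal a + ennreal e" unfolding a using U by (intro add_left_mono) auto
      finally show ?thesis using a e by simp
    qed
    finally have 1: "emeasure \<mu> (\<Union>i\<in>D. W i) \<le> ennreal ((1 + e) ^ (2 * DIM('a)) * (a + e))"
      using e a by (simp add: ennreal_mult'' mult_left_mono)
    have A'[measurable]: "A - (\<Union>i\<in>D. W i) \<in> sets borel" using A by auto
    \<comment> \<open>The covering misses a null set of image points; its preimage under \<Phi> is
      its image under the Lipschitz left inverse \<Psi>, hence null as well.\<close>
    have "emeasure \<mu> (A - (\<Union>i\<in>D. W i)) = 0"
    proof -
      obtain \<Psi> where \<Psi>: "\<And>v. \<Psi> (\<Phi> v) = v"
      proof -
        have "inj \<Phi>" using glob by (intro injI) (metis diff_self mult_zero_right norm_le_zero_iff norm_zero right_minus_eq)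
        then show ?thesis using that[of "inv \<Phi>"] by simp
      qed
      have "\<Phi> -` (A - (\<Union>i\<in>D. W i)) = \<Psi> ` (A \<inter> range \<Phi> - (\<Union>i \<in> D. W i))"
      proof (intro set_eqI iffI)
        fix v assume "v \<in> \<Phi> -` (A - (\<Union>i\<in>D. W i))"
        then show "v \<in> \<Psi> ` (A \<inter> range \<Phi> - (\<Union>i \<in> D. W i))"
          by (intro image_eqI[of _ _ "\<Phi> v"]) (auto simp: \<Psi>)
      qed (auto simp: \<Psi>)
      moreover have "negligible (\<Psi> ` (A \<inter> range \<Phi> - (\<Union>i \<in> D. W i)))"
      proof (rule negligible_locally_Lipschitz_image)
        show "negligible (A \<inter> range \<Phi> - (\<Union>i \<in> D. W i))" using neg by (simp add: W_def)
        fix x assume x: "x \<in> A \<inter> range \<Phi> - (\<Union>i \<in> D. W i)"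
        show "\<exists>T B. open T \<and> x \<in> T \<and> (\<forall>y\<in>(A \<inter> range \<Phi> - (\<Union>i \<in> D. W i)) \<inter> T. norm (\<Psi> y - \<Psi> x) \<le> B * norm (y - x))"
          using x glob \<Psi> by (intro exI[of _ UNIV] exI[of _ C]) auto
      qed simp
      ultimately have n: "negligible (\<Phi> -` (A - (\<Union>i\<in>D. W i)))" by simp
      have [measurable]: "\<Phi> -` (A - (\<Union>i\<in>D. W i)) \<in> sets borel"
        using measurable_sets[OF \<open>\<Phi> \<in> borel_measurable borel\<close> A'] by simp
      have "\<Phi> -` (A - (\<Union>i\<in>D. W i)) \<in> null_sets lborel"
        using n by (simp add: negligible_iff_null_sets null_sets_completion_iff)
      then show ?thesis unfolding \<mu>[OF A'] by (rule nn_integral_null_set)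
    qed
    have "emeasure \<mu> A \<le> emeasure \<mu> ((\<Union>i\<in>D. W i) \<union> (A - (\<Union>i\<in>D. W i)))"
      by (intro emeasure_mono) (auto simp: \<mu>_def A)
    also have "\<dots> \<le> emeasure \<mu> (\<Union>i\<in>D. W i) + emeasure \<mu> (A - (\<Union>i\<in>D. W i))"
      by (intro emeasure_subadditive) (auto simp: \<mu>_def A)
    finally show ?thesis using 1 \<open>emeasure \<mu> (A - (\<Union>i\<in>D. W i)) = 0\<close> by simp
  qed
  have "((\<lambda>e. ennreal ((1 + e) ^ (2 * DIM('a)) * (a + e))) \<longlongrightarrow> ennreal ((1 + 0) ^ (2 * DIM('a)) * (a + 0))) (at_right 0)"
    by (intro tendsto_ennrealI tendsto_intros)
  then have "emeasure \<mu> A \<le> ennreal ((1 + 0) ^ (2 * DIM('a)) * (a + 0))"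
    by (rule tendsto_lowerbound) (use key in \<open>auto simp: eventually_at_right_less intro: eventually_at_rightI[of 0 1]\<close>)
  then show ?thesis by (simp add: a \<mu>_def J_def[abs_def])
qed simp

lemma nn_integral_change_of_variables_le:
  fixes \<Phi> :: "'a::euclidean_space \<Rightarrow> 'a" and \<eta> :: "'a \<Rightarrow> real" and k :: "'a \<Rightarrow> ennreal"
  assumes \<Phi>: "continuous_on UNIV \<Phi>" and \<eta>: "continuous_on UNIV \<eta>" and \<eta>0: "\<And>v. 0 \<le> \<eta> v"
    and glob: "\<And>v v'. norm (v - v') \<le> C * norm (\<Phi> v - \<Phi> v')"
    and loc: "\<And>v v'. norm (v - v') \<le> (1 + max (\<eta> v) (\<eta> v')) * norm (\<Phi> v - \<Phi> v')"
    and k [measurable]: "k \<in> borel_measurable borel"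
  shows "(\<integral>\<^sup>+v. k (\<Phi> v) * ennreal (1 / (1 + \<eta> v) ^ DIM('a)) \<partial>lborel) \<le> (\<integral>\<^sup>+w. k w \<partial>lborel)"
proof -
  have [measurable]: "\<Phi> \<in> borel_measurable borel" "\<eta> \<in> borel_measurable borel"
    using \<Phi> \<eta> by (auto intro: borel_measurable_continuous_onI)
  let ?\<mu> = "distr (density lborel (\<lambda>v. ennreal (1 / (1 + \<eta> v) ^ DIM('a)))) borel \<Phi>"
  have "(\<integral>\<^sup>+v. k (\<Phi> v) * ennreal (1 / (1 + \<eta> v) ^ DIM('a)) \<partial>lborel) = (\<integral>\<^sup>+w. k w \<partial>?\<mu>)"
    by (subst nn_integral_distr, simp, simp, subst nn_integral_density) (auto simp: mult.commute)
  also have "\<dots> \<le> (\<integral>\<^sup>+w. k w \<partial>lborel)"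
    by (intro nn_integral_mono_measure)
      (auto simp: le_measure intro!: emeasure_distr_density_le_lborel assms)
  finally show ?thesis .
qed

section \<open>Gaussian moments and the transport inequality\<close>

lemma nn_integral_gaussian_1d:
  assumes c: "0 < c"
  shows "(\<integral>\<^sup>+x. ennreal (exp (- c * x^2 / 2)) \<partial>lborel) = ennreal (sqrt (2 * pi / c))"
proof -
  define \<sigma> where "\<sigma> = 1 / sqrt c"
  have \<sigma>: "0 < \<sigma>" "\<sigma>^2 = 1 / c" using c by (auto simp: \<sigma>_def power_divide)
  interpret prob_space "density lborel (normal_density 0 \<sigma>)"
    using \<sigma> by (intro prob_space_normal_density)
  have "1 = (\<integral>\<^sup>+x. ennreal (normal_density 0 \<sigma> x) \<partial>lborel)"
    using emeasure_space_1 by (simp add: emeasure_density)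
  also have "\<dots> = (\<integral>\<^sup>+x. ennreal (1 / sqrt (2 * pi / c)) * ennreal (exp (- c * x^2 / 2)) \<partial>lborel)"
    using c \<sigma> by (intro nn_integral_cong) (simp add: normal_density_def flip: ennreal_mult)
  also have "\<dots> = ennreal (1 / sqrt (2 * pi / c)) * (\<integral>\<^sup>+x. ennreal (exp (- c * x^2 / 2)) \<partial>lborel)"
    by (intro nn_integral_cmult) auto
  finally have e: "1 = ennreal (1 / sqrt (2 * pi / c)) * (\<integral>\<^sup>+x. ennreal (exp (- c * x^2 / 2)) \<partial>lborel)" .
  have "ennreal (sqrt (2 * pi / c)) = ennreal (sqrt (2 * pi / c)) * (ennreal (1 / sqrt (2 * pi / c)) * (\<integral>\<^sup>+x. ennreal (exp (- c * x^2 / 2)) \<partial>lborel))"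
    using e by simp
  also have "\<dots> = ennreal (sqrt (2 * pi / c) * (1 / sqrt (2 * pi / c))) * (\<integral>\<^sup>+x. ennreal (exp (- c * x^2 / 2)) \<partial>lborel)"
    using c by (subst ennreal_mult) (auto simp: mult.assoc)
  also have "sqrt (2 * pi / c) * (1 / sqrt (2 * pi / c)) = 1" using c by simp
  finally show ?thesis by simp
qed

lemma nn_integral_gaussian:
  assumes c: "0 < c"
  shows "(\<integral>\<^sup>+v. ennreal (exp (- c * (norm v)^2 / 2)) \<partial>(lborel :: 'a::euclidean_space measure))
     = ennreal ((2 * pi / c) powr (real DIM('a) / 2))"
proof -
  have "exp (- c * (norm v)^2 / 2) = (\<Prod>b\<in>Basis. exp (- c * (v \<bullet> b)^2 / 2))" for v :: 'a
  proof -
    have "(norm v)^2 = (\<Sum>b\<in>Basis. (v \<bullet> b)^2)"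
      by (simp only: power2_norm_eq_inner) (subst euclidean_inner, simp add: power2_eq_square)
    then have "- c * (norm v)^2 / 2 = (\<Sum>b\<in>Basis. - c * (v \<bullet> b)^2 / 2)"
      by (simp add: sum_distrib_left sum_divide_distrib)
    then show ?thesis by (simp add: exp_sum)
  qed
  then have "(\<integral>\<^sup>+v. ennreal (exp (- c * (norm v)^2 / 2)) \<partial>(lborel :: 'a measure))
     = (\<integral>\<^sup>+v. (\<Prod>b\<in>Basis. ennreal (exp (- c * (v \<bullet> b)^2 / 2))) \<partial>(lborel :: 'a measure))"
    by (intro nn_integral_cong) (simp add: prod_ennreal)
  also have "\<dots> = (\<Prod>b\<in>(Basis :: 'a set). (\<integral>\<^sup>+x. ennreal (exp (- c * x^2 / 2)) \<partial>lborel))"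
    by (rule nn_integral_lborel_prod) auto
  also have "\<dots> = ennreal (sqrt (2 * pi / c) ^ DIM('a))"
    unfolding nn_integral_gaussian_1d[OF c] using c by (simp add: ennreal_power)
  also have "sqrt (2 * pi / c) ^ DIM('a) = (2 * pi / c) powr (real DIM('a) / 2)"
    using c by (simp add: powr_half_sqrt[symmetric] powr_realpow[symmetric] powr_powr)
  finally show ?thesis .
qed

definition gauss_density :: "'a::euclidean_space \<Rightarrow> real" where
  "gauss_density v = (2 * pi) powr (- real DIM('a) / 2) * exp (- (norm v * norm v) / 2)"

lemma gauss_density_measurable [measurable]: "gauss_density \<in> borel_measurable borel"
  unfolding gauss_density_def by measurable

lemma gauss_density_pos: "0 < gauss_density v"
  by (simp add: gauss_density_def)

lemma std_gauss_eq: "std_gauss = density lborel (\<lambda>v. ennreal (gauss_density v))"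
  by (simp add: std_gauss_def gauss_density_def)

lemma sets_std_gauss [measurable_cong, simp]: "sets std_gauss = sets borel"
  by (simp add: std_gauss_def)

lemma space_std_gauss [simp]: "space std_gauss = UNIV"
  by (simp add: std_gauss_def)

lemma nn_integral_std_gauss:
  assumes [measurable]: "g \<in> borel_measurable borel"
  shows "(\<integral>\<^sup>+v. g v \<partial>std_gauss) = (\<integral>\<^sup>+v. ennreal (gauss_density v) * g v \<partial>lborel)"
  unfolding std_gauss_eq by (rule nn_integral_density) auto

text \<open>The moment generating function of a chi-squared variable.\<close>

lemma nn_integral_std_gauss_exp_square:
  assumes l: "l < 1/2"
  shows "(\<integral>\<^sup>+v. ennreal (exp (l * (norm v)^2)) \<partial>(std_gauss :: 'a::euclidean_space measure))
     = ennreal ((1 - 2 * l) powr (- real DIM('a) / 2))"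
proof -
  have "(\<integral>\<^sup>+v. ennreal (exp (l * (norm v)^2)) \<partial>(std_gauss :: 'a measure))
     = (\<integral>\<^sup>+v. ennreal ((2 * pi) powr (- real DIM('a) / 2)) * ennreal (exp (- (1 - 2 * l) * (norm v)^2 / 2)) \<partial>(lborel :: 'a measure))"
    by (subst nn_integral_std_gauss)
      (auto intro!: nn_integral_cong simp: gauss_density_def mult.assoc power2_eq_square field_simps
        simp flip: ennreal_mult exp_add)
  also have "\<dots> = ennreal ((2 * pi) powr (- real DIM('a) / 2)) * ennreal ((2 * pi / (1 - 2 * l)) powr (real DIM('a) / 2))"
    using l nn_integral_gaussian[of "1 - 2 * l", where 'a='a] by (subst nn_integral_cmult) simp_all
  also have "\<dots> = ennreal ((2 * pi) powr (- real DIM('a) / 2) * (2 * pi / (1 - 2 * l)) powr (real DIM('a) / 2))"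
    by (simp add: ennreal_mult)
  also have "(2 * pi) powr (- real DIM('a) / 2) * (2 * pi / (1 - 2 * l)) powr (real DIM('a) / 2) = (1 - 2 * l) powr (- real DIM('a) / 2)"
    using l by (simp add: powr_divide powr_minus field_simps)
  finally show ?thesis .
qed

lemma prob_space_std_gauss: "prob_space (std_gauss :: 'a::euclidean_space measure)"
  using nn_integral_std_gauss_exp_square[where 'a='a, of 0]
  by (intro prob_spaceI) simp

text \<open>The splitting \<open>t R \<le> z \<sigma> R\<^sup>2 / 2 + t\<^sup>2 / (2 z \<sigma>)\<close>, with the optimal \<open>z\<close>,
  recovers the constant of the Gaussian concentration inequality.\<close>

lemma nn_integral_std_gauss_exp_le:
  assumes t: "0 \<le> t" and l: "0 \<le> l" "l < 1/2" and d: "d = real DIM('a)" and \<sigma>: "\<sigma> = 1 - 2 * l"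
  shows "(\<integral>\<^sup>+v. ennreal (exp (t * norm v + l * (norm v)^2)) \<partial>(std_gauss :: 'a::euclidean_space measure))
     \<le> ennreal (exp (d * l / \<sigma> + t * sqrt d / sqrt \<sigma> + t^2 / (2 * \<sigma>)))"
proof -
  have d0: "1 \<le> d" using d DIM_positive[where 'a='a] by simp
  have \<sigma>0: "0 < \<sigma>" "\<sigma> \<le> 1" using l \<sigma> by auto
  define \<tau> where "\<tau> = t / sqrt \<sigma>"
  have \<tau>: "0 \<le> \<tau>" "t = \<tau> * sqrt \<sigma>" using t \<sigma>0 by (auto simp: \<tau>_def)
  define z where "z = \<tau> / (\<tau> + sqrt d)"
  have z: "0 \<le> z" "z < 1" using \<tau> d0 by (auto simp: z_def divide_simps add_nonneg_pos)
  define l' where "l' = l + z * \<sigma> / 2"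
  have l': "1 - 2 * l' = \<sigma> * (1 - z)" by (simp add: l'_def \<sigma> field_simps)
  have pos: "0 < \<sigma> * (1 - z)" using \<sigma>0 z by simp
  define c where "c = \<tau> * (\<tau> + sqrt d) / 2"
  have le: "t * R + l * R^2 \<le> l' * R^2 + c" for R
  proof (cases "\<tau> = 0")
    case True
    then show ?thesis using \<tau> by (simp add: l'_def c_def z_def)
  next
    case False
    define y where "y = \<tau> + sqrt d"
    have y: "0 < y" using \<tau> d0 by (auto simp: y_def add_nonneg_pos)
    have "0 \<le> \<tau> / (2 * y) * (sqrt \<sigma> * R - y)^2" using \<tau> y by auto
    also have "\<dots> = \<tau> / (2 * y) * (\<sigma> * R^2 + y^2 - 2 * (sqrt \<sigma> * R * y))"
      using \<sigma>0 by (simp add: power2_diff power_mult_distrib)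
    also have "\<dots> = z * \<sigma> / 2 * R^2 + c - t * R"
      using y unfolding z_def c_def y_def[symmetric] \<tau>(2) by (simp add: field_simps power2_eq_square)
    finally show ?thesis by (simp add: l'_def algebra_simps)
  qed
  have "(\<integral>\<^sup>+v. ennreal (exp (t * norm v + l * (norm v)^2)) \<partial>(std_gauss :: 'a measure))
     \<le> (\<integral>\<^sup>+v. ennreal (exp c) * ennreal (exp (l' * (norm v)^2)) \<partial>(std_gauss :: 'a measure))"
    using le by (intro nn_integral_mono) (simp add: add.commute[of c] flip: ennreal_mult exp_add)
  also have "\<dots> = ennreal (exp c) * ennreal ((1 - 2 * l') powr (- real DIM('a) / 2))"
    using pos l' by (subst nn_integral_cmult) (auto simp: nn_integral_std_gauss_exp_square)
  also have "\<dots> = ennreal (exp (c - d / 2 * ln (\<sigma> * (1 - z))))"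
  proof -
    have "\<sigma> * (1 - z) \<noteq> 0" using pos by linarith
    then have "exp c * (1 - 2 * l') powr (- real DIM('a) / 2) = exp (c - d / 2 * ln (\<sigma> * (1 - z)))"
      unfolding l' powr_def d by (simp only: if_False exp_add[symmetric]) simp
    then show ?thesis by (simp only: ennreal_mult'[symmetric] exp_ge_zero)
  qed
  also have "\<dots> \<le> ennreal (exp (d * l / \<sigma> + t * sqrt d / sqrt \<sigma> + t^2 / (2 * \<sigma>)))"
  proof -
    \<comment> \<open>Both logarithms are estimated by \<open>- ln x \<le> 1 / x - 1\<close>; for
      the chosen \<open>z\<close> the second right-hand side is exactly
      \<open>\<tau> / sqrt d\<close>.\<close>
    have "- ln \<sigma> \<le> 2 * l / \<sigma>"
      using ln_le_minus_one[of "1 / \<sigma>"] \<sigma>0 by (simp add: ln_div \<sigma> field_simps)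
    then have 1: "d / 2 * - ln \<sigma> \<le> d * l / \<sigma>"
      using mult_left_mono[of "- ln \<sigma>" "2 * l / \<sigma>" "d / 2"] d0 by simp
    have "1 / (1 - z) = 1 + \<tau> / sqrt d"
      using \<tau> d0 by (simp add: z_def divide_simps add_nonneg_eq_0_iff)
    moreover have "- ln (1 - z) \<le> 1 / (1 - z) - 1"
      using ln_le_minus_one[of "1 / (1 - z)"] z by (simp add: ln_div)
    ultimately have "- ln (1 - z) \<le> \<tau> / sqrt d" by linarith
    then have 2: "d / 2 * - ln (1 - z) \<le> \<tau> * sqrt d / 2"
    proof -
      have "d / 2 * - ln (1 - z) \<le> d / 2 * (\<tau> / sqrt d)" using d0 \<open>- ln (1 - z) \<le> \<tau> / sqrt d\<close> by (intro mult_left_mono) auto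
      also have "\<dots> = (d / sqrt d) * \<tau> / 2" by simp
      also have "d / sqrt d = sqrt d" using d0 by (intro real_div_sqrt) simp
      finally show ?thesis by (simp add: mult.commute)
    qed
    have 3: "t * sqrt d / sqrt \<sigma> = \<tau> * sqrt d" "t^2 / (2 * \<sigma>) = \<tau>^2 / 2"
      using \<sigma>0 by (auto simp: \<tau>(2) power_mult_distrib)
    have "c - d / 2 * ln (\<sigma> * (1 - z)) = c + d / 2 * - ln \<sigma> + d / 2 * - ln (1 - z)"
      using \<sigma>0 z by (subst ln_mult) (auto simp: algebra_simps)
    also have "\<dots> \<le> d * l / \<sigma> + t * sqrt d / sqrt \<sigma> + t^2 / (2 * \<sigma>)"
    proof -
      have "c = \<tau>^2 / 2 + \<tau> * sqrt d / 2" by (simp add: c_def power2_eq_square field_simps)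
      then show ?thesis using 1 2 unfolding 3 by linarith
    qed
    finally show ?thesis by (intro ennreal_leI) simp
  qed
  finally show ?thesis .
qed

section \<open>Transport inequality for the Gaussian velocity\<close>

context force_field
begin

text \<open>Logarithmic loss in the change of variables at a velocity of norm \<open>R\<close>. The
  local \<open>s\<close> bounds \<open>norm (\<Phi> v - v)\<close>, so
  \<open>R * s + s^2 / 2\<close> bounds half the growth of the squared norm; the last term bounds
  the logarithm of \<open>(1 + \<eta> v) ^ DIM('a)\<close>.\<close>

definition cost :: "real \<Rightarrow> real \<Rightarrow> real \<Rightarrow> real \<Rightarrow> real" where
  "cost h r y R =
     (let s = p_xy T * r + h * (p_v T * R + p_x L * y)
      in R * s + s^2 / 2 + real DIM('a) * slope_bound h r y R)"

lemma ham_flow_continuous: "continuous_on UNIV (ham_flow grad T y)"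
proof (rule lipschitz_on_continuous_on)
  show "(12/11 * T)-lipschitz_on UNIV (ham_flow grad T y)"
  proof (rule lipschitz_onI)
    fix w w'
    have "norm (ham_flow grad T y w - ham_flow grad T y w') \<le> norm (T *\<^sub>R (w - w')) + norm (ham_flow grad T y w - ham_flow grad T y w' - T *\<^sub>R (w - w'))"
      using norm_triangle_ineq[of "T *\<^sub>R (w - w')" "ham_flow grad T y w - ham_flow grad T y w' - T *\<^sub>R (w - w')"] by simp
    then show "dist (ham_flow grad T y w) (ham_flow grad T y w') \<le> 12/11 * T * dist w w'"
      using ham_flow_diff[of y w w'] T_pos by (simp add: dist_norm)
  qed (use T_pos in auto)
qed

lemma slope_bound_nonneg: "0 \<le> h \<Longrightarrow> 0 \<le> r \<Longrightarrow> 0 \<le> y \<Longrightarrow> 0 \<le> R \<Longrightarrow> 0 \<le> slope_bound h r y R"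
  using T_pos M_nonneg by (simp add: slope_bound_def j_xy_def j_c_def j_v_def j_x_def)

text \<open>Brings the Lipschitz bound on the ball of radius \<open>max (norm v) (norm v')\<close>
  into the form required by the change of variables.\<close>

lemma slope_bound_max: "0 \<le> h \<Longrightarrow> slope_bound h r y (max R R') = max (slope_bound h r y R) (slope_bound h r y R')"
proof -
  assume h: "0 \<le> h"
  have "mono (slope_bound h r y)"
    using T_pos M_nonneg h unfolding slope_bound_def j_v_def
    by (intro monoI add_left_mono mult_left_mono add_right_mono add_mono) auto
  then show ?thesis by (auto simp: max_def mono_def antisym)
qed

text \<open>Since \<open>ham_flow grad T y (\<Phi> v) = q_tilde grad T h x v\<close>, both
  integrands evaluate \<open>G\<close> at the same point and only densities have to be compared.
  Therefore \<open>G\<close> may be any nonnegative Borel function.\<close>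

lemma nn_integral_transport_le:
  assumes h: "0 \<le> h" and N: "h > 0 \<Longrightarrow> \<exists>N::nat. T = real N * h"
    and G [measurable]: "G \<in> borel_measurable borel"
  shows "(\<integral>\<^sup>+v. G (q_tilde grad T h x v) * ennreal (exp (- cost h (norm (x - y)) (norm y) (norm v))) \<partial>std_gauss)
      \<le> (\<integral>\<^sup>+w. G (ham_flow grad T y w) \<partial>std_gauss)"
proof -
  define \<Phi> where "\<Phi> v = shoot y (q_tilde grad T h x v)" for v
  define \<eta> where "\<eta> v = slope_bound h (norm (x - y)) (norm y) (norm v)" for v :: 'a
  note b1 = shoot_q_tilde(1)[OF h N, where x=x and y=y, folded \<Phi>_def]
    and b2 = shoot_q_tilde(2)[OF h N, where x=x and y=y, folded \<Phi>_def]
    and b3 = shoot_q_tilde(3)[OF h N, where x=x]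
  have qd: "10/11 * T * norm (v - v') \<le> norm (q_tilde grad T h x v - q_tilde grad T h x v')"
    "norm (q_tilde grad T h x v - q_tilde grad T h x v') \<le> 12/11 * T * norm (v - v')" for v v'
  proof -
    let ?q = "q_tilde grad T h x v - q_tilde grad T h x v'"
    have "norm (T *\<^sub>R (v - v')) \<le> norm ?q + norm (?q - T *\<^sub>R (v - v'))"
      using norm_triangle_ineq4[of ?q "?q - T *\<^sub>R (v - v')"] by simp
    then show "10/11 * T * norm (v - v') \<le> norm ?q" using b3[of v v'] T_pos by simp
    have "norm ?q \<le> norm (T *\<^sub>R (v - v')) + norm (?q - T *\<^sub>R (v - v'))"
      using norm_triangle_ineq[of "T *\<^sub>R (v - v')" "?q - T *\<^sub>R (v - v')"] by simp
    then show "norm ?q \<le> 12/11 * T * norm (v - v')" using b3[of v v'] T_pos by simp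
  qed
  have \<Phi>c: "continuous_on UNIV \<Phi>"
  proof (rule lipschitz_on_continuous_on)
    show "(6/5)-lipschitz_on UNIV \<Phi>"
    proof (rule lipschitz_onI)
      fix v v'
      have "norm (\<Phi> v - \<Phi> v') * T \<le> 11/10 * (12/11 * T * norm (v - v'))"
        unfolding \<Phi>_def by (rule order_trans[OF shoot_dist(1) mult_left_mono[OF qd(2)]]) simp
      then have "T * norm (\<Phi> v - \<Phi> v') \<le> T * (6/5 * norm (v - v'))" by (simp add: mult_ac)
      then show "dist (\<Phi> v) (\<Phi> v') \<le> 6/5 * dist v v'" using T_pos by (simp add: dist_norm)
    qed simp
  qed
  have \<eta>c: "continuous_on UNIV \<eta>" unfolding \<eta>_def slope_bound_def by (intro continuous_intros)
  have \<eta>0: "0 \<le> \<eta> v" for v unfolding \<eta>_def using h by (intro slope_bound_nonneg) auto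
  \<comment> \<open>6/5 is the quotient of 12/11 and 10/11, the distortions of the flow and of the
    leapfrog map. This crude bound controls null sets and the size of preimages; the volume factor
    comes from \<open>loc\<close>.\<close>
  have glob: "norm (v - v') \<le> 6/5 * norm (\<Phi> v - \<Phi> v')" for v v'
  proof -
    have "10/11 * T * norm (v - v') \<le> 12/11 * T * norm (\<Phi> v - \<Phi> v')"
      unfolding \<Phi>_def by (rule order_trans[OF qd(1) shoot_dist(2)])
    then have "T * norm (v - v') \<le> T * (6/5 * norm (\<Phi> v - \<Phi> v'))" by simp
    then show ?thesis using T_pos by simp
  qed
  have loc: "norm (v - v') \<le> (1 + max (\<eta> v) (\<eta> v')) * norm (\<Phi> v - \<Phi> v')" for v v'
    using b2[of v "max (norm v) (norm v')" v'] by (simp add: \<eta>_def slope_bound_max[OF h])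
  have [measurable]: "ham_flow grad T y \<in> borel_measurable borel"
    by (rule borel_measurable_continuous_onI[OF ham_flow_continuous])
  have [measurable]: "q_tilde grad T h x \<in> borel_measurable borel"
    using measurable_compose[OF measurable_Pair1' q_tilde_measurable[of h], of x] by simp
  define k where "k w = ennreal (gauss_density w) * G (ham_flow grad T y w)" for w
  have k[measurable]: "k \<in> borel_measurable borel" unfolding k_def by measurable
  have le: "ennreal (gauss_density v) * (G (q_tilde grad T h x v) * ennreal (exp (- cost h (norm (x - y)) (norm y) (norm v))))
      \<le> k (\<Phi> v) * ennreal (1 / (1 + \<eta> v) ^ DIM('a))" for v
  proof -
    define s where "s = p_xy T * norm (x - y) + h * (p_v T * norm v + p_x L * norm y)"
    have s: "norm (\<Phi> v - v) \<le> s" using b1 by (simp add: s_def)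
    then have s0: "0 \<le> s" using norm_ge_zero order_trans by blast
    have "norm (\<Phi> v) \<le> norm v + s" using norm_triangle_ineq[of v "\<Phi> v - v"] s by simp
    then have "norm (\<Phi> v) * norm (\<Phi> v) \<le> (norm v + s) * (norm v + s)" using s0 by (intro mult_mono) auto
    then have "- (norm v * norm v) / 2 - (norm v * s + s^2 / 2) \<le> - (norm (\<Phi> v) * norm (\<Phi> v)) / 2"
      by (simp add: algebra_simps power2_eq_square)
    then have 1: "gauss_density v * exp (- (norm v * s + s^2 / 2)) \<le> gauss_density (\<Phi> v)"
      unfolding gauss_density_def mult.assoc exp_add[symmetric] by (intro mult_left_mono) auto
    have "(1 + \<eta> v) ^ DIM('a) \<le> exp (\<eta> v) ^ DIM('a)" using \<eta>0[of v] by (intro power_mono) auto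
    then have 2: "exp (- (real DIM('a) * \<eta> v)) \<le> 1 / (1 + \<eta> v) ^ DIM('a)"
      using \<eta>0[of v] by (simp add: exp_minus exp_of_nat_mult exp_of_nat2_mult field_simps add_pos_nonneg)
    have "exp (- cost h (norm (x - y)) (norm y) (norm v)) = exp (- (norm v * s + s^2 / 2)) * exp (- (real DIM('a) * \<eta> v))"
      unfolding cost_def Let_def s_def[symmetric] \<eta>_def[symmetric] exp_add[symmetric] by simp
    then have "gauss_density v * exp (- cost h (norm (x - y)) (norm y) (norm v)) \<le> gauss_density (\<Phi> v) * (1 / (1 + \<eta> v) ^ DIM('a))"
      using mult_mono[OF 1 2] gauss_density_pos[of "\<Phi> v"] \<eta>0[of v] by (simp add: mult.assoc)
    then have le': "ennreal (gauss_density v * exp (- cost h (norm (x - y)) (norm y) (norm v))) * G (q_tilde grad T h x v)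
      \<le> ennreal (gauss_density (\<Phi> v) * (1 / (1 + \<eta> v) ^ DIM('a))) * G (q_tilde grad T h x v)"
      by (intro mult_right_mono ennreal_leI) auto
    have n: "0 \<le> gauss_density (\<Phi> v)" "0 \<le> gauss_density v" "0 \<le> 1 / (1 + \<eta> v) ^ DIM('a)"
      using gauss_density_pos[of "\<Phi> v"] gauss_density_pos[of v] \<eta>0[of v] by auto
    have flow: "ham_flow grad T y (\<Phi> v) = q_tilde grad T h x v" by (simp add: \<Phi>_def ham_flow_shoot)
    have "ennreal (gauss_density v) * (G (q_tilde grad T h x v) * ennreal (exp (- cost h (norm (x - y)) (norm y) (norm v))))
      = ennreal (gauss_density v * exp (- cost h (norm (x - y)) (norm y) (norm v))) * G (q_tilde grad T h x v)"
      unfolding ennreal_mult[OF n(2) exp_ge_zero] by (simp only: mult_ac)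
    also note le'
    also have "ennreal (gauss_density (\<Phi> v) * (1 / (1 + \<eta> v) ^ DIM('a))) * G (q_tilde grad T h x v) = k (\<Phi> v) * ennreal (1 / (1 + \<eta> v) ^ DIM('a))"
      unfolding k_def flow ennreal_mult[OF n(1,3)] by (simp only: mult_ac)
    finally show ?thesis .
  qed
  have "(\<integral>\<^sup>+v. G (q_tilde grad T h x v) * ennreal (exp (- cost h (norm (x - y)) (norm y) (norm v))) \<partial>std_gauss)
    = (\<integral>\<^sup>+v. ennreal (gauss_density v) * (G (q_tilde grad T h x v) * ennreal (exp (- cost h (norm (x - y)) (norm y) (norm v)))) \<partial>lborel)"
    by (intro nn_integral_std_gauss) (simp add: cost_def slope_bound_def Let_def)
  also have "\<dots> \<le> (\<integral>\<^sup>+v. k (\<Phi> v) * ennreal (1 / (1 + \<eta> v) ^ DIM('a)) \<partial>lborel)"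
    by (intro nn_integral_mono le)
  also have "\<dots> \<le> (\<integral>\<^sup>+w. k w \<partial>lborel)"
    by (rule nn_integral_change_of_variables_le[OF \<Phi>c \<eta>c \<eta>0 glob loc k])
  also have "\<dots> = (\<integral>\<^sup>+w. G (ham_flow grad T y w) \<partial>std_gauss)"
    unfolding k_def by (rule nn_integral_std_gauss[symmetric]) simp
  finally show ?thesis .
qed

end

section \<open>Stationarity of the target\<close>

lemma nn_integral_lborel_translate:
  fixes g :: "'a::euclidean_space \<Rightarrow> ennreal"
  assumes [measurable]: "g \<in> borel_measurable borel"
  shows "(\<integral>\<^sup>+x. g (c + x) \<partial>lborel) = (\<integral>\<^sup>+x. g x \<partial>lborel)"
  by (subst (2) lborel_distr_plus[symmetric, of c]) (simp add: nn_integral_distr)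

text \<open>A shear is a translation on each fibre, so Fubini reduces the claim to translation
  invariance.\<close>

lemma nn_integral_kick:
  fixes g :: "'a::euclidean_space \<times> 'a \<Rightarrow> ennreal"
  assumes [measurable]: "g \<in> borel_measurable (borel \<Otimes>\<^sub>M borel)" "A \<in> borel_measurable borel"
  shows "(\<integral>\<^sup>+z. g (fst z, A (fst z) + snd z) \<partial>(lborel \<Otimes>\<^sub>M lborel)) = (\<integral>\<^sup>+z. g z \<partial>(lborel \<Otimes>\<^sub>M lborel))"
proof -
  have "(\<integral>\<^sup>+z. g (fst z, A (fst z) + snd z) \<partial>(lborel \<Otimes>\<^sub>M lborel)) = (\<integral>\<^sup>+x. \<integral>\<^sup>+v. g (x, A x + v) \<partial>lborel \<partial>lborel)"
    by (subst lborel.nn_integral_fst[symmetric]) auto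
  also have "\<dots> = (\<integral>\<^sup>+x. \<integral>\<^sup>+v. g (x, v) \<partial>lborel \<partial>lborel)"
    by (intro nn_integral_cong nn_integral_lborel_translate) simp
  also have "\<dots> = (\<integral>\<^sup>+z. g z \<partial>(lborel \<Otimes>\<^sub>M lborel))"
    by (rule lborel.nn_integral_fst) simp
  finally show ?thesis .
qed

lemma nn_integral_drift:
  fixes g :: "'a::euclidean_space \<times> 'a \<Rightarrow> ennreal"
  assumes [measurable]: "g \<in> borel_measurable (borel \<Otimes>\<^sub>M borel)" "A \<in> borel_measurable borel"
  shows "(\<integral>\<^sup>+z. g (A (snd z) + fst z, snd z) \<partial>(lborel \<Otimes>\<^sub>M lborel)) = (\<integral>\<^sup>+z. g z \<partial>(lborel \<Otimes>\<^sub>M lborel))"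
proof -
  have "(\<integral>\<^sup>+z. g (A (snd z) + fst z, snd z) \<partial>(lborel \<Otimes>\<^sub>M lborel)) = (\<integral>\<^sup>+v. \<integral>\<^sup>+x. g (A v + x, v) \<partial>lborel \<partial>lborel)"
    by (subst lborel_pair.nn_integral_snd[symmetric]) (auto simp: split_beta)
  also have "\<dots> = (\<integral>\<^sup>+v. \<integral>\<^sup>+x. g (x, v) \<partial>lborel \<partial>lborel)"
    by (intro nn_integral_cong nn_integral_lborel_translate) simp
  also have "\<dots> = (\<integral>\<^sup>+z. g z \<partial>(lborel \<Otimes>\<^sub>M lborel))"
    by (subst lborel_pair.nn_integral_snd) auto
  finally show ?thesis .
qed

context force_field
begin

lemma grad_measurable [measurable]: "grad \<in> borel_measurable borel"
  by (rule borel_measurable_continuous_onI[OF grad_continuous])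

text \<open>A leapfrog step is a composition of two kicks and a drift, which are shears.\<close>

lemma nn_integral_leap_step:
  assumes [measurable]: "g \<in> borel_measurable (borel \<Otimes>\<^sub>M borel)"
  shows "(\<integral>\<^sup>+z. g (leap_step grad h z) \<partial>(lborel \<Otimes>\<^sub>M lborel)) = (\<integral>\<^sup>+z. g z \<partial>(lborel \<Otimes>\<^sub>M lborel))"
proof -
  define A where "A x = - (h / 2) *\<^sub>R grad x" for x
  have [measurable]: "A \<in> borel_measurable borel" unfolding A_def by measurable
  define g1 where "g1 z = g (fst z, A (fst z) + snd z)" for z
  have g1[measurable]: "g1 \<in> borel_measurable (borel \<Otimes>\<^sub>M borel)" unfolding g1_def by measurable
  define g2 where "g2 z = g1 (h *\<^sub>R snd z + fst z, snd z)" for z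
  have g2[measurable]: "g2 \<in> borel_measurable (borel \<Otimes>\<^sub>M borel)" unfolding g2_def by measurable
  have "g (leap_step grad h z) = g2 (fst z, A (fst z) + snd z)" for z
    by (cases z) (simp add: g2_def g1_def A_def leap_step_def Let_def algebra_simps power2_eq_square)
  then have "(\<integral>\<^sup>+z. g (leap_step grad h z) \<partial>(lborel \<Otimes>\<^sub>M lborel)) = (\<integral>\<^sup>+z. g2 z \<partial>(lborel \<Otimes>\<^sub>M lborel))"
    using nn_integral_kick[of g2 A] by simp
  also have "\<dots> = (\<integral>\<^sup>+z. g1 z \<partial>(lborel \<Otimes>\<^sub>M lborel))"
    unfolding g2_def by (rule nn_integral_drift) auto
  also have "\<dots> = (\<integral>\<^sup>+z. g z \<partial>(lborel \<Otimes>\<^sub>M lborel))"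
    unfolding g1_def by (rule nn_integral_kick) auto
  finally show ?thesis .
qed

lemma leap_iterate_measurable [measurable]:
  "leap_step grad h ^^ n \<in> borel \<Otimes>\<^sub>M borel \<rightarrow>\<^sub>M borel \<Otimes>\<^sub>M borel"
  unfolding borel_prod by (rule borel_measurable_continuous_onI[OF leap_iterate_continuous])

lemma nn_integral_leap_iterate:
  assumes g: "g \<in> borel_measurable (borel \<Otimes>\<^sub>M borel)"
  shows "(\<integral>\<^sup>+z. g ((leap_step grad h ^^ n) z) \<partial>(lborel \<Otimes>\<^sub>M lborel)) = (\<integral>\<^sup>+z. g z \<partial>(lborel \<Otimes>\<^sub>M lborel))"
proof (induction n)
  case (Suc n)
  have "(\<lambda>z. g ((leap_step grad h ^^ n) z)) \<in> borel_measurable (borel \<Otimes>\<^sub>M borel)"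
    using g by measurable
  from nn_integral_leap_step[OF this, of h] Suc show ?case by (simp add: funpow_Suc_right del: funpow.simps)
qed simp

end

section \<open>The invariant measure: energy conservation and Fatou's lemma\<close>

locale potential = force_field grad L M T
  for grad :: "'a::euclidean_space \<Rightarrow> 'a" and L M T :: real +
  fixes f :: "'a \<Rightarrow> real"
  assumes f_grad: "\<And>x. (f has_derivative (\<lambda>w. grad x \<bullet> w)) (at x)"
    and f_integrable: "integrable lborel (\<lambda>x. exp (- f x))"
begin

lemma f_continuous: "continuous_on S f"
  by (intro continuous_at_imp_continuous_on ballI has_derivative_continuous[OF f_grad])

lemma f_measurable [measurable]: "f \<in> borel_measurable borel"
  by (rule borel_measurable_continuous_onI[OF f_continuous])

definition Z :: real where "Z = (\<integral>y. exp (- f y) \<partial>lborel)"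

lemma Z_pos: "0 < Z"
proof -
  have "Z \<noteq> 0"
  proof
    assume "Z = 0"
    then have "AE x in lborel. exp (- f x) = 0"
      unfolding Z_def using integral_nonneg_eq_0_iff_AE[OF f_integrable] by simp
    then have "AE x in (lborel :: 'a measure). False" by simp
    then show False by (simp add: AE_iff_measurable[OF _ refl] emeasure_lborel_UNIV)
  qed
  moreover have "0 \<le> Z" unfolding Z_def by (intro integral_nonneg_AE) auto
  ultimately show ?thesis by simp
qed

lemma target_eq: "target f = density lborel (\<lambda>x. ennreal (exp (- f x) / Z))"
  by (simp add: target_def Z_def)

lemma sets_target [measurable_cong, simp]: "sets (target f) = sets borel"
  by (simp add: target_def)

lemma space_target [simp]: "space (target f) = UNIV"
  by (simp add: target_def)

lemma nn_integral_target:
  assumes [measurable]: "g \<in> borel_measurable borel"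
  shows "(\<integral>\<^sup>+y. g y \<partial>target f) = (\<integral>\<^sup>+y. ennreal (exp (- f y) / Z) * g y \<partial>lborel)"
  unfolding target_eq by (rule nn_integral_density) auto

lemma prob_space_target: "prob_space (target f)"
proof (rule prob_spaceI)
  have "emeasure (target f) (space (target f)) = (\<integral>\<^sup>+x. ennreal (1 / Z) * ennreal (exp (- f x)) \<partial>lborel)"
    unfolding target_eq using Z_pos by (auto simp: emeasure_density simp flip: ennreal_mult intro!: nn_integral_cong)
  also have "\<dots> = ennreal (1 / Z) * ennreal Z"
    by (subst nn_integral_cmult) (auto simp: nn_integral_eq_integral[OF f_integrable] Z_def)
  also have "\<dots> = 1" using Z_pos by (simp flip: ennreal_mult)
  finally show "emeasure (target f) (space (target f)) = 1" .
qed

lemma energy_conserved: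
  assumes "trajectory grad X V"
  shows "f (X t) + (norm (V t))^2 / 2 = f (X 0) + (norm (V 0))^2 / 2"
proof -
  have "((\<lambda>t. f (X t) + (V t \<bullet> V t) / 2) has_real_derivative 0) (at t)" for t
  proof -
    have X: "(X has_derivative (\<lambda>s. s *\<^sub>R V t)) (at t)" and V: "(V has_derivative (\<lambda>s. s *\<^sub>R - grad (X t))) (at t)"
      using assms by (auto simp: trajectory_def has_vector_derivative_def)
    have "((\<lambda>t. f (X t)) has_derivative (\<lambda>s. grad (X t) \<bullet> (s *\<^sub>R V t))) (at t)"
      by (rule has_derivative_compose[OF X f_grad])
    then have "((\<lambda>t. f (X t) + (V t \<bullet> V t) / 2) has_derivative
        (\<lambda>s. grad (X t) \<bullet> (s *\<^sub>R V t) + (V t \<bullet> (s *\<^sub>R - grad (X t)) + (s *\<^sub>R - grad (X t)) \<bullet> V t) / 2)) (at t)"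
      by (intro derivative_intros V) (auto intro!: derivative_eq_intros V)
    then show ?thesis
      by (simp add: has_field_derivative_def inner_commute algebra_simps lambda_zero)
  qed
  from DERIV_isconst_all[of "\<lambda>t. f (X t) + (V t \<bullet> V t) / 2", of t 0] this
  show ?thesis by (simp add: power2_norm_eq_inner)
qed

text \<open>Leapfrog iterates preserve Lebesgue measure but not the energy; the flow conserves the
  energy, and the pointwise limit lends it the first property. Openness of \<open>U\<close> makes
  its indicator lower semicontinuous, so Fatou's lemma goes in the right direction.\<close>

lemma stationary_open:
  assumes U: "open U"
  shows "(\<integral>\<^sup>+y. \<integral>\<^sup>+w. indicator U (ham_flow grad T y w) * ennreal (exp (- f y) * gauss_density w) \<partial>lborel \<partial>lborel)
    \<le> (\<integral>\<^sup>+y. indicator U y * ennreal (exp (- f y)) \<partial>lborel)"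
proof -
  have [measurable]: "U \<in> sets borel" using U by simp
  define k where "k z = indicator U (fst z) * ennreal (exp (- f (fst z)) * gauss_density (snd z))" for z :: "'a \<times> 'a"
  have k[measurable]: "k \<in> borel_measurable (borel \<Otimes>\<^sub>M borel)" unfolding k_def by measurable
  define \<phi> where "\<phi> N = leap_step grad (T / real (Suc N)) ^^ Suc N" for N
  have \<phi>[measurable]: "\<phi> N \<in> borel \<Otimes>\<^sub>M borel \<rightarrow>\<^sub>M borel \<Otimes>\<^sub>M borel" for N unfolding \<phi>_def by (rule leap_iterate_measurable)
  have ham[measurable]: "(\<lambda>z. ham_flow grad T (fst z) (snd z)) \<in> borel_measurable (borel \<Otimes>\<^sub>M borel)"
    using q_tilde_measurable[of 0] by (simp add: q_tilde_def split_beta)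
  have pt: "indicator U (ham_flow grad T y w) * ennreal (exp (- f y) * gauss_density w)
      \<le> liminf (\<lambda>N. k (\<phi> N (y, w)))" for y w
  proof (cases "ham_flow grad T y w \<in> U")
    case True
    obtain X V where X: "trajectory grad X V" "X 0 = y" "V 0 = w" by (rule trajectory_exists)
    have XT: "X T \<in> U" using True ham_flow_eq[OF X(1)] X by simp
    have x: "(\<lambda>N. fst (\<phi> N (y, w))) \<longlonglongrightarrow> X T" and v: "(\<lambda>N. snd (\<phi> N (y, w))) \<longlonglongrightarrow> V T"
      using leap_tendsto[OF X(1)] unfolding X(2,3) leap_pos_def leap_vel_def \<phi>_def by auto
    \<comment> \<open>Conservation of energy: the joint density at the endpoint of the exact path
      equals the one at its start.\<close>
    have en: "exp (- f (X T)) * gauss_density (V T) = exp (- f y) * gauss_density w"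
      using energy_conserved[OF X(1), of T] X(2,3)
      by (simp add: gauss_density_def power2_eq_square algebra_simps flip: exp_add)
    have fx: "(\<lambda>N. f (fst (\<phi> N (y, w)))) \<longlonglongrightarrow> f (X T)"
      by (rule isCont_tendsto_compose[OF has_derivative_continuous[OF f_grad] x])
    have gv: "(\<lambda>N. gauss_density (snd (\<phi> N (y, w)))) \<longlonglongrightarrow> gauss_density (V T)"
      unfolding gauss_density_def by (intro tendsto_intros v) simp
    have lim: "(\<lambda>N. ennreal (exp (- f (fst (\<phi> N (y, w)))) * gauss_density (snd (\<phi> N (y, w)))))
      \<longlonglongrightarrow> ennreal (exp (- f y) * gauss_density w)"
      unfolding en[symmetric] by (intro tendsto_ennrealI tendsto_mult tendsto_exp tendsto_minus fx gv)
    have "\<forall>\<^sub>F N in sequentially. fst (\<phi> N (y, w)) \<in> U"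
      using x U XT by (rule topological_tendstoD)
    then have ev: "\<forall>\<^sub>F N in sequentially. ennreal (exp (- f (fst (\<phi> N (y, w)))) * gauss_density (snd (\<phi> N (y, w)))) = k (\<phi> N (y, w))"
      by eventually_elim (simp add: k_def)
    have "(\<lambda>N. k (\<phi> N (y, w))) \<longlonglongrightarrow> ennreal (exp (- f y) * gauss_density w)"
      by (rule Lim_transform_eventually[OF lim ev])
    then have "liminf (\<lambda>N. k (\<phi> N (y, w))) = ennreal (exp (- f y) * gauss_density w)"
      by (rule lim_imp_Liminf[OF sequentially_bot])
    then show ?thesis using True by simp
  qed simp
  have "(\<integral>\<^sup>+y. \<integral>\<^sup>+w. indicator U (ham_flow grad T y w) * ennreal (exp (- f y) * gauss_density w) \<partial>lborel \<partial>lborel)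
    \<le> (\<integral>\<^sup>+y. \<integral>\<^sup>+w. liminf (\<lambda>N. k (\<phi> N (y, w))) \<partial>lborel \<partial>lborel)"
    by (intro nn_integral_mono pt)
  also have "\<dots> = (\<integral>\<^sup>+z. liminf (\<lambda>N. k (\<phi> N z)) \<partial>(lborel \<Otimes>\<^sub>M lborel))"
    by (rule lborel.nn_integral_fst) measurable
  also have "\<dots> \<le> liminf (\<lambda>N. \<integral>\<^sup>+z. k (\<phi> N z) \<partial>(lborel \<Otimes>\<^sub>M lborel))"
    by (rule nn_integral_liminf) measurable
  also have "\<dots> = (\<integral>\<^sup>+z. k z \<partial>(lborel \<Otimes>\<^sub>M lborel))"
    unfolding \<phi>_def nn_integral_leap_iterate[OF k] by (simp add: Liminf_const)
  also have "\<dots> = (\<integral>\<^sup>+y. \<integral>\<^sup>+w. k (y, w) \<partial>lborel \<partial>lborel)"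
    by (rule lborel.nn_integral_fst[symmetric]) simp
  also have "\<dots> = (\<integral>\<^sup>+y. indicator U y * ennreal (exp (- f y)) \<partial>lborel)"
  proof (rule nn_integral_cong)
    fix y
    have "(\<integral>\<^sup>+w. k (y, w) \<partial>lborel) = (\<integral>\<^sup>+w. (indicator U y * ennreal (exp (- f y))) * ennreal (gauss_density w) \<partial>(lborel :: 'a measure))"
      by (intro nn_integral_cong) (simp add: k_def ennreal_mult'' less_imp_le[OF gauss_density_pos] mult.assoc)
    also have "\<dots> = (indicator U y * ennreal (exp (- f y))) * (\<integral>\<^sup>+w. ennreal (gauss_density w) \<partial>(lborel :: 'a measure))"
      by (rule nn_integral_cmult) simp
    also have "(\<integral>\<^sup>+w. ennreal (gauss_density w) \<partial>(lborel :: 'a measure)) = 1"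
      using prob_space.emeasure_space_1[OF prob_space_std_gauss[where 'a='a]] unfolding std_gauss_eq
      by (simp add: emeasure_density)
    finally show "(\<integral>\<^sup>+w. k (y, w) \<partial>lborel) = indicator U y * ennreal (exp (- f y))" by simp
  qed
  finally show ?thesis .
qed

text \<open>Outer regularity of \<open>target f\<close> extends the inequality from open to Borel
  sets. The image measure \<kappa> then lies below \<open>target f\<close>, and integrals follow by
  monotonicity in the measure.\<close>

lemma stationary_le:
  assumes G [measurable]: "G \<in> borel_measurable borel"
  shows "(\<integral>\<^sup>+y. \<integral>\<^sup>+w. G (ham_flow grad T y w) \<partial>std_gauss \<partial>target f) \<le> (\<integral>\<^sup>+y. G y \<partial>target f)"
proof -
  have ham[measurable]: "(\<lambda>z. ham_flow grad T (fst z) (snd z)) \<in> borel_measurable (borel \<Otimes>\<^sub>M borel)"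
    using q_tilde_measurable[of 0] by (simp add: q_tilde_def split_beta)
  interpret \<nu>: prob_space "target f" by (rule prob_space_target)
  interpret \<gamma>: prob_space "std_gauss :: 'a measure" by (rule prob_space_std_gauss)
  define \<kappa> where "\<kappa> = distr (target f \<Otimes>\<^sub>M std_gauss) borel (\<lambda>z. ham_flow grad T (fst z) (snd z))"
  have \<kappa>: "(\<integral>\<^sup>+z. g z \<partial>\<kappa>) = (\<integral>\<^sup>+y. \<integral>\<^sup>+w. g (ham_flow grad T y w) \<partial>std_gauss \<partial>target f)"
    if [measurable]: "g \<in> borel_measurable borel" for g
    unfolding \<kappa>_def by (subst nn_integral_distr, simp, simp, subst \<gamma>.nn_integral_fst[symmetric]) auto
  have open_le: "emeasure \<kappa> U \<le> emeasure (target f) U" if U: "open U" for U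
  proof -
    have [measurable]: "U \<in> sets borel" using U by simp
    have "emeasure \<kappa> U = (\<integral>\<^sup>+z. indicator U z \<partial>\<kappa>)" by (simp add: \<kappa>_def)
    also have "\<dots> = (\<integral>\<^sup>+y. \<integral>\<^sup>+w. indicator U (ham_flow grad T y w) \<partial>std_gauss \<partial>target f)" by (rule \<kappa>) simp
    also have "\<dots> = (\<integral>\<^sup>+y. ennreal (1 / Z) * (\<integral>\<^sup>+w. indicator U (ham_flow grad T y w) * ennreal (exp (- f y) * gauss_density w) \<partial>lborel) \<partial>lborel)"
    proof (subst nn_integral_target)
      show "(\<integral>\<^sup>+y. ennreal (exp (- f y) / Z) * (\<integral>\<^sup>+w. indicator U (ham_flow grad T y w) \<partial>std_gauss) \<partial>lborel) =
        (\<integral>\<^sup>+y. ennreal (1 / Z) * (\<integral>\<^sup>+w. indicator U (ham_flow grad T y w) * ennreal (exp (- f y) * gauss_density w) \<partial>lborel) \<partial>lborel)"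
      proof (rule nn_integral_cong)
        fix y
        have [measurable]: "ham_flow grad T y \<in> borel_measurable borel"
          by (rule borel_measurable_continuous_onI[OF ham_flow_continuous])
        have [measurable]: "(\<lambda>w. indicator U (ham_flow grad T y w) :: ennreal) \<in> borel_measurable borel"
          by measurable
        have "(\<integral>\<^sup>+w. indicator U (ham_flow grad T y w) \<partial>std_gauss)
          = (\<integral>\<^sup>+w. ennreal (gauss_density w) * indicator U (ham_flow grad T y w) \<partial>lborel)"
          by (rule nn_integral_std_gauss) simp
        then have "ennreal (exp (- f y) / Z) * (\<integral>\<^sup>+w. indicator U (ham_flow grad T y w) \<partial>std_gauss)
          = (\<integral>\<^sup>+w. ennreal (exp (- f y) / Z) * (ennreal (gauss_density w) * indicator U (ham_flow grad T y w)) \<partial>lborel)"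
          by (subst nn_integral_cmult) auto
        also have "\<dots> = (\<integral>\<^sup>+w. ennreal (1 / Z) * (indicator U (ham_flow grad T y w) * ennreal (exp (- f y) * gauss_density w)) \<partial>lborel)"
          using Z_pos by (intro nn_integral_cong)
            (auto simp: indicator_def less_imp_le[OF gauss_density_pos] simp flip: ennreal_mult)
        also have "\<dots> = ennreal (1 / Z) * (\<integral>\<^sup>+w. indicator U (ham_flow grad T y w) * ennreal (exp (- f y) * gauss_density w) \<partial>lborel)"
          by (rule nn_integral_cmult) simp
        finally show "ennreal (exp (- f y) / Z) * (\<integral>\<^sup>+w. indicator U (ham_flow grad T y w) \<partial>std_gauss)
          = ennreal (1 / Z) * (\<integral>\<^sup>+w. indicator U (ham_flow grad T y w) * ennreal (exp (- f y) * gauss_density w) \<partial>lborel)" .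
      qed
    qed measurable
    also have "\<dots> = ennreal (1 / Z) * (\<integral>\<^sup>+y. (\<integral>\<^sup>+w. indicator U (ham_flow grad T y w) * ennreal (exp (- f y) * gauss_density w) \<partial>lborel) \<partial>lborel)"
      by (rule nn_integral_cmult) measurable
    also have "\<dots> \<le> ennreal (1 / Z) * (\<integral>\<^sup>+y. indicator U y * ennreal (exp (- f y)) \<partial>lborel)"
      by (intro mult_left_mono stationary_open U) simp
    also have "\<dots> = (\<integral>\<^sup>+y. ennreal (1 / Z) * (indicator U y * ennreal (exp (- f y))) \<partial>lborel)"
      by (rule nn_integral_cmult[symmetric]) simp
    also have "\<dots> = emeasure (target f) U"
      unfolding target_eq using Z_pos
      by (subst emeasure_density) (auto intro!: nn_integral_cong simp: indicator_def simp flip: ennreal_mult)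
    finally show ?thesis .
  qed
  have "emeasure \<kappa> B \<le> emeasure (target f) B" if B: "B \<in> sets borel" for B
  proof -
    have "emeasure (target f) B = (INF U\<in>{U. B \<subseteq> U \<and> open U}. emeasure (target f) U)"
      by (rule outer_regular) (use B in \<open>auto simp: \<nu>.emeasure_space_1\<close>)
    also have "\<dots> \<ge> emeasure \<kappa> B"
    proof (rule INF_greatest)
      fix U assume "U \<in> {U. B \<subseteq> U \<and> open U}"
      then show "emeasure \<kappa> B \<le> emeasure (target f) U"
        using open_le[of U] emeasure_mono[of B U \<kappa>] by (auto simp: \<kappa>_def)
    qed
    finally show ?thesis .
  qed
  then have "\<kappa> \<le> target f" by (intro le_measure[THEN iffD2]) (auto simp: \<kappa>_def)
  then have "(\<integral>\<^sup>+y. G y \<partial>\<kappa>) \<le> (\<integral>\<^sup>+y. G y \<partial>target f)"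
    by (intro nn_integral_mono_measure) (auto simp: \<kappa>_def)
  then show ?thesis using \<kappa>[OF G] by simp
qed

end

section \<open>Sub-Gaussian couplings\<close>

text \<open>Jensen's inequality from the tangent at the mean \<open>m\<close>.\<close>

lemma exp_convex_3:
  fixes a b c u v w :: real
  assumes "0 \<le> a" "0 \<le> b" "0 \<le> c" "a + b + c = 1"
  shows "exp (a * u + b * v + c * w) \<le> a * exp u + b * exp v + c * exp w"
proof -
  define m where "m = a * u + b * v + c * w"
  have t: "exp m * (1 + (x - m)) \<le> exp x" for x
    using mult_left_mono[OF exp_ge_add_one_self[of "x - m"], of "exp m"] by (simp flip: exp_add)
  have "exp m = exp m * ((a + b + c) + (a * u + b * v + c * w - (a + b + c) * m))"
    using assms(4) by (simp add: m_def)
  also have "\<dots> = a * (exp m * (1 + (u - m))) + b * (exp m * (1 + (v - m))) + c * (exp m * (1 + (w - m)))"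
    by (simp add: algebra_simps)
  also have "\<dots> \<le> a * exp u + b * exp v + c * exp w"
    using assms by (intro add_mono mult_left_mono t) auto
  finally show ?thesis by (simp add: m_def)
qed

lemma square_convex_3:
  fixes a b c u v w :: real
  assumes "0 \<le> a" "0 \<le> b" "0 \<le> c" "a + b + c = 1"
  shows "(a * u + b * v + c * w)^2 \<le> a * u^2 + b * v^2 + c * w^2"
proof -
  define m where "m = a * u + b * v + c * w"
  have t: "m * (2 * x - m) \<le> x^2" for x
    using zero_le_power2[of "x - m"] by (simp add: power2_eq_square algebra_simps)
  have "m^2 = m * (2 * (a * u + b * v + c * w) - (a + b + c) * m)"
    using assms(4) by (simp add: m_def power2_eq_square)
  also have "\<dots> = a * (m * (2 * u - m)) + b * (m * (2 * v - m)) + c * (m * (2 * w - m))"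
    by (simp add: algebra_simps)
  also have "\<dots> \<le> a * u^2 + b * v^2 + c * w^2"
    using assms by (intro add_mono mult_left_mono t) auto
  finally show ?thesis by (simp add: m_def)
qed

text \<open>Admissibility of a radius in the infimum behind \<open>psi_norm\<close>. Arguing with
  admissible radii leaves open whether the infimum is attained.\<close>

definition psi_bounded :: "'b measure \<Rightarrow> ('b \<Rightarrow> 'a::real_normed_vector) \<Rightarrow> real \<Rightarrow> bool" where
  "psi_bounded P g c \<longleftrightarrow> 0 < c \<and> (\<integral>\<^sup>+x. ennreal (exp ((norm (g x))^2 / c^2)) \<partial>P) \<le> 2"

lemma psi_norm_lessD:
  assumes "psi_norm P g < ennreal c"
  shows "psi_bounded P g c"
proof -
  obtain r where r: "0 < r" "(\<integral>\<^sup>+x. ennreal (exp ((norm (g x))^2 / r^2)) \<partial>P) \<le> 2" "ennreal r < ennreal c"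
    using assms unfolding psi_norm_def by (auto simp: Inf_less_iff)
  then have rc: "r < c" by (auto simp: ennreal_less_iff)
  have "(\<integral>\<^sup>+x. ennreal (exp ((norm (g x))^2 / c^2)) \<partial>P) \<le> (\<integral>\<^sup>+x. ennreal (exp ((norm (g x))^2 / r^2)) \<partial>P)"
    using rc r(1) by (intro nn_integral_mono ennreal_leI) (auto intro!: divide_left_mono power_mono)
  then show ?thesis using r rc by (auto simp: psi_bounded_def)
qed

lemma countable_cells:
  fixes \<delta> :: real
  assumes "0 < \<delta>"
  obtains cell :: "'a::euclidean_space \<Rightarrow> nat"
  where "cell \<in> borel \<rightarrow>\<^sub>M count_space UNIV" "\<And>x y. cell x = cell y \<Longrightarrow> dist x y \<le> \<delta>"
proof -
  obtain D :: "'a set" where D: "countable D" "\<And>X. open X \<Longrightarrow> X \<noteq> {} \<Longrightarrow> \<exists>d\<in>D. d \<in> X"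
    by (rule countable_dense_setE) blast
  define e where "e = from_nat_into D"
  have ex: "\<exists>n. dist x (e n) < \<delta> / 2" for x
  proof -
    obtain d where "d \<in> D" "d \<in> ball x (\<delta> / 2)" using D(2)[of "ball x (\<delta> / 2)"] assms by auto
    then show ?thesis using from_nat_into_surj[OF D(1)] unfolding e_def by (metis mem_ball)
  qed
  define cell where "cell x = (LEAST n. dist x (e n) < \<delta> / 2)" for x
  have c: "dist x (e (cell x)) < \<delta> / 2" for x unfolding cell_def by (rule LeastI_ex[OF ex])
  show ?thesis
  proof (rule that)
    show "cell \<in> borel \<rightarrow>\<^sub>M count_space UNIV" unfolding cell_def by measurable
    show "dist x y \<le> \<delta>" if "cell x = cell y" for x y
      using c[of x] c[of y] dist_triangle2[of x y "e (cell x)"] that by simp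
  qed
qed

text \<open>Gluing two couplings along their common marginal needs no disintegration if an error
  \<open>\<delta>\<close> is allowed: it suffices to couple the two middle coordinates independently within cells
  of a countable partition.\<close>

lemma approximate_gluing:
  fixes P P' :: "('a::euclidean_space \<times> 'a) measure"
  assumes P: "P \<in> couplings \<mu> \<nu>" and P': "P' \<in> couplings \<nu> \<pi>" and \<delta>: "0 < \<delta>"
  obtains R :: "(('a \<times> 'a) \<times> ('a \<times> 'a)) measure"
  where "sets R = sets borel"
    "\<And>g. g \<in> borel_measurable borel \<Longrightarrow> (\<integral>\<^sup>+\<omega>. g (fst \<omega>) \<partial>R) = (\<integral>\<^sup>+z. g z \<partial>P)"
    "\<And>g. g \<in> borel_measurable borel \<Longrightarrow> (\<integral>\<^sup>+\<omega>. g (snd \<omega>) \<partial>R) = (\<integral>\<^sup>+z. g z \<partial>P')"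
    "AE \<omega> in R. dist (snd (fst \<omega>)) (fst (snd \<omega>)) \<le> \<delta>"
proof -
  interpret P: prob_space P using P by (simp add: couplings_def)
  interpret P': prob_space P' using P' by (simp add: couplings_def)
  interpret PP: pair_prob_space P P' ..
  have sP[measurable_cong, simp]: "sets P = sets borel" "sets P' = sets borel"
    using P P' by (auto simp: couplings_def)
  have spP[simp]: "space P = UNIV" "space P' = UNIV" using sP[THEN sets_eq_imp_space_eq] by auto
  have \<nu>: "distr P borel snd = \<nu>" "distr P' borel fst = \<nu>" using P P' by (auto simp: couplings_def)
  have sn: "snd \<in> borel_measurable (borel :: ('a \<times> 'a) measure)" "fst \<in> borel_measurable (borel :: ('a \<times> 'a) measure)"
    unfolding borel_prod[symmetric] by auto
  interpret \<nu>: prob_space \<nu> unfolding \<nu>(1)[symmetric] by (rule P.prob_space_distr) (use sn in simp)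
  have s\<nu>[measurable_cong, simp]: "sets \<nu> = sets borel" unfolding \<nu>(1)[symmetric] by simp
  obtain cell :: "'a \<Rightarrow> nat" where cell[measurable]: "cell \<in> borel \<rightarrow>\<^sub>M count_space UNIV"
    and cell_dist: "\<And>x y. cell x = cell y \<Longrightarrow> dist x y \<le> \<delta>" using countable_cells[OF \<delta>, where 'a='a] by metis
  define p where "p n = measure \<nu> {y. cell y = n}" for n
  have mc[measurable]: "{y. cell y = n} \<in> sets borel" for n by measurable
  have ind[measurable]: "(\<lambda>y. indicator {n} (cell y) :: ennreal) \<in> borel_measurable borel" for n
    by (rule measurable_compose[OF cell]) simp
  have p: "(\<integral>\<^sup>+z. indicator {n} (cell (snd z)) \<partial>P) = ennreal (p n)" "(\<integral>\<^sup>+z. indicator {n} (cell (fst z)) \<partial>P') = ennreal (p n)" for n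
  proof -
    have "(\<integral>\<^sup>+z. indicator {n} (cell (snd z)) \<partial>P) = (\<integral>\<^sup>+y. indicator {n} (cell y) \<partial>\<nu>)"
      unfolding \<nu>(1)[symmetric] by (subst nn_integral_distr) (use sn ind in auto)
    moreover have "(\<integral>\<^sup>+z. indicator {n} (cell (fst z)) \<partial>P') = (\<integral>\<^sup>+y. indicator {n} (cell y) \<partial>\<nu>)"
      unfolding \<nu>(2)[symmetric] by (subst nn_integral_distr) (use sn ind in auto)
    moreover have "(\<integral>\<^sup>+y. indicator {n} (cell y) \<partial>\<nu>) = (\<integral>\<^sup>+y. indicator {y. cell y = n} y \<partial>\<nu>)"
      by (intro nn_integral_cong) (auto simp: indicator_def)
    moreover have "\<dots> = ennreal (p n)" by (simp add: p_def \<nu>.emeasure_eq_measure)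
    ultimately show "(\<integral>\<^sup>+z. indicator {n} (cell (snd z)) \<partial>P) = ennreal (p n)" "(\<integral>\<^sup>+z. indicator {n} (cell (fst z)) \<partial>P') = ennreal (p n)"
      by simp_all
  qed
  \<comment> \<open>Cells of mass zero, for which \<open>1 / p\<close> has the default value 0, are
    avoided almost surely by both middle coordinates.\<close>
  have pAE: "AE y in \<nu>. p (cell y) \<noteq> 0"
  proof -
    have "AE y in \<nu>. \<not> (cell y = n \<and> p n = 0)" for n
    proof (cases "p n = 0")
      case True
      then have "{y. cell y = n} \<in> null_sets \<nu>" by (auto simp: p_def \<nu>.emeasure_eq_measure null_sets_def)
      from AE_not_in[OF this] show ?thesis by eventually_elim auto
    qed simp
    then have "AE y in \<nu>. \<forall>n. \<not> (cell y = n \<and> p n = 0)" by (rule AE_all_countable[THEN iffD2, OF allI])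
    then show ?thesis by eventually_elim auto
  qed
  have pAE1: "AE z in P. p (cell (snd z)) \<noteq> 0"
    using pAE unfolding \<nu>(1)[symmetric] by (subst (asm) AE_distr_iff) (use sn in \<open>auto simp: pred_def\<close>)
  have pAE2: "AE z in P'. p (cell (fst z)) \<noteq> 0"
    using pAE unfolding \<nu>(2)[symmetric] by (subst (asm) AE_distr_iff) (use sn in \<open>auto simp: pred_def\<close>)
  note sn[measurable]
  \<comment> \<open>Density relative to the product measure. Each middle coordinate hits cell
    \<open>n\<close> with probability \<open>p n\<close>, so the weight \<open>1 / p n\<close> on
    matching cells restores both marginals.\<close>
  define \<rho> where "\<rho> \<omega> = ennreal (1 / p (cell (snd (fst \<omega>)))) * indicator {cell (snd (fst \<omega>))} (cell (fst (snd \<omega>)))"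
    for \<omega> :: "('a \<times> 'a) \<times> ('a \<times> 'a)"
  have \<rho>[measurable]: "\<rho> \<in> borel_measurable (P \<Otimes>\<^sub>M P')"
  proof -
    have "(\<lambda>z. cell (snd z)) \<in> P \<rightarrow>\<^sub>M count_space UNIV" "(\<lambda>z. cell (fst z)) \<in> P' \<rightarrow>\<^sub>M count_space UNIV"
      using measurable_compose[OF sn(1) cell] measurable_compose[OF sn(2) cell]
      by (simp_all cong: measurable_cong_sets)
    then have c1: "(\<lambda>\<omega>. cell (snd (fst \<omega>))) \<in> P \<Otimes>\<^sub>M P' \<rightarrow>\<^sub>M count_space UNIV"
      and c2: "(\<lambda>\<omega>. cell (fst (snd \<omega>))) \<in> P \<Otimes>\<^sub>M P' \<rightarrow>\<^sub>M count_space UNIV"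
      by (auto intro: measurable_compose[OF measurable_fst] measurable_compose[OF measurable_snd])
    have "{\<omega> \<in> space (P \<Otimes>\<^sub>M P'). cell (snd (fst \<omega>)) = cell (fst (snd \<omega>))}
      = (\<Union>n. ((\<lambda>\<omega>. cell (snd (fst \<omega>))) -` {n} \<inter> space (P \<Otimes>\<^sub>M P')) \<inter> ((\<lambda>\<omega>. cell (fst (snd \<omega>))) -` {n} \<inter> space (P \<Otimes>\<^sub>M P')))"
      by auto
    also have "\<dots> \<in> sets (P \<Otimes>\<^sub>M P')"
      by (intro sets.countable_UN'' sets.Int measurable_sets[OF c1] measurable_sets[OF c2]) simp_all
    finally have E: "{\<omega> \<in> space (P \<Otimes>\<^sub>M P'). cell (snd (fst \<omega>)) = cell (fst (snd \<omega>))} \<in> sets (P \<Otimes>\<^sub>M P')" .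
    have "\<rho> \<omega> = (if cell (snd (fst \<omega>)) = cell (fst (snd \<omega>)) then ennreal (1 / p (cell (snd (fst \<omega>)))) else 0)" for \<omega>
      by (auto simp: \<rho>_def indicator_def)
    moreover have "(\<lambda>\<omega>. if cell (snd (fst \<omega>)) = cell (fst (snd \<omega>)) then ennreal (1 / p (cell (snd (fst \<omega>)))) else 0) \<in> borel_measurable (P \<Otimes>\<^sub>M P')"
      by (intro measurable_If E measurable_compose[OF c1]) auto
    ultimately show ?thesis by (simp cong: measurable_cong)
  qed
  have \<rho>': "\<rho> \<omega> = ennreal (1 / p (cell (fst (snd \<omega>)))) * indicator {cell (fst (snd \<omega>))} (cell (snd (fst \<omega>)))" for \<omega>
    by (auto simp: \<rho>_def indicator_def)
  define R where "R = density (P \<Otimes>\<^sub>M P') \<rho>"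
  have sPP: "sets (P \<Otimes>\<^sub>M P') = sets borel"
    using sets_pair_measure_cong[OF sP] by (simp only: borel_prod)
  have inv: "ennreal (1 / p n) * ennreal (p n) = 1" if "p n \<noteq> 0" for n
    using that by (simp add: p_def flip: ennreal_mult)
  show ?thesis
  proof (rule that[of R])
    show "sets R = sets borel" unfolding R_def sets_density by (rule sPP)
    show "AE \<omega> in R. dist (snd (fst \<omega>)) (fst (snd \<omega>)) \<le> \<delta>"
      unfolding R_def by (subst AE_density) (auto simp: \<rho>_def indicator_def intro!: AE_I2 cell_dist)
    fix g :: "'a \<times> 'a \<Rightarrow> ennreal" assume g[measurable]: "g \<in> borel_measurable borel"
    have "(\<integral>\<^sup>+\<omega>. g (fst \<omega>) \<partial>R) = (\<integral>\<^sup>+\<omega>. \<rho> \<omega> * g (fst \<omega>) \<partial>(P \<Otimes>\<^sub>M P'))"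
      unfolding R_def by (rule nn_integral_density) auto
    also have "\<dots> = (\<integral>\<^sup>+z. \<integral>\<^sup>+z'. \<rho> (z, z') * g z \<partial>P' \<partial>P)"
      by (subst P'.nn_integral_fst[symmetric]) auto
    also have "\<dots> = (\<integral>\<^sup>+z. g z \<partial>P)"
    proof (rule nn_integral_cong_AE, use pAE1 in eventually_elim)
      fix z :: "'a \<times> 'a" assume z: "p (cell (snd z)) \<noteq> 0"
      have "(\<integral>\<^sup>+z'. \<rho> (z, z') * g z \<partial>P') = (\<integral>\<^sup>+z'. (g z * ennreal (1 / p (cell (snd z)))) * indicator {cell (snd z)} (cell (fst z')) \<partial>P')"
        by (intro nn_integral_cong) (simp add: \<rho>_def mult_ac)
      also have "\<dots> = (g z * ennreal (1 / p (cell (snd z)))) * ennreal (p (cell (snd z)))"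
        by (subst nn_integral_cmult) (auto simp: p)
      also have "\<dots> = g z" using inv[OF z] by (simp add: mult.assoc)
      finally show "(\<integral>\<^sup>+z'. \<rho> (z, z') * g z \<partial>P') = g z" .
    qed
    finally show "(\<integral>\<^sup>+\<omega>. g (fst \<omega>) \<partial>R) = (\<integral>\<^sup>+z. g z \<partial>P)" .
    have "(\<integral>\<^sup>+\<omega>. g (snd \<omega>) \<partial>R) = (\<integral>\<^sup>+\<omega>. \<rho> \<omega> * g (snd \<omega>) \<partial>(P \<Otimes>\<^sub>M P'))"
      unfolding R_def by (rule nn_integral_density) auto
    also have "\<dots> = (\<integral>\<^sup>+z'. \<integral>\<^sup>+z. \<rho> (z, z') * g z' \<partial>P \<partial>P')"
      by (subst PP.nn_integral_snd[symmetric]) (auto simp: split_beta)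
    also have "\<dots> = (\<integral>\<^sup>+z. g z \<partial>P')"
    proof (rule nn_integral_cong_AE, use pAE2 in eventually_elim)
      fix z' :: "'a \<times> 'a" assume z: "p (cell (fst z')) \<noteq> 0"
      have "(\<integral>\<^sup>+z. \<rho> (z, z') * g z' \<partial>P) = (\<integral>\<^sup>+z. (g z' * ennreal (1 / p (cell (fst z')))) * indicator {cell (fst z')} (cell (snd z)) \<partial>P)"
        by (intro nn_integral_cong) (simp add: \<rho>' mult_ac)
      also have "\<dots> = (g z' * ennreal (1 / p (cell (fst z')))) * ennreal (p (cell (fst z')))"
        by (subst nn_integral_cmult) (auto simp: p)
      also have "\<dots> = g z'" using inv[OF z] by (simp add: mult.assoc)
      finally show "(\<integral>\<^sup>+z. \<rho> (z, z') * g z' \<partial>P) = g z'" .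
    qed
    finally show "(\<integral>\<^sup>+\<omega>. g (snd \<omega>) \<partial>R) = (\<integral>\<^sup>+z. g z \<partial>P')" .
  qed
qed

text \<open>The triangle inequality of \<open>W_psi\<close> for admissible radii. The gap left by
  the gluing acts as a third summand of radius \<open>e\<close>; convexity of the square and of the
  exponential with weights \<open>a / w\<close>, \<open>b / w\<close>, \<open>e / w\<close> keeps
  the moment at most 2.\<close>

lemma couplings_triangle:
  fixes P P' :: "('a::euclidean_space \<times> 'a) measure"
  assumes P: "P \<in> couplings \<mu> \<nu>" "psi_bounded P (\<lambda>(x, y). x - y) a"
    and P': "P' \<in> couplings \<nu> \<pi>" "psi_bounded P' (\<lambda>(x, y). x - y) b" and e: "0 < e"
  obtains R where "R \<in> couplings \<mu> \<pi>" "psi_bounded R (\<lambda>(x, y). x - y) (a + b + e)"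
proof -
  \<comment> \<open>Chosen so that \<open>exp (\<delta>^2 / e^2) = 2\<close>: a deterministic gap of
    size \<delta> has exactly the moment allowed for radius \<open>e\<close>.\<close>
  define \<delta> where "\<delta> = e * sqrt (ln 2)"
  have \<delta>: "0 < \<delta>" "\<delta>^2 / e^2 = ln 2" using e by (auto simp: \<delta>_def power_mult_distrib)
  have a: "0 < a" "(\<integral>\<^sup>+z. ennreal (exp ((norm (fst z - snd z))^2 / a^2)) \<partial>P) \<le> 2"
    and b: "0 < b" "(\<integral>\<^sup>+z. ennreal (exp ((norm (fst z - snd z))^2 / b^2)) \<partial>P') \<le> 2"
    using P P' by (auto simp: psi_bounded_def split_beta)
  obtain Q :: "(('a \<times> 'a) \<times> ('a \<times> 'a)) measure" where sQ[measurable_cong]: "sets Q = sets borel"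
    and Q1: "\<And>g. g \<in> borel_measurable borel \<Longrightarrow> (\<integral>\<^sup>+\<omega>. g (fst \<omega>) \<partial>Q) = (\<integral>\<^sup>+z. g z \<partial>P)"
    and Q2: "\<And>g. g \<in> borel_measurable borel \<Longrightarrow> (\<integral>\<^sup>+\<omega>. g (snd \<omega>) \<partial>Q) = (\<integral>\<^sup>+z. g z \<partial>P')"
    and QAE: "AE \<omega> in Q. dist (snd (fst \<omega>)) (fst (snd \<omega>)) \<le> \<delta>"
    using approximate_gluing[OF P(1) P'(1) \<delta>(1)] by blast
  interpret P: prob_space P using P by (simp add: couplings_def)
  have sP[measurable_cong]: "sets P = sets borel" "sets P' = sets borel" using P P' by (auto simp: couplings_def)
  have Q: "prob_space Q"
    using Q1[of "\<lambda>_. 1"] P.emeasure_space_1 by (intro prob_spaceI) simp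
  have [measurable]: "fst \<in> borel \<rightarrow>\<^sub>M (borel :: ('a \<times> 'a) measure)" "snd \<in> borel \<rightarrow>\<^sub>M (borel :: ('a \<times> 'a) measure)"
    "fst \<in> borel_measurable (borel :: ('a \<times> 'a) measure)" "snd \<in> borel_measurable (borel :: ('a \<times> 'a) measure)"
    by (auto intro!: borel_measurable_continuous_onI continuous_intros)
  define F where "F \<omega> = (fst (fst \<omega>), snd (snd \<omega>))" for \<omega> :: "('a \<times> 'a) \<times> ('a \<times> 'a)"
  have F[measurable]: "F \<in> Q \<rightarrow>\<^sub>M borel"
  proof -
    have "F \<in> borel \<rightarrow>\<^sub>M borel" unfolding F_def by (intro borel_measurable_continuous_onI continuous_intros)
    then show ?thesis by simp
  qed
  define R where "R = distr Q borel F"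
  define w where "w = a + b + e"
  have w: "0 < w" using a b e by (simp add: w_def)
  show ?thesis
  proof (rule that[of R])
    have m1: "distr R borel fst = \<mu>"
    proof -
      have "\<mu> = distr P borel fst" using P by (simp add: couplings_def)
      also have "\<dots> = distr R borel fst"
      proof (rule measure_eqI)
        fix A assume "A \<in> sets (distr P borel fst)"
        then have A[measurable]: "A \<in> sets borel" by simp
        have "emeasure (distr P borel fst) A = (\<integral>\<^sup>+y. indicator A y \<partial>distr P borel fst)" by simp
        also have "\<dots> = (\<integral>\<^sup>+z. indicator A (fst z) \<partial>P)"
          by (rule nn_integral_distr) auto
        also have "\<dots> = (\<integral>\<^sup>+\<omega>. indicator A (fst (fst \<omega>)) \<partial>Q)"
          by (rule Q1[symmetric]) simp
        also have "\<dots> = (\<integral>\<^sup>+z. indicator A (fst z) \<partial>R)" unfolding R_def by (subst nn_integral_distr) (auto simp: F_def)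
        also have "\<dots> = (\<integral>\<^sup>+z. indicator A z \<partial>distr R borel fst)" by (rule nn_integral_distr[symmetric]) (auto simp: R_def)
        finally show "emeasure (distr P borel fst) A = emeasure (distr R borel fst) A" by simp
      qed simp
      finally show ?thesis by simp
    qed
    have m2: "distr R borel snd = \<pi>"
    proof -
      have "\<pi> = distr P' borel snd" using P' by (simp add: couplings_def)
      also have "\<dots> = distr R borel snd"
      proof (rule measure_eqI)
        fix A assume "A \<in> sets (distr P' borel snd)"
        then have A[measurable]: "A \<in> sets borel" by simp
        have "emeasure (distr P' borel snd) A = (\<integral>\<^sup>+y. indicator A y \<partial>distr P' borel snd)" by simp
        also have "\<dots> = (\<integral>\<^sup>+z. indicator A (snd z) \<partial>P')"
          by (rule nn_integral_distr) auto
        also have "\<dots> = (\<integral>\<^sup>+\<omega>. indicator A (snd (snd \<omega>)) \<partial>Q)"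
          by (rule Q2[symmetric]) simp
        also have "\<dots> = (\<integral>\<^sup>+z. indicator A (snd z) \<partial>R)" unfolding R_def by (subst nn_integral_distr) (auto simp: F_def)
        also have "\<dots> = (\<integral>\<^sup>+z. indicator A z \<partial>distr R borel snd)" by (rule nn_integral_distr[symmetric]) (auto simp: R_def)
        finally show "emeasure (distr P' borel snd) A = emeasure (distr R borel snd) A" by simp
      qed simp
      finally show ?thesis by simp
    qed
    have "prob_space R" unfolding R_def by (rule prob_space.prob_space_distr[OF Q F])
    then show "R \<in> couplings \<mu> \<pi>" using m1 m2 by (simp add: couplings_def R_def)
    define u where "u \<omega> = norm (fst (fst \<omega>) - snd (fst \<omega>))" for \<omega> :: "('a \<times> 'a) \<times> ('a \<times> 'a)"
    define v where "v \<omega> = norm (fst (snd \<omega>) - snd (snd \<omega>))" for \<omega> :: "('a \<times> 'a) \<times> ('a \<times> 'a)"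
    have [measurable]: "u \<in> borel_measurable borel" "v \<in> borel_measurable borel"
      unfolding u_def v_def by (auto intro!: borel_measurable_continuous_onI continuous_intros)
    have "(\<integral>\<^sup>+z. ennreal (exp ((norm (fst z - snd z))^2 / w^2)) \<partial>R) = (\<integral>\<^sup>+\<omega>. ennreal (exp ((norm (fst (fst \<omega>) - snd (snd \<omega>)))^2 / w^2)) \<partial>Q)"
      unfolding R_def by (subst nn_integral_distr) (auto simp: F_def)
    also have "\<dots> \<le> (\<integral>\<^sup>+\<omega>. ennreal (a / w) * ennreal (exp (u \<omega> ^ 2 / a^2)) + ennreal (b / w) * ennreal (exp (v \<omega> ^ 2 / b^2)) + ennreal (e / w) * 2 \<partial>Q)"
    proof (rule nn_integral_mono_AE, use QAE in eventually_elim)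
      fix \<omega> :: "('a \<times> 'a) \<times> ('a \<times> 'a)" assume d: "dist (snd (fst \<omega>)) (fst (snd \<omega>)) \<le> \<delta>"
      have "norm (fst (fst \<omega>) - snd (snd \<omega>)) \<le> u \<omega> + \<delta> + v \<omega>"
        using d norm_triangle_ineq[of "fst (fst \<omega>) - snd (fst \<omega>)" "snd (fst \<omega>) - snd (snd \<omega>)"]
          norm_triangle_ineq[of "snd (fst \<omega>) - fst (snd \<omega>)" "fst (snd \<omega>) - snd (snd \<omega>)"]
        by (simp add: u_def v_def dist_norm)
      then have "norm (fst (fst \<omega>) - snd (snd \<omega>)) / w \<le> a / w * (u \<omega> / a) + b / w * (v \<omega> / b) + e / w * (\<delta> / e)"
        using a b e w by (simp add: field_simps)
      then have "(norm (fst (fst \<omega>) - snd (snd \<omega>)) / w)^2 \<le> (a / w * (u \<omega> / a) + b / w * (v \<omega> / b) + e / w * (\<delta> / e))^2"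
        using w by (intro power_mono) auto
      also have "\<dots> \<le> a / w * (u \<omega> / a)^2 + b / w * (v \<omega> / b)^2 + e / w * (\<delta> / e)^2"
        using a b e w by (intro square_convex_3) (auto simp: w_def add_divide_distrib[symmetric])
      finally have "exp ((norm (fst (fst \<omega>) - snd (snd \<omega>)))^2 / w^2) \<le> exp (a / w * (u \<omega>^2 / a^2) + b / w * (v \<omega>^2 / b^2) + e / w * ln 2)"
        using \<delta>(2) by (simp add: power_divide)
      also have "\<dots> \<le> a / w * exp (u \<omega>^2 / a^2) + b / w * exp (v \<omega>^2 / b^2) + e / w * exp (ln 2)"
        using a b e w by (intro exp_convex_3) (auto simp: w_def add_divide_distrib[symmetric])
      finally have "ennreal (exp ((norm (fst (fst \<omega>) - snd (snd \<omega>)))^2 / w^2)) \<le> ennreal (a / w * exp (u \<omega>^2 / a^2) + b / w * exp (v \<omega>^2 / b^2) + e / w * 2)"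
        by (intro ennreal_leI) simp
      also have "\<dots> = ennreal (a / w) * ennreal (exp (u \<omega> ^ 2 / a^2)) + ennreal (b / w) * ennreal (exp (v \<omega> ^ 2 / b^2)) + ennreal (e / w) * 2"
        using a b e w by (simp add: ennreal_plus ennreal_mult'' del: times_divide_eq_left times_divide_eq_right)
      finally show "ennreal (exp ((norm (fst (fst \<omega>) - snd (snd \<omega>)))^2 / w^2)) \<le> \<dots>" .
    qed
    also have "\<dots> = ennreal (a / w) * (\<integral>\<^sup>+\<omega>. ennreal (exp (u \<omega> ^ 2 / a^2)) \<partial>Q) + ennreal (b / w) * (\<integral>\<^sup>+\<omega>. ennreal (exp (v \<omega> ^ 2 / b^2)) \<partial>Q) + ennreal (e / w) * 2"
      using prob_space.emeasure_space_1[OF Q] by (simp add: nn_integral_add nn_integral_cmult)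
    also have "(\<integral>\<^sup>+\<omega>. ennreal (exp (u \<omega> ^ 2 / a^2)) \<partial>Q) = (\<integral>\<^sup>+z. ennreal (exp ((norm (fst z - snd z))^2 / a^2)) \<partial>P)"
      unfolding u_def by (rule Q1) simp
    also have "(\<integral>\<^sup>+\<omega>. ennreal (exp (v \<omega> ^ 2 / b^2)) \<partial>Q) = (\<integral>\<^sup>+z. ennreal (exp ((norm (fst z - snd z))^2 / b^2)) \<partial>P')"
      unfolding v_def by (rule Q2) simp
    also have "ennreal (a / w) * (\<integral>\<^sup>+z. ennreal (exp ((norm (fst z - snd z))^2 / a^2)) \<partial>P) + ennreal (b / w) * (\<integral>\<^sup>+z. ennreal (exp ((norm (fst z - snd z))^2 / b^2)) \<partial>P') + ennreal (e / w) * 2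
        \<le> ennreal (a / w) * 2 + ennreal (b / w) * 2 + ennreal (e / w) * 2"
      using a(2) b(2) by (intro add_mono mult_left_mono) auto
    also have "\<dots> = ennreal (a / w + b / w + e / w) * 2"
      using a b e w by (simp add: distrib_right)
    also have "a / w + b / w + e / w = 1" using w by (simp add: w_def add_divide_distrib[symmetric])
    finally show "psi_bounded R (\<lambda>(x, y). x - y) (a + b + e)"
      using w unfolding psi_bounded_def by (simp add: split_beta w_def)
  qed
qed

lemma W_psi_lessE:
  assumes "W_psi \<mu> \<pi> < ennreal c"
  obtains P where "P \<in> couplings \<mu> \<pi>" "psi_bounded P (\<lambda>(x, y). x - y) c"
  using assms psi_norm_lessD unfolding W_psi_def Inf_less_iff by blast

section \<open>From a Young inequality to a Renyi bound\<close>

text \<open>The test function \<open>g = (min \<rho> n) powr (q - 1)\<close> turns the Young-type inequality into the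
  bound \<open>\<integral> (min \<rho> n) powr q \<le> C\<close> for the truncated density.\<close>

lemma renyi_le_of_young:
  assumes \<mu>: "prob_space \<mu>" and \<pi>: "prob_space \<pi>" and sets: "sets \<mu> = sets \<pi>"
    and q: "1 < q" and C: "1 \<le> C"
    and young: "\<And>g. g \<in> borel_measurable \<pi> \<Longrightarrow> (\<And>x. 0 \<le> g x) \<Longrightarrow>
      (\<integral>\<^sup>+x. ennreal (g x) \<partial>\<mu>) \<le> ennreal (1 - 1 / q) * (\<integral>\<^sup>+x. ennreal (g x powr (q / (q - 1))) \<partial>\<pi>) + ennreal (C / q)"
  shows "renyi q \<mu> \<pi> \<le> ereal (ln C / (q - 1))"
proof -
  interpret \<mu>: prob_space \<mu> by fact
  interpret \<pi>: prob_space \<pi> by fact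
  note [measurable_cong] = sets
  have q0: "0 < q" using q by simp
  \<comment> \<open>Multiples of the indicator of a \<pi>-null set \<open>N\<close> as test
    functions give \<open>real n * measure \<mu> N \<le> C / q\<close> for every
    \<open>n\<close>.\<close>
  have ac: "absolutely_continuous \<pi> \<mu>"
    unfolding absolutely_continuous_def
  proof
    fix N assume N: "N \<in> null_sets \<pi>"
    then have [measurable]: "N \<in> sets \<pi>" by auto
    have b: "real n * measure \<mu> N \<le> C / q" for n :: nat
    proof -
      have "(\<integral>\<^sup>+x. ennreal (real n * indicator N x) \<partial>\<mu>) \<le> ennreal (1 - 1 / q) * (\<integral>\<^sup>+x. ennreal ((real n * indicator N x) powr (q / (q - 1))) \<partial>\<pi>) + ennreal (C / q)"
        by (rule young) auto
      moreover have "(\<integral>\<^sup>+x. ennreal ((real n * indicator N x) powr (q / (q - 1))) \<partial>\<pi>) = 0"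
      proof -
        have "AE x in \<pi>. ennreal ((real n * indicator N x) powr (q / (q - 1))) = 0"
          using AE_not_in[OF N] by eventually_elim simp
        then show ?thesis by (subst nn_integral_0_iff_AE) auto
      qed
      moreover have "(\<integral>\<^sup>+x. ennreal (real n * indicator N x) \<partial>\<mu>) = ennreal (real n * measure \<mu> N)"
      proof -
        have "(\<integral>\<^sup>+x. ennreal (real n * indicator N x) \<partial>\<mu>) = (\<integral>\<^sup>+x. ennreal (real n) * indicator N x \<partial>\<mu>)"
          by (intro nn_integral_cong) (auto simp: indicator_def)
        also have "\<dots> = ennreal (real n) * emeasure \<mu> N" by (rule nn_integral_cmult_indicator) (simp add: sets)
        finally show ?thesis by (simp add: \<mu>.emeasure_eq_measure ennreal_mult)
      qed
      ultimately show ?thesis using C q0 by simp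
    qed
    have "measure \<mu> N = 0"
    proof (rule ccontr)
      assume "measure \<mu> N \<noteq> 0"
      then have "0 < measure \<mu> N" by (simp add: zero_less_measure_iff)
      then obtain n :: nat where "C / q < real n * measure \<mu> N" using reals_Archimedean3 by blast
      then show False using b[of n] by simp
    qed
    then show "N \<in> null_sets \<mu>" by (auto simp: null_sets_def \<mu>.emeasure_eq_measure sets)
  qed
  define \<rho> where "\<rho> = RN_deriv \<pi> \<mu>"
  have \<rho>[measurable]: "\<rho> \<in> borel_measurable \<pi>" by (simp add: \<rho>_def)
  have dens: "density \<pi> \<rho> = \<mu>" unfolding \<rho>_def by (rule \<pi>.density_RN_deriv[OF ac sets])
  define r where "r x = enn2real (\<rho> x)" for x
  have r[measurable]: "r \<in> borel_measurable \<pi>" unfolding r_def by measurable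
  have r0: "0 \<le> r x" for x by (simp add: r_def)
  \<comment> \<open>\<open>enn2real\<close> sends an infinite value to 0, which only lowers the
    density.\<close>
  have r\<rho>: "ennreal (r x) \<le> \<rho> x" for x unfolding r_def by (cases "\<rho> x") auto
  define J where "J n = (\<integral>\<^sup>+x. ennreal (min (r x) (real n) powr q) \<partial>\<pi>)" for n :: nat
  have J: "J n \<le> ennreal C" for n
  proof -
    define g where "g x = min (r x) (real n) powr (q - 1)" for x
    have [measurable]: "g \<in> borel_measurable \<pi>" unfolding g_def by measurable
    have g0: "0 \<le> g x" for x by (simp add: g_def)
    have "J n \<le> (\<integral>\<^sup>+x. \<rho> x * ennreal (g x) \<partial>\<pi>)"
      unfolding J_def
    proof (rule nn_integral_mono)
      fix x
      have "min (r x) (real n) powr q = min (r x) (real n) * g x"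
        using powr_mult_base[of "min (r x) (real n)" "q - 1"] r0[of x] by (simp add: g_def)
      also have "\<dots> \<le> r x * g x" by (intro mult_right_mono g0) simp
      finally have "ennreal (min (r x) (real n) powr q) \<le> ennreal (r x) * ennreal (g x)"
        using r0[of x] g0[of x] by (simp add: ennreal_leI flip: ennreal_mult)
      also have "\<dots> \<le> \<rho> x * ennreal (g x)" by (intro mult_right_mono r\<rho>) simp
      finally show "ennreal (min (r x) (real n) powr q) \<le> \<rho> x * ennreal (g x)" .
    qed
    also have "\<dots> = (\<integral>\<^sup>+x. ennreal (g x) \<partial>\<mu>)"
      unfolding dens[symmetric] by (rule nn_integral_density[symmetric]) auto
    also have "\<dots> \<le> ennreal (1 - 1 / q) * (\<integral>\<^sup>+x. ennreal (g x powr (q / (q - 1))) \<partial>\<pi>) + ennreal (C / q)"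
      by (rule young) (auto simp: g0)
    also have "(\<integral>\<^sup>+x. ennreal (g x powr (q / (q - 1))) \<partial>\<pi>) = J n"
      using q by (simp add: J_def g_def powr_powr)
    finally have le: "J n \<le> ennreal (1 - 1 / q) * J n + ennreal (C / q)" .
    have "J n \<le> (\<integral>\<^sup>+x. ennreal (real n powr q) \<partial>\<pi>)"
      unfolding J_def using r0 q by (intro nn_integral_mono ennreal_leI powr_mono2) auto
    \<comment> \<open>Finiteness, owed to the truncation at \<open>n\<close>, permits subtracting
      \<open>(1 - 1 / q) * J n\<close> from both sides.\<close>
    then have "J n \<noteq> \<infinity>" by (auto simp: \<pi>.emeasure_space_1 top_unique)
    then obtain j where j: "J n = ennreal j" "0 \<le> j" by (cases "J n") auto
    have "j \<le> (1 - 1 / q) * j + C / q"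
      using le q C j by (simp add: j flip: ennreal_mult ennreal_plus)
    then have "j / q \<le> C / q" by (simp add: algebra_simps)
    then show ?thesis using j q by (simp add: divide_le_cancel ennreal_leI)
  qed
  define I where "I = (\<integral>\<^sup>+x. ennreal (r x powr q) \<partial>\<pi>)"
  have "I \<le> (\<integral>\<^sup>+x. liminf (\<lambda>n. ennreal (min (r x) (real n) powr q)) \<partial>\<pi>)"
    unfolding I_def
  proof (rule nn_integral_mono)
    fix x
    obtain m :: nat where m: "r x \<le> real m" using real_arch_simple by blast
    have "\<forall>\<^sub>F n in sequentially. ennreal (r x powr q) \<le> ennreal (min (r x) (real n) powr q)"
      using eventually_ge_at_top[of m] by eventually_elim (use m in \<open>auto simp: min_def\<close>)
    then show "ennreal (r x powr q) \<le> liminf (\<lambda>n. ennreal (min (r x) (real n) powr q))"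
      by (rule Liminf_bounded)
  qed
  also have "\<dots> \<le> liminf J"
    unfolding J_def[abs_def] by (rule nn_integral_liminf) measurable
  also have "\<dots> \<le> ennreal C"
    using J by (intro order_trans[OF Liminf_mono[of J "\<lambda>_. ennreal C"]]) (auto simp: Liminf_const)
  finally have IC: "I \<le> ennreal C" .
  then obtain i where i: "I = ennreal i" "0 \<le> i" by (cases I) (auto simp: top_unique)
  have iC: "i \<le> C" using IC i C by simp
  \<comment> \<open>For \<open>i = 0\<close> the logarithm takes its default value 0, which is at
    most \<open>ln C\<close> because \<open>C \<ge> 1\<close>.\<close>
  have "ln i \<le> ln C" using iC i C by (cases "i = 0") (auto simp: ln_le_cancel_iff)
  then have "ln i / (q - 1) \<le> ln C / (q - 1)" using q by (simp add: divide_right_mono)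
  then show ?thesis
    using ac i unfolding renyi_def \<rho>_def[symmetric] r_def[symmetric] I_def[symmetric] by (simp add: Let_def)
qed

text \<open>The bound is the value of the integrand when the norms are the constants
  \<open>w * sqrt (ln 2)\<close> and \<open>k * sqrt (ln 2)\<close>, for which the moments in
  \<open>psi_bounded\<close> equal 2. Expanding around these values leaves an exponent of total
  weight \<open>g1 + g2 \<le> 1\<close>, whose exponential has expectation at most 1 by convexity.
  The joint law of \<open>X\<close> and \<open>Y\<close> is arbitrary.\<close>

lemma exp_moment_of_psi_bounded:
  fixes X Y :: "'b \<Rightarrow> 'a::euclidean_space"
  assumes R: "prob_space R" and [measurable]: "X \<in> borel_measurable R" "Y \<in> borel_measurable R"
    and X: "psi_bounded R X w" and Y: "psi_bounded R Y k"
    and nn: "0 \<le> a1" "0 \<le> b1" "0 \<le> a2" "0 \<le> b2"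
    and small: "a1 * w / (2 * sqrt (ln 2)) + b1 * w^2 + (a2 * k / (2 * sqrt (ln 2)) + b2 * k^2) \<le> 1"
  shows "(\<integral>\<^sup>+z. ennreal (exp (a1 * norm (X z) + b1 * (norm (X z))^2 + (a2 * norm (Y z) + b2 * (norm (Y z))^2))) \<partial>R)
    \<le> ennreal (exp (sqrt (ln 2) * (a1 * w + a2 * k) + ln 2 * (b1 * w^2 + b2 * k^2)))"
proof -
  interpret prob_space R by fact
  have w: "0 < w" "(\<integral>\<^sup>+z. ennreal (exp ((norm (X z) / w)^2)) \<partial>R) \<le> 2"
    and k: "0 < k" "(\<integral>\<^sup>+z. ennreal (exp ((norm (Y z) / k)^2)) \<partial>R) \<le> 2"
    using X Y by (auto simp: psi_bounded_def power_divide)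
  define l where "l = sqrt (ln (2::real))"
  have l: "0 < l" "l^2 = ln 2" "l * l = ln 2" by (auto simp: l_def)
  define \<theta>1 \<theta>2 where "\<theta>1 = a1 * w / (2 * l)" and "\<theta>2 = a2 * k / (2 * l)"
  define g1 g2 where "g1 = \<theta>1 + b1 * w^2" and "g2 = \<theta>2 + b2 * k^2"
  have \<theta>0: "0 \<le> \<theta>1" "0 \<le> \<theta>2" using nn w k l by (auto simp: \<theta>1_def \<theta>2_def)
  have g0: "0 \<le> g1" "0 \<le> g2" using \<theta>0 nn by (auto simp: g1_def g2_def)
  have g1: "g1 + g2 \<le> 1" using small by (simp add: g1_def g2_def \<theta>1_def \<theta>2_def l_def)
  define c where "c = (\<theta>1 + \<theta>2) * ln 2 + (g1 + g2) * ln 2"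
  \<comment> \<open>Arithmetic-geometric mean inequality with equality at \<open>t = l\<close>; it
    converts linear terms into quadratic ones.\<close>
  have lin: "t * (2 * l) * \<theta> \<le> \<theta> * ln 2 + \<theta> * t^2" if "0 \<le> \<theta>" for t \<theta> :: real
  proof -
    have "0 \<le> \<theta> * (t - l)^2" using that by simp
    then show ?thesis using l by (simp add: power2_diff algebra_simps)
  qed
  have pt: "exp (a1 * norm (X z) + b1 * (norm (X z))^2 + (a2 * norm (Y z) + b2 * (norm (Y z))^2))
      \<le> exp c * (g1 / 2 * exp ((norm (X z) / w)^2) + g2 / 2 * exp ((norm (Y z) / k)^2) + (1 - (g1 + g2)))" for z
  proof -
    define t1 t2 where "t1 = norm (X z) / w" and "t2 = norm (Y z) / k"
    have e: "norm (X z) = t1 * w" "norm (Y z) = t2 * k" using w k by (auto simp: t1_def t2_def)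
    have "a1 * norm (X z) = t1 * (2 * l) * \<theta>1" "a2 * norm (Y z) = t2 * (2 * l) * \<theta>2"
      using l by (auto simp: e \<theta>1_def \<theta>2_def)
    then have "a1 * norm (X z) + b1 * (norm (X z))^2 + (a2 * norm (Y z) + b2 * (norm (Y z))^2)
      \<le> (\<theta>1 * ln 2 + \<theta>1 * t1^2) + b1 * (norm (X z))^2 + ((\<theta>2 * ln 2 + \<theta>2 * t2^2) + b2 * (norm (Y z))^2)"
      using lin[OF \<theta>0(1), of t1] lin[OF \<theta>0(2), of t2] by linarith
    \<comment> \<open>Centring the squares at \<open>ln 2\<close> normalises each moment bound from
      2 to 1.\<close>
    also have "\<dots> = c + (g1 * (t1^2 - ln 2) + g2 * (t2^2 - ln 2) + (1 - (g1 + g2)) * 0)"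
      by (simp add: e c_def g1_def g2_def power_mult_distrib algebra_simps)
    finally have "exp (a1 * norm (X z) + b1 * (norm (X z))^2 + (a2 * norm (Y z) + b2 * (norm (Y z))^2))
      \<le> exp c * exp (g1 * (t1^2 - ln 2) + g2 * (t2^2 - ln 2) + (1 - (g1 + g2)) * 0)"
      by (simp flip: exp_add)
    also have "\<dots> \<le> exp c * (g1 * exp (t1^2 - ln 2) + g2 * exp (t2^2 - ln 2) + (1 - (g1 + g2)) * exp 0)"
      using g0 g1 by (intro mult_left_mono exp_convex_3) auto
    also have "\<dots> = exp c * (g1 / 2 * exp (t1^2) + g2 / 2 * exp (t2^2) + (1 - (g1 + g2)))"
      by (simp add: exp_diff)
    finally show ?thesis by (simp add: t1_def t2_def)
  qed
  have "(\<integral>\<^sup>+z. ennreal (exp (a1 * norm (X z) + b1 * (norm (X z))^2 + (a2 * norm (Y z) + b2 * (norm (Y z))^2))) \<partial>R)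
    \<le> (\<integral>\<^sup>+z. ennreal (exp c) * (ennreal (g1 / 2) * ennreal (exp ((norm (X z) / w)^2)) + ennreal (g2 / 2) * ennreal (exp ((norm (Y z) / k)^2)) + ennreal (1 - (g1 + g2))) \<partial>R)"
  proof (rule nn_integral_mono)
    fix z
    have "ennreal (exp (a1 * norm (X z) + b1 * (norm (X z))^2 + (a2 * norm (Y z) + b2 * (norm (Y z))^2)))
      \<le> ennreal (exp c * (g1 / 2 * exp ((norm (X z) / w)^2) + g2 / 2 * exp ((norm (Y z) / k)^2) + (1 - (g1 + g2))))"
      by (intro ennreal_leI pt)
    also have "\<dots> = ennreal (exp c) * (ennreal (g1 / 2) * ennreal (exp ((norm (X z) / w)^2)) + ennreal (g2 / 2) * ennreal (exp ((norm (Y z) / k)^2)) + ennreal (1 - (g1 + g2)))"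
      using g0 g1 by (simp add: ennreal_mult'' ennreal_plus del: times_divide_eq_left)
    finally show "ennreal (exp (a1 * norm (X z) + b1 * (norm (X z))^2 + (a2 * norm (Y z) + b2 * (norm (Y z))^2))) \<le> \<dots>" .
  qed
  also have "\<dots> = ennreal (exp c) * (ennreal (g1 / 2) * (\<integral>\<^sup>+z. ennreal (exp ((norm (X z) / w)^2)) \<partial>R) + ennreal (g2 / 2) * (\<integral>\<^sup>+z. ennreal (exp ((norm (Y z) / k)^2)) \<partial>R) + ennreal (1 - (g1 + g2)))"
    by (simp add: nn_integral_cmult nn_integral_add emeasure_space_1)
  also have "\<dots> \<le> ennreal (exp c) * (ennreal (g1 / 2) * 2 + ennreal (g2 / 2) * 2 + ennreal (1 - (g1 + g2)))"
    using w k by (intro mult_left_mono add_mono) auto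
  also have "\<dots> = ennreal (exp c)"
  proof -
    have "ennreal (g1 / 2) * 2 = ennreal g1" "ennreal (g2 / 2) * 2 = ennreal g2"
      using g0 ennreal_mult[of "g1 / 2" 2] ennreal_mult[of "g2 / 2" 2] by auto
    then show ?thesis using g0 g1 by (simp flip: ennreal_plus)
  qed
  also have "c = sqrt (ln 2) * (a1 * w + a2 * k) + ln 2 * (b1 * w^2 + b2 * k^2)"
  proof -
    have "2 * \<theta>1 * ln 2 = l * (a1 * w)" "2 * \<theta>2 * ln 2 = l * (a2 * k)"
      using l(1) unfolding \<theta>1_def \<theta>2_def l(3)[symmetric] by auto
    then show ?thesis unfolding c_def g1_def g2_def l_def[symmetric] by (simp add: algebra_simps)
  qed
  finally show ?thesis .
qed

section \<open>Integrating the cost over the Gaussian velocity\<close>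

context force_field
begin

text \<open>As a function of \<open>R\<close> the cost is a quadratic polynomial, so the Gaussian
  estimate applies. The role of \<open>u\<close> is to keep the quadratic coefficient small:
  \<open>(1 + h * p_v T)^2 \<le> u^2 = 1 + 1 / (4 * s)\<close> gives \<open>2 * l \<le> 1/8\<close>,
  hence \<open>\<sigma> \<ge> 7/8\<close> and the factors 8/7 and 15/14.\<close>

lemma nn_integral_exp_cost_le:
  assumes h: "0 \<le> h" and r: "0 \<le> r" and y: "0 \<le> y" and \<beta>: "0 < \<beta>"
    and s: "s = 2 * \<beta> + 1" and u: "u^2 = 1 + 1 / (4 * s)" "0 < u" and hu: "1 + h * p_v T \<le> u"
    and d: "d = real DIM('a)" and L0: "0 \<le> L"
  shows "(\<integral>\<^sup>+v. ennreal (exp (\<beta> * cost h r y (norm v))) \<partial>(std_gauss :: 'a measure))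
    \<le> ennreal (exp (\<beta> * (8/7 * d * (h * p_v T + h^2 * (p_v T)^2 / 2) + 15/14 * sqrt d * (d * h * j_v M T)
        + 36/7 * \<beta> * (d * h * j_v M T)^2 + d * h * j_c T
        + (15/14 * u * sqrt d * p_xy T + d * j_xy M T) * r
        + h * (15/14 * u * sqrt d * p_x L + d * j_x M T) * y
        + (1/2 + 9/14 * \<beta> * u^2) * (5/4 * (p_xy T)^2 * r^2 + 5 * h^2 * (p_x L)^2 * y^2))))"
proof -
  have pv: "0 < p_v T" and pxy: "0 < p_xy T" and px: "0 \<le> p_x L" and jv: "0 \<le> j_v M T"
    using T_pos M_nonneg L0 by (auto simp: p_v_def p_xy_def p_x_def j_v_def)
  have d0: "1 \<le> d" using d DIM_positive[where 'a='a] by simp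
  define a where "a = p_xy T * r + h * (p_x L * y)"
  define e where "e = d * h * j_v M T"
  define c where "c = h * p_v T + h^2 * (p_v T)^2 / 2"
  define t where "t = \<beta> * (a * (1 + h * p_v T) + e)"
  define l where "l = \<beta> * c"
  define \<sigma> where "\<sigma> = 1 - 2 * l"
  define w where "w = \<beta> * (a^2 / 2 + d * (j_xy M T * r + h * j_c T + h * j_x M T * y))"
  have a0: "0 \<le> a" using pxy px r y h by (auto simp: a_def)
  have e0: "0 \<le> e" using d0 h jv by (auto simp: e_def)
  have c0: "0 \<le> c" using h pv by (auto simp: c_def)
  have "(1 + h * p_v T)^2 \<le> u^2" using hu h pv by (intro power_mono) auto
  then have "2 * c \<le> 1 / (4 * s)" unfolding u(1) c_def by (simp add: power2_eq_square algebra_simps)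
  then have "2 * l \<le> \<beta> * (1 / (4 * s))" using mult_left_mono[of "2 * c" "1 / (4 * s)" \<beta>] \<beta> by (simp add: l_def mult_ac)
  also have "\<dots> \<le> 1/8" using \<beta> by (simp add: s field_simps)
  finally have l2: "2 * l \<le> 1/8" .
  have l0: "0 \<le> l" "l < 1/2" using \<beta> c0 l2 by (auto simp: l_def)
  have \<sigma>: "7/8 \<le> \<sigma>" using l2 by (simp add: \<sigma>_def)
  have t0: "0 \<le> t" using \<beta> a0 e0 h pv by (auto simp: t_def)
  have split: "\<beta> * cost h r y R = (t * R + l * R^2) + w" for R
    unfolding cost_def Let_def slope_bound_def t_def l_def w_def a_def e_def c_def d
    by (simp add: power2_eq_square algebra_simps)
  have "(\<integral>\<^sup>+v. ennreal (exp (\<beta> * cost h r y (norm v))) \<partial>(std_gauss :: 'a measure))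
      = (\<integral>\<^sup>+v. ennreal (exp w) * ennreal (exp (t * norm v + l * (norm v)^2)) \<partial>(std_gauss :: 'a measure))"
    unfolding split by (simp add: exp_add ennreal_mult mult.commute)
  also have "\<dots> = ennreal (exp w) * (\<integral>\<^sup>+v. ennreal (exp (t * norm v + l * (norm v)^2)) \<partial>(std_gauss :: 'a measure))"
    by (rule nn_integral_cmult) simp
  also have "\<dots> \<le> ennreal (exp w) * ennreal (exp (d * l / \<sigma> + t * sqrt d / sqrt \<sigma> + t^2 / (2 * \<sigma>)))"
    by (intro mult_left_mono nn_integral_std_gauss_exp_le t0 l0 d \<sigma>_def) simp
  also have "\<dots> = ennreal (exp (w + (d * l / \<sigma> + t * sqrt d / sqrt \<sigma> + t^2 / (2 * \<sigma>))))"
    by (simp add: exp_add ennreal_mult)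
  also have "\<dots> \<le> ennreal (exp (\<beta> * (8/7 * d * c + 15/14 * sqrt d * e + 36/7 * \<beta> * e^2 + d * h * j_c T
        + (15/14 * u * sqrt d * p_xy T + d * j_xy M T) * r
        + h * (15/14 * u * sqrt d * p_x L + d * j_x M T) * y
        + (1/2 + 9/14 * \<beta> * u^2) * (5/4 * (p_xy T)^2 * r^2 + 5 * h^2 * (p_x L)^2 * y^2))))"
  proof (intro ennreal_leI iffD2[OF exp_le_cancel_iff])
    have i1: "1 / \<sigma> \<le> 8/7" using \<sigma> by (simp add: field_simps)
    have i2: "1 / sqrt \<sigma> \<le> 15/14"
    proof -
      have "(14/15)^2 \<le> \<sigma>" using \<sigma> by (simp add: power2_eq_square)
      then have "14/15 \<le> sqrt \<sigma>" by (rule real_le_rsqrt)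
      then show ?thesis using \<sigma> by (simp add: field_simps)
    qed
    have t_le: "t \<le> \<beta> * (u * a + e)" unfolding t_def using \<beta> a0 hu
      by (intro mult_left_mono add_right_mono) (auto simp: mult.commute[of u] intro!: mult_left_mono)
    have "d * l / \<sigma> = d * l * (1 / \<sigma>)" by simp
    also have "\<dots> \<le> d * l * (8/7)" using i1 d0 l0 by (intro mult_left_mono) auto
    finally have e1: "d * l / \<sigma> \<le> \<beta> * (8/7 * d * c)" by (simp add: l_def mult_ac)
    have "t * sqrt d / sqrt \<sigma> = t * sqrt d * (1 / sqrt \<sigma>)" by simp
    also have "\<dots> \<le> (\<beta> * (u * a + e)) * sqrt d * (15/14)"
      using t0 t_le i2 d0 \<sigma> by (intro mult_mono) auto
    finally have e2: "t * sqrt d / sqrt \<sigma> \<le> \<beta> * (15/14 * sqrt d * (u * a + e))" by (simp add: mult_ac)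
    have "t^2 / (2 * \<sigma>) = t^2 / 2 * (1 / \<sigma>)" by simp
    also have "\<dots> \<le> (\<beta> * (u * a + e))^2 / 2 * (8/7)"
      using i1 \<sigma> t0 t_le by (intro mult_mono divide_right_mono power_mono) auto
    also have "\<dots> = \<beta> * (4/7 * \<beta> * (u * a + e)^2)" by (simp add: power2_eq_square algebra_simps)
    also have "\<dots> \<le> \<beta> * (4/7 * \<beta> * (9/8 * u^2 * a^2 + 9 * e^2))"
    proof -
      \<comment> \<open>Unequal splitting: the larger factor 9 falls on \<open>e\<close>, which
        carries a factor \<open>h\<close>, while the coefficient of \<open>a^2\<close> grows only by
        9/8.\<close>
      have "0 \<le> (u * a - 8 * e)^2 / 8" by simp
      then have "(u * a + e)^2 \<le> 9/8 * u^2 * a^2 + 9 * e^2" by (simp add: power2_eq_square algebra_simps)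
      then show ?thesis using \<beta> by (intro mult_left_mono) auto
    qed
    finally have e3: "t^2 / (2 * \<sigma>) \<le> \<beta> * (9/14 * \<beta> * u^2 * a^2 + 36/7 * \<beta> * e^2)" by (simp add: algebra_simps)
    have a2: "a^2 \<le> 5/4 * (p_xy T)^2 * r^2 + 5 * h^2 * (p_x L)^2 * y^2"
    proof -
      have "0 \<le> (p_xy T * r / 2 - 2 * (h * (p_x L * y)))^2" by simp
      then show ?thesis by (simp add: a_def power2_eq_square algebra_simps)
    qed
    have om: "0 \<le> 1/2 + 9/14 * \<beta> * u^2" using \<beta> by simp
    have "w + (d * l / \<sigma> + t * sqrt d / sqrt \<sigma> + t^2 / (2 * \<sigma>))
      \<le> w + (\<beta> * (8/7 * d * c) + \<beta> * (15/14 * sqrt d * (u * a + e)) + \<beta> * (9/14 * \<beta> * u^2 * a^2 + 36/7 * \<beta> * e^2))"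
      by (intro add_left_mono add_mono e1 e2 e3)
    also have "\<dots> = \<beta> * (8/7 * d * c + 15/14 * sqrt d * e + 36/7 * \<beta> * e^2 + d * h * j_c T
        + (15/14 * u * sqrt d * p_xy T + d * j_xy M T) * r
        + h * (15/14 * u * sqrt d * p_x L + d * j_x M T) * y
        + (1/2 + 9/14 * \<beta> * u^2) * a^2)"
      by (simp add: w_def a_def algebra_simps)
    also have "\<dots> \<le> \<beta> * (8/7 * d * c + 15/14 * sqrt d * e + 36/7 * \<beta> * e^2 + d * h * j_c T
        + (15/14 * u * sqrt d * p_xy T + d * j_xy M T) * r
        + h * (15/14 * u * sqrt d * p_x L + d * j_x M T) * y
        + (1/2 + 9/14 * \<beta> * u^2) * (5/4 * (p_xy T)^2 * r^2 + 5 * h^2 * (p_x L)^2 * y^2))"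
      using \<beta> om a2 by (intro mult_left_mono add_left_mono) auto
    finally show "w + (d * l / \<sigma> + t * sqrt d / sqrt \<sigma> + t^2 / (2 * \<sigma>)) \<le> \<dots>" .
  qed
  finally show ?thesis unfolding c_def e_def .
qed

end

text \<open>Young's inequality with exponents \<open>q / (q - 1)\<close> and \<open>q\<close> for
  the factors \<open>g * exp (- (1 - 1 / q) * c)\<close> and
  \<open>exp ((1 - 1 / q) * c)\<close>.\<close>

lemma young_weight:
  fixes g c q :: real
  assumes q: "1 < q" and g: "0 \<le> g"
  shows "g \<le> (1 - 1 / q) * (g powr (q / (q - 1)) * exp (- c)) + 1 / q * exp ((q - 1) * c)"
proof (cases "g = 0")
  case True
  then show ?thesis using q by simp
next
  case False
  then have g0: "0 < g" using g by simp
  define a where "a = (q / (q - 1)) * ln g - c"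
  define b where "b = (q - 1) * c"
  have e: "(1 - 1 / q) * a + 1 / q * b = ln g"
  proof -
    have "(1 - 1 / q) * a + 1 / q * b = ((1 - 1 / q) * (q / (q - 1))) * ln g + (- (1 - 1 / q) + (q - 1) / q) * c"
      by (simp add: a_def b_def algebra_simps diff_divide_distrib)
    also have "(1 - 1 / q) * (q / (q - 1)) = 1" using q by (simp add: field_simps)
    also have "- (1 - 1 / q) + (q - 1) / q = 0" using q by (simp add: diff_divide_distrib)
    finally show ?thesis by simp
  qed
  have "g = exp ((1 - 1 / q) * a + 1 / q * b + 0 * 0)" using e g0 by simp
  also have "\<dots> \<le> (1 - 1 / q) * exp a + 1 / q * exp b + 0 * exp 0"
    using q by (intro exp_convex_3) (auto simp: field_simps)
  also have "exp a = g powr (q / (q - 1)) * exp (- c)"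
    using g0 by (simp add: a_def powr_def exp_diff exp_minus divide_inverse)
  finally show ?thesis by (simp add: b_def)
qed

section \<open>From the transport inequality to the divergence of a coupled pair\<close>

context potential
begin

text \<open>Young's inequality, unlike Hoelder's, is additive: it is integrated over the velocity
  for fixed \<open>x\<close> and \<open>y\<close>, then over the coupling. There \<open>F\<close>
  sees only the first marginal and \<open>G\<close> only the second, to which stationarity applies.
  The final division by \<open>q - 1\<close> cancels the factor \<beta> of the exponent.\<close>

lemma renyi_P_tilde_le:
  assumes h: "0 \<le> h" and N: "h > 0 \<Longrightarrow> \<exists>N::nat. T = real N * h"
    and q: "1 < q" and \<beta>: "\<beta> = q - 1" and s: "s = 2 * q - 1"
    and u: "u^2 = 1 + 1 / (4 * s)" "0 < u" and hu: "1 + h * p_v T \<le> u" and d: "d = real DIM('a)"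
    and A0: "A0 = 8/7 * d * (h * p_v T + h^2 * (p_v T)^2 / 2) + 15/14 * sqrt d * (d * h * j_v M T)
        + 36/7 * \<beta> * (d * h * j_v M T)^2 + d * h * j_c T"
    and \<alpha>1: "\<alpha>1 = 15/14 * u * sqrt d * p_xy T + d * j_xy M T"
    and \<alpha>2: "\<alpha>2 = h * (15/14 * u * sqrt d * p_x L + d * j_x M T)"
    and \<omega>: "\<omega> = 1/2 + 9/14 * \<beta> * u^2"
    and R: "R \<in> couplings \<mu> (target f)" and w: "psi_bounded R (\<lambda>(x, y). x - y) w"
    and k: "psi_bounded (target f) (\<lambda>x. x) k"
    and small: "\<beta> * \<alpha>1 * w / (2 * sqrt (ln 2)) + \<beta> * \<omega> * (5/4 * (p_xy T)^2) * w^2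
      + (\<beta> * \<alpha>2 * k / (2 * sqrt (ln 2)) + \<beta> * \<omega> * (5 * h^2 * (p_x L)^2) * k^2) \<le> 1"
  shows "renyi q (P_tilde grad T h \<mu>) (target f)
    \<le> ereal (A0 + sqrt (ln 2) * (\<alpha>1 * w + \<alpha>2 * k) + ln 2 * \<omega> * (5/4 * (p_xy T)^2 * w^2 + 5 * h^2 * (p_x L)^2 * k^2))"
    (is "_ \<le> ereal ?b")
proof -
  have \<beta>0: "0 < \<beta>" using q \<beta> by simp
  have s': "s = 2 * \<beta> + 1" by (simp add: s \<beta>)
  have nn: "0 \<le> p_v T" "0 \<le> p_xy T" "0 \<le> p_x L" "0 \<le> j_v M T" "0 \<le> j_xy M T" "0 \<le> j_x M T" "0 \<le> j_c T"
    using T_pos M_nonneg L_nonneg by (auto simp: p_v_def p_xy_def p_x_def j_v_def j_xy_def j_x_def j_c_def)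
  have d0: "0 \<le> d" by (simp add: d)
  have A00: "0 \<le> A0" using nn d0 h \<beta>0 by (auto simp: A0)
  have \<alpha>0: "0 \<le> \<alpha>1" "0 \<le> \<alpha>2" using nn d0 h u(2) by (auto simp: \<alpha>1 \<alpha>2)
  have \<omega>0: "0 \<le> \<omega>" using \<beta>0 by (simp add: \<omega>)
  have wk: "0 < w" "0 < k" using w k by (auto simp: psi_bounded_def)
  interpret R: prob_space R using R by (simp add: couplings_def)
  interpret \<gamma>: prob_space "std_gauss :: 'a measure" by (rule prob_space_std_gauss)
  interpret \<nu>: prob_space "target f" by (rule prob_space_target)
  have sR[measurable_cong]: "sets R = sets borel" using R by (simp add: couplings_def)
  have R1: "distr R borel fst = \<mu>" and R2: "distr R borel snd = target f" using R by (auto simp: couplings_def)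
  have fs: "fst \<in> borel_measurable (borel :: ('a \<times> 'a) measure)" "snd \<in> borel_measurable (borel :: ('a \<times> 'a) measure)"
    unfolding borel_prod[symmetric] by auto
  have [measurable]: "fst \<in> borel_measurable R" "snd \<in> borel_measurable R" using fs by simp_all
  have s\<mu>[measurable_cong]: "sets \<mu> = sets borel" unfolding R1[symmetric] by simp
  interpret \<mu>: prob_space \<mu> unfolding R1[symmetric] by (rule R.prob_space_distr) simp
  interpret \<mu>\<gamma>: pair_prob_space \<mu> "std_gauss :: 'a measure" ..
  have qm: "(\<lambda>(x, v). q_tilde grad T h x v) \<in> borel_measurable (\<mu> \<Otimes>\<^sub>M std_gauss)"
    using q_tilde_measurable[of h] by (simp cong: measurable_cong_sets add: s\<mu>)
  have ham[measurable]: "(\<lambda>z. ham_flow grad T (fst z) (snd z)) \<in> borel_measurable (borel \<Otimes>\<^sub>M borel)"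
    using q_tilde_measurable[of 0] by (simp add: q_tilde_def split_beta)
  define B where "B r y = A0 + \<alpha>1 * r + \<alpha>2 * y + \<omega> * (5/4 * (p_xy T)^2 * r^2 + 5 * h^2 * (p_x L)^2 * y^2)" for r y
  have exp_split: "ennreal (exp (a + b)) = ennreal (exp a) * ennreal (exp b)" for a b :: real
    by (simp add: exp_add ennreal_mult)
  have mom: "(\<integral>\<^sup>+z. ennreal (exp (\<beta> * B (norm (fst z - snd z)) (norm (snd z)))) \<partial>R) \<le> ennreal (exp (\<beta> * ?b))"
  proof -
    have kR: "psi_bounded R snd k"
    proof -
      have "(\<integral>\<^sup>+x. ennreal (exp ((norm x)^2 / k^2)) \<partial>distr R borel snd) = (\<integral>\<^sup>+z. ennreal (exp ((norm (snd z))^2 / k^2)) \<partial>R)"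
        by (rule nn_integral_distr) auto
      then show ?thesis using k unfolding psi_bounded_def R2 by simp
    qed
    have wR: "psi_bounded R (\<lambda>z. fst z - snd z) w" using w by (simp add: case_prod_unfold)
    let ?e = "\<lambda>z. (\<beta> * \<alpha>1) * norm (fst z - snd z) + (\<beta> * \<omega> * (5/4 * (p_xy T)^2)) * (norm (fst z - snd z))^2
        + ((\<beta> * \<alpha>2) * norm (snd z) + (\<beta> * \<omega> * (5 * h^2 * (p_x L)^2)) * (norm (snd z))^2)"
    let ?m = "sqrt (ln 2) * (\<beta> * \<alpha>1 * w + \<beta> * \<alpha>2 * k) + ln 2 * (\<beta> * \<omega> * (5/4 * (p_xy T)^2) * w^2 + \<beta> * \<omega> * (5 * h^2 * (p_x L)^2) * k^2)"
    have m: "(\<integral>\<^sup>+z. ennreal (exp (?e z)) \<partial>R)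
      \<le> ennreal (exp ?m)"
      by (rule exp_moment_of_psi_bounded[OF R.prob_space_axioms _ _ wR kR])
        (use \<alpha>0 \<omega>0 \<beta>0 small in auto)
    have "(\<integral>\<^sup>+z. ennreal (exp (\<beta> * B (norm (fst z - snd z)) (norm (snd z)))) \<partial>R)
      = (\<integral>\<^sup>+z. ennreal (exp (\<beta> * A0)) * ennreal (exp (?e z)) \<partial>R)"
    proof (rule nn_integral_cong)
      fix z :: "'a \<times> 'a"
      have "\<beta> * B (norm (fst z - snd z)) (norm (snd z)) = \<beta> * A0 + (?e z)"
        unfolding B_def by (simp add: algebra_simps)
      then show "ennreal (exp (\<beta> * B (norm (fst z - snd z)) (norm (snd z)))) = ennreal (exp (\<beta> * A0)) * ennreal (exp (?e z))"
        by (simp only: exp_split[of "\<beta> * A0"])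
    qed
    also have "\<dots> = ennreal (exp (\<beta> * A0)) * (\<integral>\<^sup>+z. ennreal (exp (?e z)) \<partial>R)"
      by (rule nn_integral_cmult) simp
    also have "\<dots> \<le> ennreal (exp (\<beta> * A0)) * ennreal (exp ?m)"
      by (intro mult_left_mono m) simp
    also have "\<dots> = ennreal (exp (\<beta> * ?b))"
    proof -
      have "\<beta> * ?b = \<beta> * A0 + ?m"
        by (simp add: algebra_simps)
      then show ?thesis by (simp only: exp_split[of "\<beta> * A0"])
    qed
    finally show ?thesis .
  qed
  have b0: "0 \<le> ?b" using A00 \<alpha>0 \<omega>0 wk by auto
  have "renyi q (P_tilde grad T h \<mu>) (target f) \<le> ereal (ln (exp (\<beta> * ?b)) / (q - 1))"
  proof (rule renyi_le_of_young[OF _ \<nu>.prob_space_axioms _ q])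
    show "prob_space (P_tilde grad T h \<mu>)"
      unfolding P_tilde_def by (rule \<mu>\<gamma>.prob_space_distr[OF qm])
    show "sets (P_tilde grad T h \<mu>) = sets (target f)" by (simp add: P_tilde_def)
    show "1 \<le> exp (\<beta> * ?b)" using \<beta>0 b0 by simp
    fix g :: "'a \<Rightarrow> real" assume "g \<in> borel_measurable (target f)" and g0: "\<And>x. 0 \<le> g x"
    then have g[measurable]: "g \<in> borel_measurable borel" by simp
    define G where "G y = (\<integral>\<^sup>+w. ennreal (g (ham_flow grad T y w) powr (q / (q - 1))) \<partial>std_gauss)" for y
    have G[measurable]: "G \<in> borel_measurable borel"
    proof -
      have "(\<lambda>z. ennreal (g (ham_flow grad T (fst z) (snd z)) powr (q / (q - 1)))) \<in> borel_measurable (borel \<Otimes>\<^sub>M std_gauss)"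
        by measurable
      then show ?thesis unfolding G_def by (intro \<gamma>.borel_measurable_nn_integral) (simp add: split_beta)
    qed
    define F where "F x = (\<integral>\<^sup>+v. ennreal (g (q_tilde grad T h x v)) \<partial>std_gauss)" for x
    have F[measurable]: "F \<in> borel_measurable borel"
    proof -
      have "(\<lambda>z. ennreal (g (case z of (x, v) \<Rightarrow> q_tilde grad T h x v))) \<in> borel_measurable (borel \<Otimes>\<^sub>M std_gauss)"
        by measurable
      then show ?thesis unfolding F_def by (intro \<gamma>.borel_measurable_nn_integral) (simp add: split_beta)
    qed
    \<comment> \<open>The transport inequality is applied to the conjugate power of
      \<open>g\<close>, and the Gaussian estimate to the exponential of the cost.\<close>
    have pt: "F x \<le> ennreal (1 - 1 / q) * G y + ennreal (1 / q) * ennreal (exp (\<beta> * B (norm (x - y)) (norm y)))" for x y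
    proof -
      let ?c = "\<lambda>v::'a. cost h (norm (x - y)) (norm y) (norm v)"
      have cm[measurable]: "(\<lambda>v::'a. ?c v) \<in> borel_measurable borel"
        unfolding cost_def slope_bound_def Let_def by measurable
      have qx[measurable]: "q_tilde grad T h x \<in> borel_measurable borel"
        using measurable_compose[OF measurable_Pair1' q_tilde_measurable[of h], of x] by simp
      have "F x \<le> (\<integral>\<^sup>+v. ennreal (1 - 1 / q) * (ennreal (g (q_tilde grad T h x v) powr (q / (q - 1))) * ennreal (exp (- ?c v))) + ennreal (1 / q) * ennreal (exp (\<beta> * ?c v)) \<partial>std_gauss)"
        unfolding F_def
      proof (rule nn_integral_mono)
        fix v
        have "ennreal (g (q_tilde grad T h x v)) \<le> ennreal ((1 - 1 / q) * (g (q_tilde grad T h x v) powr (q / (q - 1)) * exp (- ?c v)) + 1 / q * exp (\<beta> * ?c v))"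
          unfolding \<beta> by (intro ennreal_leI young_weight q g0)
        also have "\<dots> = ennreal (1 - 1 / q) * (ennreal (g (q_tilde grad T h x v) powr (q / (q - 1))) * ennreal (exp (- ?c v))) + ennreal (1 / q) * ennreal (exp (\<beta> * ?c v))"
          using q by (simp add: ennreal_mult'' ennreal_plus del: times_divide_eq_left)
        finally show "ennreal (g (q_tilde grad T h x v)) \<le> \<dots>" .
      qed
      also have "\<dots> = ennreal (1 - 1 / q) * (\<integral>\<^sup>+v. ennreal (g (q_tilde grad T h x v) powr (q / (q - 1))) * ennreal (exp (- ?c v)) \<partial>std_gauss)
          + ennreal (1 / q) * (\<integral>\<^sup>+v. ennreal (exp (\<beta> * ?c v)) \<partial>std_gauss)"
        by (simp add: nn_integral_add nn_integral_cmult)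
      also have "\<dots> \<le> ennreal (1 - 1 / q) * G y + ennreal (1 / q) * ennreal (exp (\<beta> * B (norm (x - y)) (norm y)))"
      proof (intro add_mono mult_left_mono)
        show "(\<integral>\<^sup>+v. ennreal (g (q_tilde grad T h x v) powr (q / (q - 1))) * ennreal (exp (- ?c v)) \<partial>std_gauss) \<le> G y"
          unfolding G_def by (rule nn_integral_transport_le[OF h N]) auto
        show "(\<integral>\<^sup>+v. ennreal (exp (\<beta> * ?c v)) \<partial>std_gauss) \<le> ennreal (exp (\<beta> * B (norm (x - y)) (norm y)))"
          unfolding B_def A0 \<alpha>1 \<alpha>2 \<omega>
          by (rule nn_integral_exp_cost_le[OF h _ _ \<beta>0 s' u hu d L_nonneg]) auto
      qed auto
      finally show ?thesis .
    qed
    have "(\<integral>\<^sup>+x. ennreal (g x) \<partial>P_tilde grad T h \<mu>) = (\<integral>\<^sup>+z. ennreal (g (case z of (x, v) \<Rightarrow> q_tilde grad T h x v)) \<partial>(\<mu> \<Otimes>\<^sub>M std_gauss))"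
      unfolding P_tilde_def by (rule nn_integral_distr[OF qm]) simp
    also have "\<dots> = (\<integral>\<^sup>+x. F x \<partial>\<mu>)"
      unfolding F_def by (subst \<gamma>.nn_integral_fst[symmetric]) (use qm in auto)
    also have "\<dots> = (\<integral>\<^sup>+z. F (fst z) \<partial>R)"
      unfolding R1[symmetric] by (rule nn_integral_distr) auto
    also have "\<dots> \<le> (\<integral>\<^sup>+z. ennreal (1 - 1 / q) * G (snd z) + ennreal (1 / q) * ennreal (exp (\<beta> * B (norm (fst z - snd z)) (norm (snd z)))) \<partial>R)"
      by (intro nn_integral_mono pt)
    also have "\<dots> = ennreal (1 - 1 / q) * (\<integral>\<^sup>+z. G (snd z) \<partial>R) + ennreal (1 / q) * (\<integral>\<^sup>+z. ennreal (exp (\<beta> * B (norm (fst z - snd z)) (norm (snd z)))) \<partial>R)"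
      by (simp add: nn_integral_add nn_integral_cmult B_def)
    also have "(\<integral>\<^sup>+z. G (snd z) \<partial>R) = (\<integral>\<^sup>+y. G y \<partial>target f)"
      unfolding R2[symmetric] by (rule nn_integral_distr[symmetric]) auto
    also have "ennreal (1 - 1 / q) * (\<integral>\<^sup>+y. G y \<partial>target f) + ennreal (1 / q) * (\<integral>\<^sup>+z. ennreal (exp (\<beta> * B (norm (fst z - snd z)) (norm (snd z)))) \<partial>R)
      \<le> ennreal (1 - 1 / q) * (\<integral>\<^sup>+y. ennreal (g y powr (q / (q - 1))) \<partial>target f) + ennreal (1 / q) * ennreal (exp (\<beta> * ?b))"
      unfolding G_def by (intro add_mono mult_left_mono mom stationary_le) auto
    also have "ennreal (1 / q) * ennreal (exp (\<beta> * ?b)) = ennreal (exp (\<beta> * ?b) / q)"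
      using q by (simp add: ennreal_mult'[symmetric])
    finally show "(\<integral>\<^sup>+x. ennreal (g x) \<partial>P_tilde grad T h \<mu>)
      \<le> ennreal (1 - 1 / q) * (\<integral>\<^sup>+x. ennreal (g x powr (q / (q - 1))) \<partial>target f) + ennreal (exp (\<beta> * ?b) / q)" .
  qed
  also have "ln (exp (\<beta> * ?b)) / (q - 1) = ?b" using q \<beta> by simp
  finally show ?thesis .
qed

end

section \<open>Numerical constants\<close>

text \<open>Real arithmetic, separated from the measure theory. \<open>D\<close> stands for
  \<open>sqrt d\<close>, \<open>l\<close> for \<open>sqrt (ln 2)\<close>, \<open>w1\<close> for the
  contracted initial distance, \<Delta> for the bias and \<open>k\<close> for the positive part of
  \<open>K\<close>; \<alpha>1, \<alpha>2 and \<omega> are the coefficients left by the Gaussian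
  integration.\<close>

locale constants =
  fixes d D l \<beta> q s u p j px jx h w1 \<Delta> k \<alpha>1 \<alpha>2 \<omega> X :: real
  assumes d: "D * D = d" "1 \<le> D" and l: "0 < l" "l \<le> 5/6"
    and \<beta>: "0 < \<beta>" "q = \<beta> + 1" "s = 2 * \<beta> + 1" and u: "u^2 = 1 + 1 / (4 * s)" "0 < u"
    and p: "0 \<le> p" "0 \<le> j" "0 \<le> px" "0 \<le> jx" "0 \<le> h"
    and w: "0 \<le> w1" "0 \<le> \<Delta>" "0 \<le> k"
    and \<alpha>1: "\<alpha>1 = 15/14 * u * D * p + d * j"
    and \<alpha>2: "\<alpha>2 = h * (15/14 * u * D * px + d * jx)"
    and \<omega>: "\<omega> = 1/2 + 9/14 * \<beta> * u^2" and X: "X = 1 + 3 * s * u^2"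
begin

text \<open>28/25 is a rational just above \<open>sqrt (5/4)\<close>, convenient because
  \<open>15/14 * 28/25 = 6/5\<close>.\<close>

lemma u_le: "u \<le> 28/25"
proof -
  have "u^2 \<le> (28/25)^2" unfolding u(1) using \<beta> by (simp add: field_simps power2_eq_square)
  then show ?thesis by (rule power2_le_imp_le) simp
qed

lemma \<beta>u_le: "\<beta> * u^2 \<le> \<beta> + 1/8"
  unfolding u(1) using \<beta> by (simp add: field_simps)

lemma \<omega>_le: "8 * \<omega> \<le> X"
proof -
  have "1 \<le> u^2" unfolding u(1) using \<beta> by simp
  moreover have "0 \<le> \<beta> * u^2" using \<beta> by simp
  moreover have "X = 1 + 3 * u^2 + 6 * (\<beta> * u^2)" by (simp add: X \<beta>(3) algebra_simps)
  ultimately show ?thesis unfolding \<omega> by simp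
qed

lemma \<omega>_le': "\<omega> \<le> 7/12 + 9/14 * \<beta>" "0 < \<omega>"
  using \<beta>u_le \<beta> unfolding \<omega> by (auto simp: add_pos_nonneg)

lemma nonneg: "0 \<le> d * j" "0 \<le> D * p" "0 \<le> d * jx" "0 \<le> D * px" "0 \<le> \<alpha>1" "0 \<le> \<alpha>2" "0 \<le> d"
  using d p \<alpha>1 \<alpha>2 u(2) by (auto simp flip: d(1))

lemma \<alpha>1_le: "\<alpha>1 \<le> 6/5 * (D * p) + d * j" "\<alpha>1 \<le> 15/14 * (D * (6 * D * j + p * u))"
proof -
  have "15/14 * u * (D * p) \<le> 15/14 * (28/25) * (D * p)" using u_le nonneg by (intro mult_right_mono) auto
  then show "\<alpha>1 \<le> 6/5 * (D * p) + d * j" by (simp add: \<alpha>1 mult_ac)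
  show "\<alpha>1 \<le> 15/14 * (D * (6 * D * j + p * u))"
    using nonneg unfolding \<alpha>1 d(1)[symmetric] by (simp add: algebra_simps)
qed

lemma \<alpha>2_le: "\<alpha>2 * k \<le> 15/14 * (h * k * (D * (6 * D * jx + px * u)))"
proof -
  have "\<alpha>2 * k = h * k * (15/14 * u * D * px + d * jx)" by (simp add: \<alpha>2)
  also have "\<dots> \<le> h * k * (15/14 * (D * (6 * D * jx + px * u)))"
    using p w nonneg unfolding d(1)[symmetric] by (intro mult_left_mono) (auto simp: algebra_simps)
  finally show ?thesis by (simp add: mult_ac)
qed

lemma square_w_le: "(w1 + \<Delta>)^2 \<le> 5/4 * w1^2 + 5 * \<Delta>^2"
proof -
  have "0 \<le> (w1 / 2 - 2 * \<Delta>)^2" by simp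
  then show ?thesis by (simp add: power2_eq_square algebra_simps)
qed

text \<open>A budget: \<open>hk\<close> enters with the factor 3/5, and the thresholds for \<Delta>
  and for \<open>h * k\<close> add at most 15/112, 25/512, 75/784 and 5/256, in total less than 1.
  The main saving is \<open>\<beta> \<le> s / 2\<close>. Strictness makes room for the error in the
  couplings.\<close>

lemma small:
  assumes hk: "s * (16/11 * d * j + D * p) * w1 / (2 * l) + q * s * p^2 * w1^2 \<le> 1"
    and \<Delta>1: "\<Delta> * (s * (D * (6 * D * j + p * u))) \<le> l / 2" and \<Delta>2: "8 * s * X * (p^2 * \<Delta>^2) \<le> 1"
    and k1: "h * k * (s * (D * (6 * D * jx + px * u))) \<le> 5/14 * l" and k2: "16 * s * X * (h^2 * px^2 * k^2) \<le> 1"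
  shows "\<beta> * \<alpha>1 * (w1 + \<Delta>) / (2 * l) + \<beta> * \<omega> * (5/4 * p^2) * (w1 + \<Delta>)^2
      + (\<beta> * \<alpha>2 * k / (2 * l) + \<beta> * \<omega> * (5 * h^2 * px^2) * k^2) < 1"
proof -
  have s: "0 < s" "\<beta> \<le> s / 2" using \<beta> by auto
  have \<omega>0: "0 < \<omega>" by (rule \<omega>_le')
  have t1: "\<beta> * \<alpha>1 * w1 / (2 * l) \<le> 3/5 * (s * (16/11 * d * j + D * p) * w1 / (2 * l))"
  proof -
    have "\<beta> * \<alpha>1 \<le> s / 2 * \<alpha>1" using s nonneg by (intro mult_right_mono) auto
    also have "\<dots> \<le> s / 2 * (6/5 * (D * p) + d * j)" using s \<alpha>1_le by (intro mult_left_mono) auto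
    also have "\<dots> \<le> s / 2 * (6/5 * (16/11 * d * j + D * p))" using s nonneg by (intro mult_left_mono) auto
    also have "\<dots> = 3/5 * (s * (16/11 * d * j + D * p))" by simp
    finally have "\<beta> * \<alpha>1 * w1 / (2 * l) \<le> 3/5 * (s * (16/11 * d * j + D * p)) * w1 / (2 * l)"
      using w l by (intro divide_right_mono mult_right_mono) auto
    then show ?thesis by simp
  qed
  have t2: "\<beta> * \<omega> * (5/4 * p^2) * (5/4 * w1^2) \<le> 3/5 * (q * s * p^2 * w1^2)"
  proof -
    have "\<beta> * \<omega> \<le> \<beta> * (7/12 + 9/14 * \<beta>)" using \<beta> \<omega>_le' by (intro mult_left_mono) auto
    \<comment> \<open>48/125 is 3/5 divided by 25/16, the product of the two factors 5/4 on the
      left.\<close>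
    also have "\<dots> \<le> 48/125 * (q * s)"
    proof -
      have "\<beta> * (7/12 + 9/14 * \<beta>) = 7/12 * \<beta> + 9/14 * (\<beta> * \<beta>)"
        "48/125 * (q * s) = 96/125 * (\<beta> * \<beta>) + 144/125 * \<beta> + 48/125"
        unfolding \<beta>(2,3) by (simp_all add: algebra_simps)
      moreover have "9/14 * (\<beta> * \<beta>) \<le> 96/125 * (\<beta> * \<beta>)" by simp
      ultimately show ?thesis using \<beta>(1) by linarith
    qed
    finally have "\<beta> * \<omega> * (25/16 * (p^2 * w1^2)) \<le> 48/125 * (q * s) * (25/16 * (p^2 * w1^2))"
      by (intro mult_right_mono) auto
    then show ?thesis by (simp add: mult_ac)
  qed
  have t3: "\<beta> * \<alpha>1 * \<Delta> / (2 * l) \<le> 15/112"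
  proof -
    have "\<beta> * \<alpha>1 * \<Delta> \<le> (s / 2) * (15/14 * (D * (6 * D * j + p * u))) * \<Delta>"
      using s nonneg \<alpha>1_le(2) w by (intro mult_mono mult_right_mono) auto
    also have "\<dots> = 15/28 * (\<Delta> * (s * (D * (6 * D * j + p * u))))" by simp
    also have "\<dots> \<le> 15/28 * (l / 2)" by (rule mult_left_mono[OF \<Delta>1]) simp
    finally show ?thesis using l by (simp add: field_simps)
  qed
  have \<beta>\<omega>: "16 * (\<beta> * \<omega>) \<le> s * X"
  proof -
    have "16 * (\<beta> * \<omega>) = (2 * \<beta>) * (8 * \<omega>)" by simp
    also have "\<dots> \<le> s * X" using s \<beta> \<omega>0 \<omega>_le by (intro mult_mono) auto
    finally show ?thesis .
  qed
  have t4: "\<beta> * \<omega> * (5/4 * p^2) * (5 * \<Delta>^2) \<le> 25/512"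
  proof -
    have "16 * (\<beta> * \<omega>) * (p^2 * \<Delta>^2) \<le> s * X * (p^2 * \<Delta>^2)" using \<beta>\<omega> by (rule mult_right_mono) simp
    then have "\<beta> * \<omega> * (p^2 * \<Delta>^2) \<le> 1/128" using \<Delta>2 by simp
    then show ?thesis by (simp add: mult_ac)
  qed
  have t5: "\<beta> * \<alpha>2 * k / (2 * l) \<le> 75/784"
  proof -
    have "\<beta> * (\<alpha>2 * k) \<le> (s / 2) * (15/14 * (h * k * (D * (6 * D * jx + px * u))))"
      by (rule mult_mono) (use s nonneg \<alpha>2_le w \<beta> in auto)
    also have "\<dots> = 15/28 * (h * k * (s * (D * (6 * D * jx + px * u))))" by simp
    also have "\<dots> \<le> 15/28 * (5/14 * l)" by (rule mult_left_mono[OF k1]) simp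
    finally show ?thesis using l by (simp add: field_simps)
  qed
  have t6: "\<beta> * \<omega> * (5 * h^2 * px^2) * k^2 \<le> 5/256"
  proof -
    have "16 * (\<beta> * \<omega>) * (h^2 * px^2 * k^2) \<le> s * X * (h^2 * px^2 * k^2)" using \<beta>\<omega> by (rule mult_right_mono) simp
    then have "\<beta> * \<omega> * (h^2 * px^2 * k^2) \<le> 1/256" using k2 by simp
    then show ?thesis by (simp add: mult_ac)
  qed
  have "\<beta> * \<omega> * (5/4 * p^2) * (w1 + \<Delta>)^2 \<le> \<beta> * \<omega> * (5/4 * p^2) * (5/4 * w1^2 + 5 * \<Delta>^2)"
    using \<beta> \<omega>0 by (intro mult_left_mono square_w_le) auto
  then have "\<beta> * \<omega> * (5/4 * p^2) * (w1 + \<Delta>)^2 \<le> \<beta> * \<omega> * (5/4 * p^2) * (5/4 * w1^2) + \<beta> * \<omega> * (5/4 * p^2) * (5 * \<Delta>^2)"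
    by (simp only: distrib_left)
  moreover have "\<beta> * \<alpha>1 * (w1 + \<Delta>) / (2 * l) = \<beta> * \<alpha>1 * w1 / (2 * l) + \<beta> * \<alpha>1 * \<Delta> / (2 * l)"
    by (simp only: distrib_left add_divide_distrib)
  moreover have "A + B + (f + g) < 1"
    if "B \<le> c + e" "A = a + b" "a \<le> 3/5 * P" "c \<le> 3/5 * Q" "b \<le> 15/112" "e \<le> 25/512"
      "f \<le> 75/784" "g \<le> 5/256" "P + Q \<le> 1" for A B a b c e f g P Q :: real
    using that by argo
  ultimately show ?thesis using t1 t2 t3 t4 t5 t6 hk by blast
qed

text \<open>Termwise comparison. Since \<open>E\<close> dominates both \<open>w1\<close> and its
  square, the linear and the quadratic contribution of the initial distance merge into one term;
  \<open>l \<le> 5/6\<close> and \<open>8 * \<omega> \<le> X\<close> absorb the numerical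
  factors.\<close>

lemma bound:
  assumes E: "w1 \<le> E" "w1^2 \<le> E" and Y: "k \<le> Y" and jv: "0 \<le> jv" "0 \<le> jc" "0 \<le> pv"
  shows "8/7 * d * (h * pv + h^2 * pv^2 / 2) + 15/14 * D * (d * h * jv) + 36/7 * \<beta> * (d * h * jv)^2 + d * h * jc
      + l * (\<alpha>1 * (w1 + \<Delta>) + \<alpha>2 * k) + l^2 * \<omega> * (5/4 * p^2 * (w1 + \<Delta>)^2 + 5 * h^2 * px^2 * k^2)
    \<le> 3/2 * (16/11 * d * j + D * p + q * p^2) * l * E
      + (d * h * (6 * jc + 6 * D * jv + 108 * s * d * h * jv^2 + h * pv^2 + 2 * pv)
         + 2 * D * (6 * D * j + p * u) * \<Delta> + p^2 * X * \<Delta>^2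
         + 2 * h * D * (6 * D * jx + px * u) * Y + 2 * h^2 * px^2 * X * (\<Delta>^2 + k^2))"
proof -
  have E0: "0 \<le> E" using E w by linarith
  have \<omega>0: "0 < \<omega>" by (rule \<omega>_le')
  have l2: "l^2 \<le> 25/36" "l^2 \<le> 5/6 * l" "0 \<le> l^2"
    using l power_mono[of l "5/6" 2] by (auto simp: power2_eq_square)
  have X0: "0 \<le> X" using \<omega>_le \<omega>0 by linarith
  have a: "8/7 * d * (h * pv + h^2 * pv^2 / 2) + 15/14 * D * (d * h * jv) + 36/7 * \<beta> * (d * h * jv)^2 + d * h * jc
    \<le> d * h * (6 * jc + 6 * D * jv + 108 * s * d * h * jv^2 + h * pv^2 + 2 * pv)"
  proof -
    have n: "0 \<le> d * h * pv" "0 \<le> d * h^2 * pv^2" "0 \<le> D * (d * h * jv)" "0 \<le> d * h * jc" "0 \<le> \<beta> * (d * h * jv)^2" "0 \<le> (d * h * jv)^2"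
      using nonneg p jv \<beta> d by auto
    have "8/7 * d * (h * pv + h^2 * pv^2 / 2) + 15/14 * D * (d * h * jv) + 36/7 * \<beta> * (d * h * jv)^2 + d * h * jc
      = 8/7 * (d * h * pv) + 4/7 * (d * h^2 * pv^2) + 15/14 * (D * (d * h * jv)) + 36/7 * (\<beta> * (d * h * jv)^2) + d * h * jc"
      by (simp add: algebra_simps)
    also have "\<dots> \<le> 2 * (d * h * pv) + d * h^2 * pv^2 + 6 * (D * (d * h * jv)) + (216 * (\<beta> * (d * h * jv)^2) + 108 * (d * h * jv)^2) + 6 * (d * h * jc)"
      using n by linarith
    also have "\<dots> = d * h * (6 * jc + 6 * D * jv + 108 * s * d * h * jv^2 + h * pv^2 + 2 * pv)"
      by (simp add: \<beta>(3) power2_eq_square algebra_simps)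
    finally show ?thesis .
  qed
  have b: "l * (\<alpha>1 * w1) + l^2 * \<omega> * (5/4 * p^2 * (5/4 * w1^2)) \<le> 3/2 * (16/11 * d * j + D * p + q * p^2) * l * E"
  proof -
    have "l * (\<alpha>1 * w1) \<le> l * ((6/5 * (D * p) + d * j) * E)"
      using l \<alpha>1_le E w nonneg by (intro mult_left_mono mult_mono) auto
    also have "\<dots> \<le> l * ((3/2 * (16/11 * d * j + D * p)) * E)"
      using l E0 nonneg by (intro mult_left_mono mult_right_mono) auto
    finally have 1: "l * (\<alpha>1 * w1) \<le> 3/2 * (16/11 * d * j + D * p) * l * E" by (simp add: mult_ac)
    have "l^2 * \<omega> * (5/4 * p^2 * (5/4 * w1^2)) = (l^2 * \<omega>) * (25/16 * (p^2 * w1^2))" by simp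
    also have "\<dots> \<le> ((5/6 * l) * (7/12 + 9/14 * \<beta>)) * (25/16 * (p^2 * E))"
      using l2 l \<omega>_le' \<beta> E w by (intro mult_mono) auto
    also have "\<dots> = (125/96 * (7/12 + 9/14 * \<beta>)) * (l * (p^2 * E))" by simp
    also have "\<dots> \<le> (3/2 * q) * (l * (p^2 * E))"
      using \<beta> l E0 by (intro mult_right_mono) auto
    finally show ?thesis using 1 by (simp add: algebra_simps)
  qed
  have c: "l * (\<alpha>1 * \<Delta>) \<le> 2 * D * (6 * D * j + p * u) * \<Delta>"
  proof -
    have "l * (\<alpha>1 * \<Delta>) \<le> 1 * ((15/14 * (D * (6 * D * j + p * u))) * \<Delta>)"
      using l \<alpha>1_le(2) w nonneg by (intro mult_mono mult_right_mono) auto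
    also have "\<dots> \<le> (2 * (D * (6 * D * j + p * u))) * \<Delta>"
    proof -
      have "0 \<le> D * (6 * D * j + p * u)" using d p u by auto
      then have "15/14 * (D * (6 * D * j + p * u)) \<le> 2 * (D * (6 * D * j + p * u))" by linarith
      from mult_right_mono[OF this w(2)] show ?thesis by simp
    qed
    finally show ?thesis by (simp add: mult_ac)
  qed
  have \<omega>X: "l^2 * \<omega> \<le> 25/288 * X"
    using mult_mono[OF l2(1) \<omega>_le] \<omega>0 by simp
  have e: "l^2 * \<omega> * (5/4 * p^2 * (5 * \<Delta>^2)) \<le> p^2 * X * \<Delta>^2"
  proof -
    have "l^2 * \<omega> * (25/4 * (p^2 * \<Delta>^2)) \<le> 25/288 * X * (25/4 * (p^2 * \<Delta>^2))" using \<omega>X by (rule mult_right_mono) simp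
    also have "\<dots> \<le> X * (p^2 * \<Delta>^2)" using mult_nonneg_nonneg[OF X0, of "p^2 * \<Delta>^2"] by (simp add: mult_ac)
    finally show ?thesis by (simp add: mult_ac)
  qed
  have f: "l * (\<alpha>2 * k) \<le> 2 * h * D * (6 * D * jx + px * u) * Y"
  proof -
    have z: "0 \<le> h * (D * (6 * D * jx + px * u))" using d p u by auto
    have "l * (\<alpha>2 * k) \<le> 1 * (15/14 * (h * k * (D * (6 * D * jx + px * u))))"
      by (rule mult_mono) (use l \<alpha>2_le w nonneg in auto)
    also have "\<dots> = 15/14 * (h * (D * (6 * D * jx + px * u)) * k)" by simp
    also have "\<dots> \<le> 2 * (h * (D * (6 * D * jx + px * u)) * Y)"
      using mult_left_mono[OF Y z] mult_nonneg_nonneg[OF z w(3)] by linarith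
    finally show ?thesis by (simp add: mult_ac)
  qed
  have g: "l^2 * \<omega> * (5 * h^2 * px^2 * k^2) \<le> 2 * h^2 * px^2 * X * (\<Delta>^2 + k^2)"
  proof -
    have "l^2 * \<omega> * (5 * (h^2 * px^2 * k^2)) \<le> 25/288 * X * (5 * (h^2 * px^2 * k^2))" using \<omega>X by (rule mult_right_mono) simp
    also have "\<dots> \<le> 2 * (X * (h^2 * px^2 * k^2))" using mult_nonneg_nonneg[OF X0, of "h^2 * px^2 * k^2"] by (simp add: mult_ac)
    also have "\<dots> \<le> 2 * (X * (h^2 * px^2 * k^2)) + 2 * (X * (h^2 * px^2 * \<Delta>^2))" using X0 by simp
    finally show ?thesis by (simp add: algebra_simps)
  qed
  have m: "l^2 * \<omega> * (5/4 * p^2 * (w1 + \<Delta>)^2) \<le> l^2 * \<omega> * (5/4 * p^2 * (5/4 * w1^2)) + l^2 * \<omega> * (5/4 * p^2 * (5 * \<Delta>^2))"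
  proof -
    have "l^2 * \<omega> * (5/4 * p^2 * (w1 + \<Delta>)^2) \<le> l^2 * \<omega> * (5/4 * p^2 * (5/4 * w1^2 + 5 * \<Delta>^2))"
      using l2 \<omega>0 by (intro mult_left_mono square_w_le) auto
    then show ?thesis by (simp only: distrib_left)
  qed
  have "l * (\<alpha>1 * (w1 + \<Delta>) + \<alpha>2 * k) = l * (\<alpha>1 * w1) + l * (\<alpha>1 * \<Delta>) + l * (\<alpha>2 * k)"
    "l^2 * \<omega> * (5/4 * p^2 * (w1 + \<Delta>)^2 + 5 * h^2 * px^2 * k^2) = l^2 * \<omega> * (5/4 * p^2 * (w1 + \<Delta>)^2) + l^2 * \<omega> * (5 * h^2 * px^2 * k^2)"
    by (simp_all only: distrib_left)
  then show ?thesis using a b c e f g m by linarith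
qed

end

section \<open>The main theorem\<close>

text \<open>The four-point inequality comes from moving along the segments from \<open>b\<close> to
  \<open>a\<close> and from \<open>e\<close> to \<open>c\<close> with one parameter. The derivative
  splits into a Hessian applied to \<open>a - b - (c - e)\<close> and a difference of Hessians
  applied to \<open>c - e\<close>; by convexity the two moving points stay within distance
  \<open>m\<close>.\<close>

lemma force_field_of_bounds:
  fixes grad :: "'a::euclidean_space \<Rightarrow> 'a" and Hess :: "'a \<Rightarrow> 'a \<Rightarrow>\<^sub>L 'a"
    and D3 :: "'a \<Rightarrow> 'a \<Rightarrow>\<^sub>L 'a \<Rightarrow>\<^sub>L 'a"
  assumes zero: "grad 0 = 0"
    and hess: "\<And>x. (grad has_derivative blinfun_apply (Hess x)) (at x)"
    and third: "\<And>x. (Hess has_derivative blinfun_apply (D3 x)) (at x)"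
    and L: "\<And>x. norm (Hess x) \<le> L" and M: "\<And>x. norm (D3 x) \<le> M"
    and T: "0 < T" "L * T^2 \<le> 1/12"
  shows "force_field grad L M T"
proof
  show L0: "0 \<le> L" and M0: "0 \<le> M" using norm_ge_zero order_trans L M by blast+
  show "norm (grad a - grad b) \<le> L * norm (a - b)" for a b
    by (rule differentiable_bound[where S=UNIV and f'="\<lambda>x. blinfun_apply (Hess x)"])
      (use hess L in \<open>auto simp: norm_blinfun.rep_eq[symmetric]\<close>)
  have Hlip: "norm (Hess a - Hess b) \<le> M * norm (a - b)" for a b
    by (rule differentiable_bound[where S=UNIV and f'="\<lambda>x. blinfun_apply (D3 x)"])
      (use third M in \<open>auto simp: norm_blinfun.rep_eq[symmetric]\<close>)
  fix a b c e :: 'a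
  define m where "m = max (norm (a - c)) (norm (b - e))"
  define k where "k t = grad (b + t *\<^sub>R (a - b)) - grad (e + t *\<^sub>R (c - e))" for t :: real
  define k' where "k' t = Hess (b + t *\<^sub>R (a - b)) (a - b) - Hess (e + t *\<^sub>R (c - e)) (c - e)" for t :: real
  have "norm (k 1 - k 0) \<le> (L * norm (a - b - (c - e)) + M * m * norm (c - e)) * norm (1 - 0 :: real)"
  proof (rule differentiable_bound[where S="{0..1}" and f'="\<lambda>t s. s *\<^sub>R k' t"])
    show "(k has_derivative (\<lambda>s. s *\<^sub>R k' t)) (at t within {0..1})" for t
    proof -
      have "((\<lambda>t. grad (z + t *\<^sub>R y)) has_derivative (\<lambda>s. Hess (z + t *\<^sub>R y) (s *\<^sub>R y))) (at t)" for z y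
        by (rule has_derivative_compose[OF _ hess]) (auto intro!: derivative_eq_intros)
      then have "((\<lambda>t. grad (z + t *\<^sub>R y)) has_derivative (\<lambda>s. s *\<^sub>R Hess (z + t *\<^sub>R y) y)) (at t)" for z y
        by (simp only: blinfun.scaleR_right)
      from has_derivative_diff[OF this[of b "a - b"] this[of e "c - e"]]
      have "(k has_derivative (\<lambda>s. s *\<^sub>R k' t)) (at t)"
        unfolding k_def[abs_def] k'_def scaleR_diff_right[of _ "blinfun_apply _ _" "blinfun_apply _ _"] .
      then show ?thesis by (rule has_derivative_at_withinI)
    qed
    fix t :: real assume t: "t \<in> {0..1}"
    let ?x = "b + t *\<^sub>R (a - b)" and ?y = "e + t *\<^sub>R (c - e)"
    have "?x - ?y = (1 - t) *\<^sub>R (b - e) + t *\<^sub>R (a - c)" by (simp add: algebra_simps)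
    also have "norm \<dots> \<le> (1 - t) * norm (b - e) + t * norm (a - c)"
      using t by (intro order_trans[OF norm_triangle_ineq]) simp
    also have "\<dots> \<le> (1 - t) * m + t * m" using t by (intro add_mono mult_left_mono) (auto simp: m_def)
    finally have xy: "norm (?x - ?y) \<le> m" by (simp add: algebra_simps)
    have "k' t = Hess ?x (a - b - (c - e)) + (Hess ?x - Hess ?y) (c - e)"
      by (simp add: k'_def blinfun.diff_left blinfun.diff_right)
    also have "norm \<dots> \<le> norm (Hess ?x) * norm (a - b - (c - e)) + norm (Hess ?x - Hess ?y) * norm (c - e)"
      by (intro order_trans[OF norm_triangle_ineq] add_mono norm_blinfun)
    also have "\<dots> \<le> L * norm (a - b - (c - e)) + M * m * norm (c - e)"
      using L Hlip[of ?x ?y] mult_left_mono[OF xy M0] by (intro add_mono mult_right_mono) auto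
    finally have k': "norm (k' t) \<le> L * norm (a - b - (c - e)) + M * m * norm (c - e)" .
    then show "onorm (\<lambda>s. s *\<^sub>R k' t) \<le> L * norm (a - b - (c - e)) + M * m * norm (c - e)"
      using order_trans[OF norm_ge_zero k'] by (intro onorm_bound) (auto simp: mult.commute[of _ "\<bar>_\<bar>"] intro!: mult_left_mono)
  qed auto
  then show "norm (grad a - grad b - (grad c - grad e)) \<le> L * norm (a - b - (c - e)) + M * max (norm (a - c)) (norm (b - e)) * norm (c - e)"
    by (simp add: k_def m_def algebra_simps)
qed (use zero T in auto)

theorem theorem4:
  fixes f :: "'a::euclidean_space \<Rightarrow> real"
    and grad :: "'a \<Rightarrow> 'a" and Hess :: "'a \<Rightarrow> 'a \<Rightarrow>\<^sub>L 'a"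
    and D3 :: "'a \<Rightarrow> 'a \<Rightarrow>\<^sub>L 'a \<Rightarrow>\<^sub>L 'a"
    and L M T h q \<Delta> K c\<^sub>1 c\<^sub>2 :: real
    and \<mu> \<nu>Q :: "'a measure" and Q :: "'a \<Rightarrow> 'a measure"
    and d s u \<delta>\<^sub>1 \<delta>\<^sub>2 B :: real
  assumes d_def: "d = real DIM('a)"
    and s_def: "s = 2 * q - 1"
    and u_def: "u = sqrt (1 + 1 / (4 * s))"
    and \<delta>1_def: "\<delta>\<^sub>1 = s * (8 * d * M * T^2 + 3 * sqrt d / (2 * T))"
    and \<delta>2_def: "\<delta>\<^sub>2 = 9 * q * s / (4 * T^2)"
    and B_def: "B = d * h * (6 * j_c T + 6 * sqrt d * j_v M T + 108 * s * d * h * (j_v M T)^2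
                  + h * (p_v T)^2 + 2 * p_v T)
            + 2 * sqrt d * (6 * sqrt d * j_xy M T + p_xy T * u) * \<Delta>
            + (p_xy T)^2 * (1 + 3 * s * u^2) * \<Delta>^2
            + 2 * h * sqrt d * (6 * sqrt d * j_x M T + p_x L * u)
                * (\<Delta> + K + sqrt (\<Delta>^2 + K^2))
            + 2 * h^2 * (p_x L)^2 * (1 + 3 * s * u^2) * (\<Delta>^2 + K^2)"
    \<comment> \<open>(a) global minimum at 0 with value 0\<close>
    and min0: "\<forall>x. f 0 \<le> f x" and f0: "f 0 = 0"
    \<comment> \<open>(b),(c): f is C^3, gradient grad, Hessian Hess, third derivative D3\<close>
    and grad: "\<forall>x. (f has_derivative (\<lambda>w. grad x \<bullet> w)) (at x)"
    and hess: "\<forall>x. (grad has_derivative blinfun_apply (Hess x)) (at x)"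
    and third: "\<forall>x. (Hess has_derivative blinfun_apply (D3 x)) (at x)"
    and D3_cont: "continuous_on UNIV D3"
    and L_bound: "\<forall>x. norm (Hess x) \<le> L"
    and M_bound: "\<forall>x. norm (D3 x) \<le> M"
    \<comment> \<open>nu is a well-defined probability measure\<close>
    and integrable: "integrable lborel (\<lambda>x. exp (- f x))"
    \<comment> \<open>sub-Gaussianity of nu\<close>
    and K_nu: "psi_norm (target f) (\<lambda>x. x) \<le> ennreal K"
    \<comment> \<open>initial distribution\<close>
    and mu: "\<mu> \<in> space (prob_algebra (borel :: 'a measure))"
    \<comment> \<open>Markov kernel with stationary distribution\<close>
    and Q: "Q \<in> borel \<rightarrow>\<^sub>M prob_algebra (borel :: 'a measure)"
    and \<nu>Q: "\<nu>Q \<in> space (prob_algebra (borel :: 'a measure))"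
    and stationary: "\<nu>Q \<bind> Q = \<nu>Q"
    and c1: "c\<^sub>1 \<ge> 1" and c2: "c\<^sub>2 > 0"
    and contraction: "\<forall>k::nat. k \<ge> 1 \<longrightarrow> (\<forall>\<rho> \<in> space (prob_algebra (borel :: 'a measure)).
        W_psi (kernel_pow Q k \<rho>) \<nu>Q \<le> ennreal (c\<^sub>1 * exp (- c\<^sub>2 * real k)) * W_psi \<rho> \<nu>Q)"
    and bias: "W_psi \<nu>Q (target f) \<le> ennreal \<Delta>" and \<Delta>_nonneg: "\<Delta> \<ge> 0"
    \<comment> \<open>parameters\<close>
    and q: "1 < q"
    and T_pos: "T > 0"
    and h_nonneg: "0 \<le> h"
    and h_grid: "h > 0 \<Longrightarrow> \<exists>N::nat. T = real N * h"
    and LT: "L * (T^2 + T * h) \<le> 1 / 12"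
    and \<Delta>_small: "\<Delta> \<le> min
        (sqrt (2 * ln 2) / (4 * s * (sqrt d * (6 * sqrt d * j_xy M T + p_xy T * u) / sqrt 2
                                    + h * sqrt d * (6 * sqrt d * j_x M T + p_x L * u))))
        (1 / sqrt (8 * s * ((p_xy T)^2 * (1 + 3 * s * u^2)
                            + 2 * h^2 * (p_x L)^2 * (1 + 3 * s * u^2))))"
    and h_small: "h \<le> min ((u - 1) / p_v T)
        (min (sqrt (ln 2) / (2 * sqrt 2 * s * sqrt d * (6 * sqrt d * j_x M T + p_x L * u) * K))
             (1 / (4 * K * p_x L * sqrt ((1 + 3 * s * u^2) * s))))"
    \<comment> \<open>finiteness of the initial distance (otherwise no k satisfies the hypothesis below)\<close>
    and W_fin: "W_psi \<mu> \<nu>Q \<noteq> \<infinity>"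
  shows "\<forall>k::nat.
     real k \<ge> 1 / c\<^sub>2 * ln (c\<^sub>1 * enn2real (W_psi \<mu> \<nu>Q) / (4 * sqrt (ln 2))
                           * (\<delta>\<^sub>1 + sqrt (\<delta>\<^sub>1^2 + 16 * ln 2 * \<delta>\<^sub>2))) \<longrightarrow>
     renyi q (P_tilde grad T h (kernel_pow Q k \<mu>)) (target f)
       \<le> ereal (3 * (\<delta>\<^sub>1 + \<delta>\<^sub>2) / (2 * (2 * q - 1)) * sqrt (ln 2) * c\<^sub>1^2 * exp (- c\<^sub>2 * real k)
                 * max 1 ((enn2real (W_psi \<mu> \<nu>Q))^2) + B)"
proof (intro allI impI)
  fix k :: nat
  define \<beta> where "\<beta> = q - 1"
  define l where "l = sqrt (ln (2::real))"
  define W where "W = enn2real (W_psi \<mu> \<nu>Q)"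
  define w1 where "w1 = c\<^sub>1 * exp (- c\<^sub>2 * real k) * W"
  define K0 where "K0 = max K 0"
  define p where "p = p_xy T"
  define \<alpha>1 where "\<alpha>1 = 15/14 * u * sqrt d * p + d * j_xy M T"
  define \<alpha>2 where "\<alpha>2 = h * (15/14 * u * sqrt d * p_x L + d * j_x M T)"
  define \<omega> where "\<omega> = 1/2 + 9/14 * \<beta> * u^2"
  define X where "X = 1 + 3 * s * u^2"
  define A0 where "A0 = 8/7 * d * (h * p_v T + h^2 * (p_v T)^2 / 2) + 15/14 * sqrt d * (d * h * j_v M T)
        + 36/7 * \<beta> * (d * h * j_v M T)^2 + d * h * j_c T"
  assume k: "1 / c\<^sub>2 * ln (c\<^sub>1 * enn2real (W_psi \<mu> \<nu>Q) / (4 * sqrt (ln 2))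
                           * (\<delta>\<^sub>1 + sqrt (\<delta>\<^sub>1^2 + 16 * ln 2 * \<delta>\<^sub>2))) \<le> real k"
  have L0: "0 \<le> L" and M0: "0 \<le> M" using norm_ge_zero order_trans L_bound M_bound by blast+
  have d1: "1 \<le> d" using DIM_positive[where 'a='a] by (simp add: d_def)
  have D1: "1 \<le> sqrt d" "sqrt d * sqrt d = d" using d1 by auto
  have \<beta>: "0 < \<beta>" "q = \<beta> + 1" "s = 2 * \<beta> + 1" using q by (auto simp: \<beta>_def s_def)
  have u: "u^2 = 1 + 1 / (4 * s)" "0 < u" using \<beta> by (auto simp: u_def add_pos_pos)
  have pos: "0 < p" "0 < p_v T" "0 \<le> p_x L" "0 \<le> j_xy M T" "0 \<le> j_x M T" "0 \<le> j_v M T" "0 \<le> j_c T"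
    using T_pos L0 M0 by (auto simp: p_def p_xy_def p_v_def p_x_def j_xy_def j_x_def j_v_def j_c_def)
  have l: "0 < l" "l \<le> 5/6" "l^2 = ln 2"
  proof -
    show "0 < l" "l^2 = ln 2" by (auto simp: l_def)
    show "l \<le> 5/6" unfolding l_def by (rule real_le_lsqrt) (use ln2_le_25_over_36 in \<open>auto simp: power2_eq_square\<close>)
  qed
  have LT2: "L * T^2 \<le> 1/12"
  proof -
    have "0 \<le> L * (T * h)" using L0 T_pos h_nonneg by simp
    then show ?thesis using LT by (simp add: distrib_left)
  qed
  have grad0: "grad 0 = 0"
  proof -
    have "(\<lambda>w. grad 0 \<bullet> w) = (\<lambda>v. 0)"
      by (rule differential_zero_maxmin[of 0 UNIV f]) (use grad min0 in auto)
    then have "grad 0 \<bullet> grad 0 = 0" by metis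
    then show ?thesis by simp
  qed
  interpret force_field grad L M T
    by (rule force_field_of_bounds[where Hess=Hess and ?D3.0=D3]) (use grad0 hess third L_bound M_bound T_pos LT2 in auto)
  interpret potential grad L M T f
    by unfold_locales (use grad integrable in auto)
  have W0: "0 \<le> W" by (simp add: W_def)
  have w10: "0 \<le> w1" using c1 W0 by (simp add: w1_def)
  have K0: "0 \<le> K0" by (simp add: K0_def)
  have s0: "0 < s" using \<beta> by simp
  have X0: "0 < X" using s0 by (simp add: X_def add_pos_nonneg)
  have hu: "1 + h * p_v T \<le> u"
    using h_small pos(2) by (auto simp: pos_le_divide_eq)
  \<comment> \<open>\<open>ennreal\<close> truncates a negative \<open>K\<close> to 0, so
    \<open>K0\<close> is the effective constant. For negative \<open>K\<close> the second threshold
    for \<open>h\<close> is nonpositive and forces \<open>h = 0\<close>.\<close>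
  have hK: "h = 0 \<or> K0 = K"
  proof (rule ccontr)
    assume "\<not> (h = 0 \<or> K0 = K)"
    then have "0 < h" "K < 0" using h_nonneg by (auto simp: K0_def max_def split: if_splits)
    moreover have "0 \<le> 2 * sqrt 2 * s * sqrt d * (6 * sqrt d * j_x M T + p_x L * u)"
      using s0 d1 pos u by auto
    ultimately have "sqrt (ln 2) / (2 * sqrt 2 * s * sqrt d * (6 * sqrt d * j_x M T + p_x L * u) * K) \<le> 0"
      by (intro divide_nonneg_nonpos mult_nonneg_nonpos) auto
    then show False using h_small \<open>0 < h\<close> by auto
  qed
  interpret cst: constants d "sqrt d" l \<beta> q s u p "j_xy M T" "p_x L" "j_x M T" h w1 \<Delta> K0 \<alpha>1 \<alpha>2 \<omega> X
    by unfold_locales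
      (use D1 l \<beta> u pos h_nonneg w10 \<Delta>_nonneg K0 in \<open>auto simp: \<alpha>1_def \<alpha>2_def \<omega>_def X_def\<close>)
  \<comment> \<open>Here \<open>16/11 * j_xy M T = 8 * M * T^2\<close>.\<close>
  have \<delta>1: "\<delta>\<^sub>1 = s * (16/11 * d * j_xy M T + sqrt d * p)"
    by (simp add: \<delta>1_def j_xy_def p_def p_xy_def)
  have \<delta>2: "\<delta>\<^sub>2 = q * s * p^2" by (simp add: \<delta>2_def p_def p_xy_def power_divide power_mult_distrib)
  have \<delta>pos: "0 < \<delta>\<^sub>1" "0 < \<delta>\<^sub>2"
    using s0 pos d1 \<beta> by (auto simp: \<delta>1 \<delta>2 intro!: mult_pos_pos add_nonneg_pos)
  \<comment> \<open>The positive root of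
    \<open>\<delta>\<^sub>2 * w^2 + \<delta>\<^sub>1 * w / (2 * l) = 1\<close> is, after
    rationalising, \<open>4 * l / (\<delta>\<^sub>1 + r)\<close> with \<open>r\<close> as below; the
    assumption on \<open>k\<close> says that \<open>w1\<close> does not exceed it. For
    \<open>W = 0\<close> the logarithm carries no information, but then
    \<open>w1 = 0\<close>.\<close>
  have hk: "s * (16/11 * d * j_xy M T + sqrt d * p) * w1 / (2 * l) + q * s * p^2 * w1^2 \<le> 1"
  proof (cases "W = 0")
    case True
    then show ?thesis by (simp add: w1_def)
  next
    case False
    define r where "r = sqrt (\<delta>\<^sub>1^2 + 16 * ln 2 * \<delta>\<^sub>2)"
    have r: "r^2 = \<delta>\<^sub>1^2 + 16 * l^2 * \<delta>\<^sub>2" "0 \<le> r" using \<delta>pos l(3) by (auto simp: r_def)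
    define y where "y = c\<^sub>1 * W / (4 * l) * (\<delta>\<^sub>1 + r)"
    have y: "0 < y" unfolding y_def using False W0 c1 l \<delta>pos r by (intro mult_pos_pos divide_pos_pos add_pos_nonneg) auto
    have "ln y / c\<^sub>2 \<le> real k" using k by (simp add: y_def r_def l_def W_def)
    then have "ln y \<le> c\<^sub>2 * real k" using c2 by (simp add: pos_divide_le_eq mult.commute)
    then have "exp (ln y) \<le> exp (c\<^sub>2 * real k)" by simp
    then have "y \<le> exp (c\<^sub>2 * real k)" using y by simp
    then have "y * exp (- c\<^sub>2 * real k) \<le> exp (c\<^sub>2 * real k) * exp (- c\<^sub>2 * real k)" by (intro mult_right_mono) auto
    also have "\<dots> = 1" by (simp flip: exp_add)
    finally have "w1 * (\<delta>\<^sub>1 + r) / (4 * l) \<le> 1" by (simp add: y_def w1_def mult_ac)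
    then have 1: "w1 * r \<le> 4 * l - w1 * \<delta>\<^sub>1" using l by (simp add: field_simps)
    have "(w1 * r)^2 \<le> (4 * l - w1 * \<delta>\<^sub>1)^2" by (rule power_mono[OF 1]) (use w10 r in auto)
    then have "w1^2 * (\<delta>\<^sub>1^2 + 16 * l^2 * \<delta>\<^sub>2) \<le> 16 * l^2 - 8 * l * w1 * \<delta>\<^sub>1 + w1^2 * \<delta>\<^sub>1^2"
      unfolding power_mult_distrib r(1)[symmetric] by (simp add: power2_eq_square algebra_simps)
    moreover have "(16 * l^2) * (\<delta>\<^sub>1 * w1 / (2 * l) + \<delta>\<^sub>2 * w1^2) = 8 * l * w1 * \<delta>\<^sub>1 + w1^2 * (16 * l^2 * \<delta>\<^sub>2)"
      using l(1) by (simp add: power2_eq_square field_simps)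
    ultimately have "(16 * l^2) * (\<delta>\<^sub>1 * w1 / (2 * l) + \<delta>\<^sub>2 * w1^2) \<le> (16 * l^2) * 1"
      unfolding distrib_left by linarith
    then have "\<delta>\<^sub>1 * w1 / (2 * l) + \<delta>\<^sub>2 * w1^2 \<le> 1" using l(1) by (subst (asm) mult_le_cancel_left_pos) auto
    then show ?thesis unfolding \<delta>1 \<delta>2 .
  qed
  have sq2: "sqrt (2 * ln 2) = sqrt 2 * l" by (simp add: l_def real_sqrt_mult)
  let ?U = "sqrt d * (6 * sqrt d * j_xy M T + p * u)" and ?V = "sqrt d * (6 * sqrt d * j_x M T + p_x L * u)"
  have UV: "0 < ?U" "0 \<le> ?V" using d1 pos u by (auto intro!: mult_pos_pos add_nonneg_pos)
  \<comment> \<open>Dropping the nonnegative summand \<open>h * ?V\<close> from the denominator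
    turns the first threshold for \<Delta> into \<open>l / (2 * s * ?U)\<close>.\<close>
  have D1: "\<Delta> * (s * ?U) \<le> l / 2"
  proof -
    have "\<Delta> \<le> sqrt 2 * l / (4 * s * (?U / sqrt 2 + h * ?V))"
      using \<Delta>_small by (simp add: sq2 p_def mult.assoc)
    moreover have den: "0 < 4 * s * (?U / sqrt 2 + h * ?V)"
    proof -
      have "0 < ?U / sqrt 2" using UV(1) by (rule divide_pos_pos) simp
      moreover have "0 \<le> h * ?V" using h_nonneg UV(2) by (rule mult_nonneg_nonneg)
      ultimately have "0 < ?U / sqrt 2 + h * ?V" by (rule add_pos_nonneg)
      then show ?thesis using s0 by (intro mult_pos_pos) auto
    qed
    ultimately have "\<Delta> * (4 * s * (?U / sqrt 2 + h * ?V)) \<le> sqrt 2 * l" by (simp add: pos_le_divide_eq)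
    moreover have "\<Delta> * (4 * s * (?U / sqrt 2)) \<le> \<Delta> * (4 * s * (?U / sqrt 2 + h * ?V))"
      using s0 UV h_nonneg \<Delta>_nonneg by (intro mult_left_mono) auto
    ultimately have "\<Delta> * (4 * s * (?U / sqrt 2)) \<le> sqrt 2 * l" by linarith
    then have "sqrt 2 * (\<Delta> * (4 * s * (?U / sqrt 2))) \<le> sqrt 2 * (sqrt 2 * l)" by (intro mult_left_mono) auto
    moreover have c: "sqrt 2 * (\<Delta> * (4 * s * (U / sqrt 2))) = 4 * (\<Delta> * (s * U))" for U by simp
    note c[of ?U]
    moreover have "sqrt 2 * (sqrt 2 * l) = 2 * l" by simp
    ultimately show ?thesis by linarith
  qed
  have D2: "8 * s * X * (p^2 * \<Delta>^2) \<le> 1"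
  proof -
    let ?Y = "8 * s * (p^2 * X + 2 * h^2 * (p_x L)^2 * X)"
    have Y: "8 * s * (p^2 * X) \<le> ?Y" "0 < 8 * s * (p^2 * X)" using s0 X0 pos by auto
    have Y0: "0 < ?Y" using Y by (rule less_le_trans[rotated])
    have "\<Delta> \<le> 1 / sqrt ?Y" using \<Delta>_small by (simp add: p_def X_def)
    then have "\<Delta>^2 \<le> (1 / sqrt ?Y)^2" using \<Delta>_nonneg by (intro power_mono) auto
    also have "\<dots> = 1 / ?Y" unfolding power_divide real_sqrt_pow2[OF less_imp_le[OF Y0]] by simp
    finally have "\<Delta>^2 * ?Y \<le> 1" using Y0 by (simp only: pos_le_divide_eq)
    moreover have "\<Delta>^2 * (8 * s * (p^2 * X)) \<le> \<Delta>^2 * ?Y" by (rule mult_left_mono[OF Y(1)]) simp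
    ultimately show ?thesis by (simp add: mult_ac)
  qed
  \<comment> \<open>In the degenerate cases the left side vanishes. Otherwise
    \<open>2 * sqrt 2 \<ge> 14/5\<close> produces 5/14.\<close>
  have K1: "h * K0 * (s * ?V) \<le> 5/14 * l"
  proof (cases "h = 0 \<or> ?V = 0 \<or> K0 = 0")
    case True
    then show ?thesis using l by auto
  next
    case False
    have V: "0 < ?V" using False UV(2) less_eq_real_def by metis
    have "K0 = K" "0 < K" using False hK K0 by (auto simp: K0_def)
    note KK = this V
    have "h \<le> l / (2 * sqrt 2 * s * ?V * K)"
      using h_small by (simp add: l_def mult.assoc)
    then have "h * (2 * sqrt 2 * s * ?V * K) \<le> l" using KK s0 by (simp add: pos_le_divide_eq)
    then have "2 * sqrt 2 * (h * K0 * (s * ?V)) \<le> l" by (simp add: KK(1) mult_ac)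
    moreover have "14/5 \<le> 2 * sqrt (2::real)"
    proof -
      have "7/5 \<le> sqrt (2::real)" by (rule real_le_rsqrt) (simp add: power2_eq_square)
      then show ?thesis by simp
    qed
    moreover have "0 \<le> h * K0 * (s * ?V)" using h_nonneg K0 s0 UV by auto
    ultimately have "14/5 * (h * K0 * (s * ?V)) \<le> l" by (meson mult_right_mono order_trans)
    then show ?thesis by simp
  qed
  have K2: "16 * s * X * (h^2 * (p_x L)^2 * K0^2) \<le> 1"
  proof (cases "h = 0 \<or> p_x L = 0 \<or> K0 = 0")
    case True
    then show ?thesis by auto
  next
    case False
    then have KK: "K0 = K" "0 < K" "0 < p_x L" using hK pos K0 by (auto simp: K0_def)
    have "h \<le> 1 / (4 * K * p_x L * sqrt (X * s))" using h_small by (simp add: X_def)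
    then have "h * (4 * K * p_x L * sqrt (X * s)) \<le> 1" using KK s0 X0 by (simp add: pos_le_divide_eq)
    then have "(h * (4 * K * p_x L * sqrt (X * s)))^2 \<le> 1^2" using h_nonneg KK s0 X0 by (intro power_mono) auto
    then show ?thesis using s0 X0 by (simp add: power_mult_distrib KK(1) mult_ac)
  qed
  note small0 = cst.small[OF hk D1 D2 K1 K2]
  define \<mu>k where "\<mu>k = kernel_pow Q k \<mu>"
  define E where "E = c\<^sub>1^2 * exp (- c\<^sub>2 * real k) * max 1 (W^2)"
  have E: "w1 \<le> E" "w1^2 \<le> E"
  proof -
    have e: "0 < exp (- c\<^sub>2 * real k)" "exp (- c\<^sub>2 * real k) \<le> 1" using c2 by auto
    have cc: "c\<^sub>1 \<le> c\<^sub>1^2" using c1 by (simp add: power2_eq_square)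
    have Wm: "W \<le> max 1 (W^2)"
      using W0 by (cases "W \<le> 1") (auto simp: power2_eq_square le_max_iff_disj)
    show "w1 \<le> E" unfolding w1_def E_def
      using cc Wm W0 c1 by (intro mult_mono mult_right_mono) auto
    have "w1^2 = c\<^sub>1^2 * (exp (- c\<^sub>2 * real k) * exp (- c\<^sub>2 * real k)) * W^2"
      by (simp add: w1_def power2_eq_square)
    also have "\<dots> \<le> c\<^sub>1^2 * (exp (- c\<^sub>2 * real k) * 1) * max 1 (W^2)"
      using e by (intro mult_mono mult_left_mono) auto
    finally show "w1^2 \<le> E" by (simp add: E_def)
  qed
  have wk: "W_psi \<mu>k \<nu>Q \<le> ennreal w1"
  proof -
    have Wm: "W_psi \<mu> \<nu>Q = ennreal W" using W_fin by (simp add: W_def less_top)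
    have "W_psi \<mu>k \<nu>Q \<le> ennreal (c\<^sub>1 * exp (- c\<^sub>2 * real k)) * W_psi \<mu> \<nu>Q"
    \<comment> \<open>\<open>contraction\<close> starts at one step; for zero steps
      \<open>c\<^sub>1 \<ge> 1\<close> suffices.\<close>
    proof (cases "k = 0")
      case True
      have "1 * ennreal W \<le> ennreal c\<^sub>1 * ennreal W" using c1 by (intro mult_right_mono) auto
      then show ?thesis using True by (simp add: \<mu>k_def kernel_pow_def Wm)
    next
      case False
      then show ?thesis using contraction mu unfolding \<mu>k_def by auto
    qed
    then show ?thesis using c1 W0 by (simp add: Wm w1_def ennreal_mult)
  qed
  \<comment> \<open>The bound and the moment condition as continuous functions of the two radii, so
    that radii enlarged by \<open>e\<close> can be sent to their limits.\<close>
  define bnd where "bnd w kk = A0 + l * (\<alpha>1 * w + \<alpha>2 * kk) + ln 2 * \<omega> * (5/4 * p^2 * w^2 + 5 * h^2 * (p_x L)^2 * kk^2)" for w kk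
  define gam where "gam w kk = \<beta> * \<alpha>1 * w / (2 * l) + \<beta> * \<omega> * (5/4 * p^2) * w^2
      + (\<beta> * \<alpha>2 * kk / (2 * l) + \<beta> * \<omega> * (5 * h^2 * (p_x L)^2) * kk^2)" for w kk
  have renyi_le: "renyi q (P_tilde grad T h \<mu>k) (target f) \<le> ereal (bnd (w1 + \<Delta> + e) (K0 + e))"
    if e: "0 < e" and g: "gam (w1 + \<Delta> + e) (K0 + e) \<le> 1" for e
  proof -
    have "W_psi \<mu>k \<nu>Q < ennreal (w1 + e / 3)" using wk e w10 by (auto simp: ennreal_less_iff intro: le_less_trans)
    then obtain P1 where P1: "P1 \<in> couplings \<mu>k \<nu>Q" "psi_bounded P1 (\<lambda>(x, y). x - y) (w1 + e / 3)"
      by (rule W_psi_lessE)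
    have "W_psi \<nu>Q (target f) < ennreal (\<Delta> + e / 3)" using bias e \<Delta>_nonneg by (auto simp: ennreal_less_iff intro: le_less_trans)
    then obtain P2 where P2: "P2 \<in> couplings \<nu>Q (target f)" "psi_bounded P2 (\<lambda>(x, y). x - y) (\<Delta> + e / 3)"
      by (rule W_psi_lessE)
    \<comment> \<open>One third of \<open>e\<close> for each of the two couplings and one for the
      gap in their gluing.\<close>
    have "0 < e / 3" using e by simp
    from couplings_triangle[OF P1 P2 this] obtain R where R: "R \<in> couplings \<mu>k (target f)"
      "psi_bounded R (\<lambda>(x, y). x - y) (w1 + e / 3 + (\<Delta> + e / 3) + e / 3)" by blast
    have we: "w1 + e / 3 + (\<Delta> + e / 3) + e / 3 = w1 + \<Delta> + e" by simp
    have "psi_norm (target f) (\<lambda>x. x) < ennreal (K0 + e)"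
      using K_nu e K0 by (auto simp: K0_def ennreal_less_iff max_def ennreal_neg split: if_splits intro: le_less_trans)
    then have kb: "psi_bounded (target f) (\<lambda>x. x) (K0 + e)" by (rule psi_norm_lessD)
    show ?thesis
      using renyi_P_tilde_le[OF h_nonneg _ q \<beta>_def s_def u hu d_def A0_def \<alpha>1_def[unfolded p_def] \<alpha>2_def \<omega>_def R(1) R(2)[unfolded we] kb]
        h_grid g unfolding bnd_def gam_def l_def p_def by simp
  qed
  have lim0: "((\<lambda>e. w1 + \<Delta> + e) \<longlongrightarrow> w1 + \<Delta>) (at_right 0)" "((\<lambda>e. K0 + e) \<longlongrightarrow> K0) (at_right 0)"
    by (auto intro!: tendsto_eq_intros)
  have "((\<lambda>e. gam (w1 + \<Delta> + e) (K0 + e)) \<longlongrightarrow> gam (w1 + \<Delta>) K0) (at_right 0)"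
    unfolding gam_def using l by (intro tendsto_intros lim0) auto
  moreover have "gam (w1 + \<Delta>) K0 < 1" using small0 by (simp add: gam_def)
  ultimately have "\<forall>\<^sub>F e in at_right 0. gam (w1 + \<Delta> + e) (K0 + e) < 1" by (rule order_tendstoD(2))
  then have ev: "\<forall>\<^sub>F e in at_right 0. renyi q (P_tilde grad T h \<mu>k) (target f) \<le> ereal (bnd (w1 + \<Delta> + e) (K0 + e))"
    using eventually_at_right_less[of 0] by eventually_elim (auto intro: renyi_le)
  have lim: "((\<lambda>e. ereal (bnd (w1 + \<Delta> + e) (K0 + e))) \<longlongrightarrow> ereal (bnd (w1 + \<Delta>) K0)) (at_right 0)"
    unfolding bnd_def by (intro tendsto_intros lim0)
  have main: "renyi q (P_tilde grad T h \<mu>k) (target f) \<le> ereal (bnd (w1 + \<Delta>) K0)"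
    by (rule tendsto_lowerbound[OF lim ev]) simp
  have KY: "K0 \<le> \<Delta> + K0 + sqrt (\<Delta>^2 + K0^2)" using \<Delta>_nonneg by simp
  have "bnd (w1 + \<Delta>) K0 \<le> 3/2 * (16/11 * d * j_xy M T + sqrt d * p + q * p^2) * l * E
      + (d * h * (6 * j_c T + 6 * sqrt d * j_v M T + 108 * s * d * h * (j_v M T)^2 + h * (p_v T)^2 + 2 * p_v T)
         + 2 * sqrt d * (6 * sqrt d * j_xy M T + p * u) * \<Delta> + p^2 * X * \<Delta>^2
         + 2 * h * sqrt d * (6 * sqrt d * j_x M T + p_x L * u) * (\<Delta> + K0 + sqrt (\<Delta>^2 + K0^2)) + 2 * h^2 * (p_x L)^2 * X * (\<Delta>^2 + K0^2))"
    using cst.bound[OF E KY pos(6,7) less_imp_le[OF pos(2)]] unfolding bnd_def A0_def l(3) .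
  also have "3/2 * (16/11 * d * j_xy M T + sqrt d * p + q * p^2) * l * E = 3 * (\<delta>\<^sub>1 + \<delta>\<^sub>2) / (2 * (2 * q - 1)) * l * E"
    using s0 unfolding s_def[symmetric] by (simp add: \<delta>1 \<delta>2 field_simps)
  \<comment> \<open>If \<open>K0\<close> differs from \<open>K\<close>, then \<open>h = 0\<close>
    and every term containing either of them vanishes.\<close>
  also have "d * h * (6 * j_c T + 6 * sqrt d * j_v M T + 108 * s * d * h * (j_v M T)^2 + h * (p_v T)^2 + 2 * p_v T)
         + 2 * sqrt d * (6 * sqrt d * j_xy M T + p * u) * \<Delta> + p^2 * X * \<Delta>^2
         + 2 * h * sqrt d * (6 * sqrt d * j_x M T + p_x L * u) * (\<Delta> + K0 + sqrt (\<Delta>^2 + K0^2)) + 2 * h^2 * (p_x L)^2 * X * (\<Delta>^2 + K0^2) = B"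
    using hK by (auto simp: B_def p_def X_def)
  finally have "bnd (w1 + \<Delta>) K0 \<le> 3 * (\<delta>\<^sub>1 + \<delta>\<^sub>2) / (2 * (2 * q - 1)) * l * E + B" .
  then have "renyi q (P_tilde grad T h \<mu>k) (target f) \<le> ereal (3 * (\<delta>\<^sub>1 + \<delta>\<^sub>2) / (2 * (2 * q - 1)) * l * E + B)"
    using main by (meson ereal_less_eq(3) order_trans)
  moreover have "3 * (\<delta>\<^sub>1 + \<delta>\<^sub>2) / (2 * (2 * q - 1)) * l * E = 3 * (\<delta>\<^sub>1 + \<delta>\<^sub>2) / (2 * (2 * q - 1)) * sqrt (ln 2) * c\<^sub>1^2 * exp (- c\<^sub>2 * real k)
                 * max 1 ((enn2real (W_psi \<mu> \<nu>Q))^2)"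
    by (simp only: E_def l_def W_def mult.assoc)
  ultimately show "renyi q (P_tilde grad T h (kernel_pow Q k \<mu>)) (target f)
       \<le> ereal (3 * (\<delta>\<^sub>1 + \<delta>\<^sub>2) / (2 * (2 * q - 1)) * sqrt (ln 2) * c\<^sub>1^2 * exp (- c\<^sub>2 * real k)
                 * max 1 ((enn2real (W_psi \<mu> \<nu>Q))^2) + B)"
    by (simp only: \<mu>k_def)
qed

end
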